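(* Let $P$ be a finite poset. Then $f_2^\Delta(\mathcal{O}(P))\le f_2^\Delta(\mathcal{C}(P))$, with equality holding if and only if $P$ is $\mathbf{X}$-free.
   Context: For a finite poset $P$, the order polytope is $\mathcal{O}(P)=\{x\in\mathbb{R}^P: 0\le x_p\le 1 \text{ for all } p\in P,\ x_p\le x_q \text{ whenever } p\le q\}$ and the chain polytope is $\mathcal{C}(P)=\{x\in\mathbb{R}^P: x_p\ge 0 \text{ for all } p,\ x_{p_1}+\dots+x_{p_k}\le 1 \text{ whenever } p_1<\dots<p_k \text{ in } P\}$. For a polytope $\mathcal{P}$, $f_2^\Delta(\mathcal{P})$ is the number of $2$-dimensional faces of $\mathcal{P}$ having exactly three vertices. $\mathbf{X}$ denotes the five-element poset with elements $d_1,d_2,e,u_1,u_2$ where $d_1,d_2<e<u_1,u_2$, $d_1\parallel d_2$ and $u_1\parallel u_2$; $P$ is $\mathbf{X}$-free if it contains no (induced) subposet isomorphic to $\mathbf{X}$. *)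

theory Defs
  imports "HOL-Analysis.Analysis"
begin

text \<open>
  A finite poset is a set \<open>P\<close> over a finite type together with a relation \<open>r\<close> satisfying
  \<open>partial_order_on P r\<close>; \<open>(p, q) \<in> r\<close> means that \<open>p\<close> is below or equal to \<open>q\<close>.
  Using a carrier set, rather than the whole type, keeps the empty poset in scope.
  The space of real vectors indexed by \<open>P\<close> is identified with the coordinate subspace
  of \<open>real ^ 'a\<close> in which all coordinates outside \<open>P\<close> vanish.
\<close>

definition order_polytope :: "'a::finite set \<Rightarrow> 'a rel \<Rightarrow> (real ^ 'a) set" where
  "order_polytope P r =
     {x. (\<forall>p. p \<notin> P \<longrightarrow> x $ p = 0) \<and>
         (\<forall>p\<in>P. 0 \<le> x $ p \<and> x $ p \<le> 1) \<and>
         (\<forall>p\<in>P. \<forall>q\<in>P. (p, q) \<in> r \<longrightarrow> x $ p \<le> x $ q)}"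

definition chain_polytope :: "'a::finite set \<Rightarrow> 'a rel \<Rightarrow> (real ^ 'a) set" where
  "chain_polytope P r =
     {x. (\<forall>p. p \<notin> P \<longrightarrow> x $ p = 0) \<and>
         (\<forall>p\<in>P. 0 \<le> x $ p) \<and>
         (\<forall>ps. set ps \<subseteq> P \<and> sorted_wrt (\<lambda>p q. (p, q) \<in> r \<and> p \<noteq> q) ps
               \<longrightarrow> (\<Sum>p\<leftarrow>ps. x $ p) \<le> 1)}"

definition num_triangular_faces :: "'v::euclidean_space set \<Rightarrow> nat" where
  "num_triangular_faces S =
     card {F. F face_of S \<and> aff_dim F = 2 \<and> card {v. v extreme_point_of F} = 3}"

definition poset_isomorphic :: "'a set \<Rightarrow> 'a rel \<Rightarrow> 'b set \<Rightarrow> 'b rel \<Rightarrow> bool" where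
  "poset_isomorphic P r Q s \<longleftrightarrow>
     (\<exists>f. bij_betw f P Q \<and> (\<forall>a\<in>P. \<forall>b\<in>P. (a, b) \<in> r \<longleftrightarrow> (f a, f b) \<in> s))"

datatype X_elem = D1 | D2 | E | U1 | U2

definition X_rel :: "X_elem rel" where
  "X_rel = Id \<union> {D1, D2} \<times> {E, U1, U2} \<union> {E} \<times> {U1, U2}"

lemma partial_order_on_X_rel: "partial_order_on UNIV X_rel"
  by (auto simp: partial_order_on_def preorder_on_def X_rel_def refl_on_def
      intro!: transI antisymI)

definition X_free :: "'a set \<Rightarrow> 'a rel \<Rightarrow> bool" where
  "X_free P r \<longleftrightarrow> \<not> (\<exists>Q\<subseteq>P. poset_isomorphic Q (Restr r Q) UNIV X_rel)"

end

theory Submission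
  imports Defs
begin

text \<open>
  Vertices of the order polytope are indicators of filters, vertices of the chain polytope are
  indicators of antichains. Triangular faces of the former are chains \<open>F \<subset> G \<subset> H\<close> of filters whose
  three differences are connected; triangular faces of the latter are triples of antichains whose
  pairwise symmetric differences are connected. Both kinds of triple are sorted by a common
  \<^emph>\<open>frame\<close> \<open>(A, C, X, Y)\<close>: \<open>A\<close> and \<open>C\<close> contain the minimal and the maximal elements of the
  connected region \<open>H - F\<close>, and \<open>X \<subseteq> A\<close>, \<open>Y \<subseteq> C\<close> record how the third set meets them. What remains
  to be chosen inside the frame is, for the order polytope, an order ideal \<open>I\<close> of a poset \<open>Q\<close> with
  \<open>L I\<close> and \<open>U (Q - I)\<close>, and for the chain polytope an antichain \<open>B\<close> of \<open>Q\<close> with \<open>L B\<close> and \<open>U B\<close>,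
  for two connectivity conditions \<open>L\<close>, \<open>U\<close> that are monotone under dominance from above and from below.
  Removing a minimal element of \<open>Q\<close> shows that there are at least as many antichains as ideals,
  by the same supermodularity that underlies Kleitman's correlation inequality. The defect vanishes
  if no element of \<open>Q\<close> joins two components both below and above itself, and such an element is the
  centre of a copy of the forbidden five-element poset; conversely such a copy gives a frame with a
  positive defect.
\<close>

section \<open>Triangular faces of polytopes with 0/1 vertices\<close>

text \<open>Filters and antichains correspond by taking minimal elements, but this correspondence
  does not carry faces to faces, so triples must be sorted by data visible on both sides. Frames
  serve for this because connectedness of a region can be tested on any subset that bounds it from
  below and from above (\<open>order_connected_dominate\<close>); therefore an ideal and an
  antichain of the middle part enter literally the same predicates \<open>L\<close> and
  \<open>U\<close>. The remaining difference is that for an ideal \<open>I\<close> the condition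
  \<open>L\<close> sees only the maximal elements of \<open>I\<close> and \<open>U\<close> only the
  minimal elements of \<open>Q - I\<close>, which are two different antichains, while a cut has to
  satisfy both conditions with one antichain. The inequality is therefore a correlation effect. Its
  local gain at a minimal element \<open>q\<close> counts the antichains for which adding
  \<open>q\<close> turns both conditions from false to true.\<close>

definition indvec :: "'a::finite set \<Rightarrow> real ^ 'a" where
  "indvec A = (\<chi> i. if i \<in> A then 1 else 0)"

lemma indvec_nth [simp]: "indvec A $ i = (if i \<in> A then 1 else 0)"
  by (simp add: indvec_def)

lemma indvec_eq_iff [simp]: "indvec A = indvec B \<longleftrightarrow> A = B"
  by (auto simp: vec_eq_iff split: if_splits)

lemma inj_indvec: "inj indvec"
  by (simp add: inj_def)

text \<open>A strict convex combination of two numbers in [0, 1] is 0 or 1 only if both equal it, so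
  no open segment inside the cube passes through a 0/1 vector.\<close>

lemma indvec_extreme_point:
  fixes K :: "(real ^ 'a::finite) set"
  assumes "indvec A \<in> K" and K: "\<And>x i. x \<in> K \<Longrightarrow> 0 \<le> x $ i \<and> x $ i \<le> 1"
  shows "indvec A extreme_point_of K"
  unfolding extreme_point_of_def
proof (intro conjI ballI notI)
  fix x y assume xy: "x \<in> K" "y \<in> K" and "indvec A \<in> open_segment x y"
  then obtain u where u: "0 < u" "u < 1" "x \<noteq> y" "indvec A = (1 - u) *\<^sub>R x + u *\<^sub>R y"
    by (auto simp: in_segment)
  have "x $ i = y $ i" for i
  proof -
    have e: "indvec A $ i = (1 - u) * x $ i + u * y $ i"
      using u(4) by simp
    have b: "0 \<le> x $ i" "x $ i \<le> 1" "0 \<le> y $ i" "y $ i \<le> 1"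
      using K[OF xy(1)] K[OF xy(2)] by auto
    show ?thesis
    proof (cases "i \<in> A")
      case True
      then have "(1 - u) * (1 - x $ i) + u * (1 - y $ i) = 0"
        using e by (simp add: algebra_simps)
      then show ?thesis
        using b u by (simp add: add_nonneg_eq_0_iff)
    next
      case False
      then have "(1 - u) * x $ i + u * y $ i = 0"
        using e by simp
      then show ?thesis
        using b u by (simp add: add_nonneg_eq_0_iff)
    qed
  qed
  then show False
    using u(3) by (simp add: vec_eq_iff)
qed (rule assms(1))

lemma convex_hull_indvec_cube:
  assumes "x \<in> convex hull (indvec ` T)"
  shows "0 \<le> x $ i \<and> x $ i \<le> 1"
proof -
  have "convex hull (indvec ` T) \<subseteq> {x. 0 \<le> x $ i \<and> x $ i \<le> 1}"
  proof (rule hull_minimal)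
    have "{x::real^'a. 0 \<le> x $ i \<and> x $ i \<le> 1} = {x. axis i 1 \<bullet> x \<ge> 0} \<inter> {x. axis i 1 \<bullet> x \<le> 1}"
      by (auto simp: inner_axis')
    then show "convex {x::real^'a. 0 \<le> x $ i \<and> x $ i \<le> 1}"
      by (simp add: convex_Int convex_halfspace_le convex_halfspace_ge)
  qed auto
  then show ?thesis
    using assms by blast
qed

lemma extreme_points_convex_hull_indvec:
  "{v. v extreme_point_of (convex hull (indvec ` T))} = indvec ` T"
proof
  show "indvec ` T \<subseteq> {v. v extreme_point_of (convex hull (indvec ` T))}"
  proof clarify
    fix A assume "A \<in> T"
    then have "indvec A \<in> convex hull (indvec ` T)"
      by (simp add: hull_inc)
    then show "indvec A extreme_point_of (convex hull (indvec ` T))"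
      by (rule indvec_extreme_point) (rule convex_hull_indvec_cube)
  qed
qed (auto dest: extreme_point_of_convex_hull)

lemma indvec_in_convex_hull_iff [simp]: "indvec A \<in> convex hull (indvec ` T) \<longleftrightarrow> A \<in> T"
proof
  assume "indvec A \<in> convex hull (indvec ` T)"
  then have "indvec A extreme_point_of (convex hull (indvec ` T))"
    by (rule indvec_extreme_point) (rule convex_hull_indvec_cube)
  then show "A \<in> T"
    by (auto dest: extreme_point_of_convex_hull)
qed (auto intro: hull_inc)

text \<open>A vector between two others would lie in their hull without being one of its vertices.
  Thus the dimension condition in \<open>num_triangular_faces\<close> comes for free.\<close>

lemma aff_dim_three_indvec:
  assumes "card T = 3"
  shows "aff_dim (convex hull (indvec ` T)) = 2"
proof -
  from assms obtain A B C where T: "T = {A, B, C}" and ne: "A \<noteq> B" "A \<noteq> C" "B \<noteq> C"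
    by (auto simp: card_3_iff)
  have not_between: "\<not> between (indvec X, indvec Y) (indvec Z)" if "Z \<noteq> X" "Z \<noteq> Y" for X Y Z :: "'a set"
  proof
    assume "between (indvec X, indvec Y) (indvec Z)"
    then have "indvec Z \<in> convex hull (indvec ` {X, Y})"
      by (simp add: between_mem_segment segment_convex_hull)
    then show False
      \<comment> \<open>Without \<open>image_insert\<close> the hull keeps the shape matched by
        \<open>indvec_in_convex_hull_iff\<close>.\<close>
      using that by (simp del: image_insert)
  qed
  have "\<not> collinear (indvec ` T)"
    using not_between ne by (auto simp: T collinear_between_cases)
  then have "aff_dim (indvec ` T) > 1"
    by (simp add: collinear_aff_dim)
  moreover have "aff_dim (indvec ` T) \<le> of_nat (card (indvec ` T)) - 1"
    by (rule aff_dim_le_card) simp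
  moreover have "card (indvec ` T) = 3"
    using assms by (simp add: card_image inj_on_subset[OF inj_indvec])
  ultimately show ?thesis
    by (simp add: aff_dim_convex_hull)
qed

text \<open>A face of a compact convex set is the hull of its extreme points (Krein-Milman), and
  these are vertices of \<open>S\<close>; so triangular faces may be counted as triples of
  sets.\<close>

lemma num_triangular_faces_indvec:
  fixes S :: "(real ^ 'a::finite) set"
  assumes S: "compact S" "convex S" and ext: "{v. v extreme_point_of S} = indvec ` V"
  shows "num_triangular_faces S = card {T. T \<subseteq> V \<and> card T = 3 \<and> (convex hull (indvec ` T)) face_of S}"
proof -
  let ?N = "{T. T \<subseteq> V \<and> card T = 3 \<and> (convex hull (indvec ` T)) face_of S}"
  let ?F = "{F. F face_of S \<and> aff_dim F = 2 \<and> card {v. v extreme_point_of F} = 3}"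
  let ?h = "\<lambda>T. convex hull (indvec ` T)"
  have "inj_on ?h ?N"
  proof (rule inj_onI)
    fix T U :: "'a set set" assume "?h T = ?h U"
    then have "indvec ` T = indvec ` U"
      by (metis extreme_points_convex_hull_indvec)
    then show "T = U"
      by (simp add: inj_image_eq_iff inj_indvec)
  qed
  moreover have "?h ` ?N = ?F"
  proof (intro equalityI subsetI)
    fix F assume "F \<in> ?h ` ?N"
    then obtain T where T: "T \<subseteq> V" "card T = 3" "?h T face_of S" and F: "F = ?h T"
      by blast
    have "card (indvec ` T) = 3"
      using T by (simp add: card_image inj_on_subset[OF inj_indvec])
    then show "F \<in> ?F"
      using T by (simp add: F extreme_points_convex_hull_indvec aff_dim_three_indvec)
  next
    fix F assume F: "F \<in> ?F"
    define T where "T = {A. indvec A extreme_point_of F}"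
    have "{v. v extreme_point_of F} \<subseteq> indvec ` V"
      using F ext extreme_point_of_face by blast
    then have eq: "{v. v extreme_point_of F} = indvec ` T"
      by (auto simp: T_def)
    have "F = convex hull {v. v extreme_point_of F}"
      using F S by (intro Krein_Milman_Minkowski)
        (auto intro: face_of_imp_compact face_of_imp_convex)
    then have "F = ?h T"
      by (simp add: eq)
    moreover have "card T = 3"
    proof -
      have "card (indvec ` T) = card T"
        by (rule card_image) (rule inj_on_subset[OF inj_indvec subset_UNIV])
      moreover have "card (indvec ` T) = 3"
        using F by (simp flip: eq)
      ultimately show ?thesis
        by simp
    qed
    moreover have "indvec ` T \<subseteq> indvec ` V"
      using eq \<open>{v. v extreme_point_of F} \<subseteq> indvec ` V\<close> by simp
    then have "T \<subseteq> V"
      by auto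
    ultimately show "F \<in> ?h ` ?N"
      using F by blast
  qed
  ultimately have "card ?F = card ?N"
    using card_image[of ?h ?N] by argo
  then show ?thesis
    unfolding num_triangular_faces_def .
qed

text \<open>The midpoint of two vertices of the face is also the midpoint of \<open>A'\<close> and
  \<open>B'\<close>, so the face contains both, and the third vertex of a triangle cannot belong to
  such a pair. All necessary conditions on faces come from exhibiting a second pair with the same
  sum.\<close>

lemma convex_hull_face_of_exchange:
  assumes face: "convex hull (indvec ` T) face_of S" and T: "card T = 3" "A \<in> T" "B \<in> T" "A \<noteq> B"
    and S: "indvec A' \<in> S" "indvec B' \<in> S"
    and AB: "A' \<inter> B' = A \<inter> B" "A' \<union> B' = A \<union> B"
  shows "A' = A \<or> A' = B"
proof (rule ccontr)
  assume neg: "\<not> (A' = A \<or> A' = B)"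
  let ?m = "midpoint (indvec A) (indvec B)"
  have sum: "indvec A + indvec B = indvec A' + indvec B'"
  proof -
    have "i \<in> A' \<and> i \<in> B' \<longleftrightarrow> i \<in> A \<and> i \<in> B" "i \<in> A' \<or> i \<in> B' \<longleftrightarrow> i \<in> A \<or> i \<in> B" for i
      using AB by blast+
    then show ?thesis
      unfolding vec_eq_iff by (simp add: if_distrib) metis
  qed
  have "A' \<noteq> B'"
    using AB T(4) by blast
  moreover have "?m = midpoint (indvec A') (indvec B')"
    by (simp add: midpoint_def sum)
  ultimately have "?m \<in> open_segment (indvec A') (indvec B')"
    by simp
  moreover have "?m \<in> convex hull (indvec ` T)"
    using T by (meson convex_convex_hull convex_contains_segment hull_inc imageI midpoint_in_closed_segment subsetD)
  ultimately have "A' \<in> T" "B' \<in> T"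
    using face_ofD[OF face _ S] by auto
  moreover obtain Z where Z: "T = {A, B, Z}" "Z \<noteq> A" "Z \<noteq> B"
    using T unfolding card_3_iff by blast
  ultimately have "A' = Z" "B' \<in> {A, B, Z}"
    using neg by blast+
  \<comment> \<open>\<open>B'\<close> is neither \<open>A\<close> nor \<open>B\<close>, since the
    intersection and union would then make \<open>A'\<close> the other one; and
    \<open>B' = Z\<close> would give \<open>A \<inter> B = A \<union> B\<close>.\<close>
  then show False
    using neg AB T(4) Z by blast
qed

text \<open>The valid inequalities that are tight on \<open>T\<close> cut out a face containing
  \<open>T\<close>. By \<open>only\<close>, their equalities hold at no vertex outside
  \<open>T\<close>; an application may test whichever inequalities are convenient.\<close>

lemma convex_hull_face_of_tight:
  fixes S :: "(real ^ 'a::finite) set"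
  assumes S: "compact S" "convex S" and ext: "{v. v extreme_point_of S} = indvec ` V"
    and T: "T \<subseteq> V"
    and only: "\<And>A. A \<in> V \<Longrightarrow>
      (\<And>w c. (\<And>x. x \<in> S \<Longrightarrow> w \<bullet> x \<le> c) \<Longrightarrow> (\<And>B. B \<in> T \<Longrightarrow> w \<bullet> indvec B = c) \<Longrightarrow> w \<bullet> indvec A = c)
      \<Longrightarrow> A \<in> T"
  shows "convex hull (indvec ` T) face_of S"
proof -
  define W where "W = {(w, c). (\<forall>x\<in>S. w \<bullet> x \<le> c) \<and> (\<forall>B\<in>T. w \<bullet> indvec B = c)}"
  \<comment> \<open>Inserting \<open>S\<close> makes the family visibly nonempty, as
    \<open>face_of_Inter\<close> demands.\<close>
  define F where "F = \<Inter> (insert S ((\<lambda>(w, c). S \<inter> {x. w \<bullet> x = c}) ` W))"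
  have F: "F face_of S"
    unfolding F_def
    using S by (intro face_of_Inter)
      (auto simp: W_def intro!: face_of_refl face_of_Int_supporting_hyperplane_le)
  have F_iff: "x \<in> F \<longleftrightarrow> x \<in> S \<and> (\<forall>(w, c)\<in>W. w \<bullet> x = c)" for x
    by (auto simp: F_def)
  have "F = convex hull {v. v extreme_point_of F}"
    using F S by (intro Krein_Milman_Minkowski) (auto intro: face_of_imp_compact face_of_imp_convex)
  also have "{v. v extreme_point_of F} = indvec ` T"
  proof (intro equalityI subsetI)
    fix v assume "v \<in> {v. v extreme_point_of F}"
    then have v: "v extreme_point_of S" "v \<in> F"
      using extreme_point_of_face[OF F] by auto
    then obtain A where A: "v = indvec A" "A \<in> V"
      using ext by auto
    have "A \<in> T"
    proof (rule only[OF A(2)])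
      fix w c assume "\<And>x. x \<in> S \<Longrightarrow> w \<bullet> x \<le> c" "\<And>B. B \<in> T \<Longrightarrow> w \<bullet> indvec B = c"
      then have "(w, c) \<in> W"
        by (simp add: W_def)
      moreover have "\<forall>(w, c)\<in>W. w \<bullet> indvec A = c"
        using v(2) unfolding F_iff A(1) by (rule conjunct2)
      ultimately show "w \<bullet> indvec A = c"
        by auto
    qed
    then show "v \<in> indvec ` T"
      by (simp add: A(1))
  next
    fix v assume "v \<in> indvec ` T"
    then obtain A where A: "v = indvec A" "A \<in> T"
      by auto
    then have "v extreme_point_of S"
      using ext T by blast
    moreover from this have "v \<in> S"
      by (simp add: extreme_point_of_def)
    then have "v \<in> F"
      using A by (auto simp: F_iff W_def)
    ultimately show "v \<in> {v. v extreme_point_of F}"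
      using extreme_point_of_face[OF F] by auto
  qed
  finally show ?thesis
    using F by simp
qed

section \<open>Splits and cuts of a finite poset\<close>

definition down_closed :: "'a rel \<Rightarrow> 'a set \<Rightarrow> 'a set \<Rightarrow> bool" where
  "down_closed r Q I \<longleftrightarrow> I \<subseteq> Q \<and> (\<forall>x\<in>Q. \<forall>y\<in>I. (x, y) \<in> r \<longrightarrow> x \<in> I)"

definition antichain :: "'a rel \<Rightarrow> 'a set \<Rightarrow> bool" where
  "antichain r A \<longleftrightarrow> (\<forall>x\<in>A. \<forall>y\<in>A. (x, y) \<in> r \<longrightarrow> x = y)"

text \<open>For a preorder on \<open>Q\<close> this means that \<open>L\<close> depends only on the
  down-set generated by its argument and grows with it; with \<open>r\<inverse>\<close>, on the
  up-set.\<close>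

definition dominance_mono :: "'a rel \<Rightarrow> 'a set \<Rightarrow> ('a set \<Rightarrow> bool) \<Rightarrow> bool" where
  "dominance_mono r Q L \<longleftrightarrow>
     (\<forall>S T. S \<subseteq> Q \<longrightarrow> T \<subseteq> Q \<longrightarrow> (\<forall>s\<in>S. \<exists>t\<in>T. (s, t) \<in> r) \<longrightarrow> L S \<longrightarrow> L T)"

definition splits :: "'a rel \<Rightarrow> 'a set \<Rightarrow> ('a set \<Rightarrow> bool) \<Rightarrow> ('a set \<Rightarrow> bool) \<Rightarrow> 'a set set" where
  "splits r Q L U = {I. down_closed r Q I \<and> L I \<and> U (Q - I)}"

definition cuts :: "'a rel \<Rightarrow> 'a set \<Rightarrow> ('a set \<Rightarrow> bool) \<Rightarrow> ('a set \<Rightarrow> bool) \<Rightarrow> 'a set set" where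
  "cuts r Q L U = {B. B \<subseteq> Q \<and> antichain r B \<and> L B \<and> U B}"

lemma dominance_monoD:
  "\<lbrakk>dominance_mono r Q L; S \<subseteq> Q; T \<subseteq> Q; \<And>s. s \<in> S \<Longrightarrow> \<exists>t\<in>T. (s, t) \<in> r; L S\<rbrakk> \<Longrightarrow> L T"
  unfolding dominance_mono_def by simp

lemma dominance_mono_subset:
  assumes "dominance_mono r Q L" "R \<subseteq> Q"
  shows "dominance_mono r R L"
  unfolding dominance_mono_def
proof (intro allI impI)
  fix S T assume "S \<subseteq> R" "T \<subseteq> R" "\<forall>s\<in>S. \<exists>t\<in>T. (s, t) \<in> r" "L S"
  then show "L T"
    using assms by (intro dominance_monoD[of r Q L S T]) auto
qed

lemma dominance_mono_insert:
  assumes "dominance_mono r Q L" "q \<in> Q" "(q, q) \<in> r" "R \<subseteq> Q"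
  shows "dominance_mono r R (\<lambda>S. L (insert q S))"
  unfolding dominance_mono_def
proof (intro allI impI)
  fix S T assume "S \<subseteq> R" "T \<subseteq> R" "\<forall>s\<in>S. \<exists>t\<in>T. (s, t) \<in> r" "L (insert q S)"
  then show "L (insert q T)"
    using assms by (intro dominance_monoD[of r Q L "insert q S" "insert q T"]) auto
qed

lemma finite_splits [simp]: "finite Q \<Longrightarrow> finite (splits r Q L U)"
  by (rule finite_subset[of _ "Pow Q"]) (auto simp: splits_def down_closed_def)

lemma finite_cuts [simp]: "finite Q \<Longrightarrow> finite (cuts r Q L U)"
  by (rule finite_subset[of _ "Pow Q"]) (auto simp: cuts_def)

text \<open>Inclusion-exclusion with the error term kept: the last summand becomes the gain of cuts
  over splits.\<close>

lemma card_supermodular: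
  assumes "finite A" "\<And>x. x \<in> A \<Longrightarrow> L x \<Longrightarrow> L' x" "\<And>x. x \<in> A \<Longrightarrow> U x \<Longrightarrow> U' x"
  shows "card {x\<in>A. L x \<and> U x} + card {x\<in>A. L' x \<and> U' x} =
         card {x\<in>A. L' x \<and> U x} + card {x\<in>A. L x \<and> U' x} + card {x\<in>A. L' x \<and> U' x \<and> \<not> L x \<and> \<not> U x}"
proof -
  let ?E = "{x\<in>A. L' x \<and> U' x \<and> \<not> L x \<and> \<not> U x}"
  have "{x\<in>A. L' x \<and> U' x} = ({x\<in>A. L' x \<and> U x} \<union> {x\<in>A. L x \<and> U' x}) \<union> ?E"
    using assms by blast
  moreover have "card (({x\<in>A. L' x \<and> U x} \<union> {x\<in>A. L x \<and> U' x}) \<union> ?E) =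
    card ({x\<in>A. L' x \<and> U x} \<union> {x\<in>A. L x \<and> U' x}) + card ?E"
    using assms(1) by (intro card_Un_disjoint) auto
  moreover have "{x\<in>A. L x \<and> U x} = {x\<in>A. L' x \<and> U x} \<inter> {x\<in>A. L x \<and> U' x}"
    using assms by blast
  moreover have "card {x\<in>A. L' x \<and> U x} + card {x\<in>A. L x \<and> U' x} =
    card ({x\<in>A. L' x \<and> U x} \<union> {x\<in>A. L x \<and> U' x}) + card ({x\<in>A. L' x \<and> U x} \<inter> {x\<in>A. L x \<and> U' x})"
    using assms(1) by (intro card_Un_Int) auto
  ultimately show ?thesis
    by simp
qed

section \<open>Recursion on a minimal element\<close>

context
  fixes r :: "'a rel" and Q :: "'a set" and q :: 'a
    and Q1 Q2 :: "'a set"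
  assumes trans: "trans r" and fin: "finite Q" and refl: "refl_on Q r" and q: "q \<in> Q" "(q, q) \<in> r"
    and min: "\<And>x. x \<in> Q \<Longrightarrow> (x, q) \<in> r \<Longrightarrow> x = q"
  defines "Q1 \<equiv> Q - {q}" and "Q2 \<equiv> {x\<in>Q. (q, x) \<notin> r}"
begin

lemma Q2_subset: "Q2 \<subseteq> Q1"
  using q by (auto simp: Q1_def Q2_def)

text \<open>An ideal containing \<open>q\<close> is \<open>q\<close> plus an ideal of
  \<open>Q1\<close>. An ideal avoiding \<open>q\<close> avoids everything above \<open>q\<close>, so
  it is an ideal of \<open>Q2\<close>; on the upper side \<open>q\<close> alone then stands for its
  whole up-set, by dominance in \<open>r\<inverse>\<close>.\<close>

lemma card_splits_rec:
  assumes "dominance_mono (r\<inverse>) Q U"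
  shows "card (splits r Q L U) =
    card (splits r Q1 (\<lambda>S. L (insert q S)) U) + card (splits r Q2 L (\<lambda>S. U (insert q S)))"
proof -
  have U_eq: "U (Q - I) \<longleftrightarrow> U (insert q (Q2 - I))" if "down_closed r Q I" "q \<notin> I" for I
  proof
    assume "U (Q - I)"
    then show "U (insert q (Q2 - I))"
      by (rule dominance_monoD[OF assms, rotated 3]) (use q refl that in \<open>auto simp: Q2_def refl_on_def\<close>)
  next
    assume "U (insert q (Q2 - I))"
    then show "U (Q - I)"
      by (rule dominance_monoD[OF assms, rotated 3]) (use q refl that in \<open>auto simp: Q2_def refl_on_def\<close>)
  qed
  let ?A = "splits r Q1 (\<lambda>S. L (insert q S)) U" and ?B = "splits r Q2 L (\<lambda>S. U (insert q S))"
  have sub: "I \<subseteq> Q2" if "down_closed r Q I" "q \<notin> I" for I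
    using that q by (auto simp: down_closed_def Q2_def)
  have "splits r Q L U = insert q ` ?A \<union> ?B"
  proof (intro equalityI subsetI)
    fix I assume I: "I \<in> splits r Q L U"
    show "I \<in> insert q ` ?A \<union> ?B"
    proof (cases "q \<in> I")
      case True
      have "I - {q} \<in> ?A"
      proof -
        have "Q1 - (I - {q}) = Q - I" "insert q (I - {q}) = I"
          using True by (auto simp: Q1_def)
        then show ?thesis
          using I by (auto simp: splits_def down_closed_def Q1_def)
      qed
      then show ?thesis
        using True by (intro UnI1 image_eqI[of _ _ "I - {q}"]) auto
    next
      case False
      have "down_closed r Q2 I"
        using I sub[of I] False by (auto simp: splits_def down_closed_def Q2_def)
      then show ?thesis
        using I U_eq[of I] False by (auto simp: splits_def)
    qed
  next
    fix I assume "I \<in> insert q ` ?A \<union> ?B"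
    then show "I \<in> splits r Q L U"
    proof
      assume "I \<in> insert q ` ?A"
      then obtain J where J: "J \<in> ?A" "I = insert q J"
        by blast
      moreover have "Q - I = Q1 - J"
        using J by (auto simp: Q1_def)
      moreover have "down_closed r Q I"
        unfolding down_closed_def
      proof (intro conjI ballI impI)
        fix x y assume "x \<in> Q" "y \<in> I" "(x, y) \<in> r"
        then show "x \<in> I"
          using J min[of x] by (auto simp: splits_def down_closed_def Q1_def)
      qed (use J q in \<open>auto simp: splits_def down_closed_def Q1_def\<close>)
      ultimately show ?thesis
        by (simp add: splits_def)
    next
      assume I: "I \<in> ?B"
      have "down_closed r Q I"
        unfolding down_closed_def
      proof (intro conjI ballI impI)
        fix x y assume xy: "x \<in> Q" "y \<in> I" "(x, y) \<in> r"
        then have "x \<in> Q2"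
          using I transD[OF trans, of q x y] by (auto simp: splits_def down_closed_def Q2_def)
        then show "x \<in> I"
          using I xy by (auto simp: splits_def down_closed_def)
      qed (use I in \<open>auto simp: splits_def down_closed_def Q2_def\<close>)
      moreover have "q \<notin> I"
        using I q by (auto simp: splits_def down_closed_def Q2_def)
      ultimately show ?thesis
        using I U_eq[of I] by (auto simp: splits_def)
    qed
  qed
  moreover have "insert q ` ?A \<inter> ?B = {}"
    using q by (auto simp: splits_def down_closed_def Q2_def)
  moreover have "card (insert q ` ?A) = card ?A"
  proof (intro card_image inj_onI)
    fix I J assume "I \<in> ?A" "J \<in> ?A" "insert q I = insert q J"
    moreover from this have "q \<notin> I" "q \<notin> J"
      by (auto simp: splits_def down_closed_def Q1_def)
    ultimately show "I = J"
      by (simp add: insert_ident)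
  qed
  moreover have "finite ?A" "finite ?B"
    using fin by (auto simp: Q1_def Q2_def)
  ultimately show ?thesis
    by (simp add: card_Un_disjoint)
qed

text \<open>By minimality of \<open>q\<close>, the elements of \<open>Q2\<close> are those
  incomparable to \<open>q\<close>, that is, the possible companions of \<open>q\<close> in an
  antichain.\<close>

lemma card_cuts_rec:
  assumes "antisym r"
  shows "card (cuts r Q L U) = card (cuts r Q1 L U) +
    card (cuts r Q2 (\<lambda>S. L (insert q S)) (\<lambda>S. U (insert q S)))"
proof -
  let ?B = "cuts r Q2 (\<lambda>S. L (insert q S)) (\<lambda>S. U (insert q S))"
  have "cuts r Q L U = cuts r Q1 L U \<union> insert q ` ?B"
  proof (intro equalityI subsetI)
    fix I assume I: "I \<in> cuts r Q L U"
    show "I \<in> cuts r Q1 L U \<union> insert q ` ?B"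
    proof (cases "q \<in> I")
      case True
      have "I - {q} \<in> ?B"
        using I True by (auto simp: cuts_def antichain_def Q2_def insert_absorb)
      then show ?thesis
        using True by (intro UnI2 image_eqI[of _ _ "I - {q}"]) auto
    next
      case False
      then show ?thesis
        using I by (auto simp: cuts_def Q1_def)
    qed
  next
    fix I assume "I \<in> cuts r Q1 L U \<union> insert q ` ?B"
    then show "I \<in> cuts r Q L U"
      using q min by (auto simp: cuts_def antichain_def Q1_def Q2_def)
  qed
  moreover have "cuts r Q1 L U \<inter> insert q ` ?B = {}"
    using q by (auto simp: cuts_def Q1_def)
  moreover have "card (insert q ` ?B) = card ?B"
  proof (intro card_image inj_onI)
    fix I J assume "I \<in> ?B" "J \<in> ?B" "insert q I = insert q J"
    moreover from this have "q \<notin> I" "q \<notin> J"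
      using q by (auto simp: cuts_def Q2_def)
    ultimately show "I = J"
      by (simp add: insert_ident)
  qed
  moreover have "finite (cuts r Q1 L U)" "finite ?B"
    using fin by (auto simp: Q1_def Q2_def)
  ultimately show ?thesis
    by (simp add: card_Un_disjoint)
qed

text \<open>Brings the recursion for cuts into the shape of the recursion for splits. An antichain
  of \<open>Q1\<close> that leaves \<open>Q2\<close> has an element above \<open>q\<close>, so
  adding \<open>q\<close> does not change \<open>L\<close>; on antichains of \<open>Q2\<close> the
  four counts are related by \<open>card_supermodular\<close>.\<close>

lemma card_cuts_exchange:
  assumes L: "dominance_mono r Q L" and U: "dominance_mono (r\<inverse>) Q U" and "antisym r"
  shows "card (cuts r Q L U) =
    card (cuts r Q1 (\<lambda>S. L (insert q S)) U) + card (cuts r Q2 L (\<lambda>S. U (insert q S)))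
    + card {B. B \<subseteq> Q2 \<and> antichain r B \<and> L (insert q B) \<and> U (insert q B) \<and> \<not> L B \<and> \<not> U B}"
proof -
  let ?L = "\<lambda>S. L (insert q S)" and ?U = "\<lambda>S. U (insert q S)"
  let ?Z = "{B. B \<subseteq> Q1 \<and> \<not> B \<subseteq> Q2 \<and> antichain r B \<and> L B \<and> U B}"
  let ?A = "{B. B \<subseteq> Q2 \<and> antichain r B}"
  have fins: "finite Q1" "finite Q2"
    using fin by (auto simp: Q1_def Q2_def)
  have L_eq: "L (insert q B) \<longleftrightarrow> L B" if "B \<subseteq> Q1" "\<not> B \<subseteq> Q2" for B
  proof
    assume "L (insert q B)"
    then show "L B"
      by (rule dominance_monoD[OF L, rotated 3]) (use q refl that in \<open>auto simp: Q1_def Q2_def refl_on_def\<close>)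
  next
    assume "L B"
    then show "L (insert q B)"
      by (rule dominance_monoD[OF L, rotated 3]) (use q refl that in \<open>auto simp: Q1_def Q2_def refl_on_def\<close>)
  qed
  have split: "card (cuts r Q1 M U) = card ?Z + card (cuts r Q2 M U)"
    if "\<And>B. B \<subseteq> Q1 \<Longrightarrow> \<not> B \<subseteq> Q2 \<Longrightarrow> M B = L B" for M
  proof -
    have "cuts r Q1 M U = ?Z \<union> cuts r Q2 M U"
      using that Q2_subset by (auto simp: cuts_def)
    moreover have "?Z \<inter> cuts r Q2 M U = {}"
      by (auto simp: cuts_def)
    moreover have "finite ?Z"
      using fins by (auto intro: finite_subset[of _ "Pow Q1"])
    ultimately show ?thesis
      using fins by (simp add: card_Un_disjoint)
  qed
  have incL: "L (insert q B)" if "L B" "B \<subseteq> Q2" for B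
    using that(1) by (rule dominance_monoD[OF L, rotated 3]) (use q refl that Q2_subset in \<open>auto simp: Q1_def Q2_def refl_on_def\<close>)
  have incU: "U (insert q B)" if "U B" "B \<subseteq> Q2" for B
    using that(1) by (rule dominance_monoD[OF U, rotated 3]) (use q refl that Q2_subset in \<open>auto simp: Q1_def Q2_def refl_on_def\<close>)
  have "card {x\<in>?A. L x \<and> U x} + card {x\<in>?A. ?L x \<and> ?U x} =
    card {x\<in>?A. ?L x \<and> U x} + card {x\<in>?A. L x \<and> ?U x} + card {x\<in>?A. ?L x \<and> ?U x \<and> \<not> L x \<and> \<not> U x}"
    by (rule card_supermodular) (use fins incL incU in auto)
  then have "card (cuts r Q2 L U) + card (cuts r Q2 ?L ?U) =
    card (cuts r Q2 ?L U) + card (cuts r Q2 L ?U)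
    + card {B. B \<subseteq> Q2 \<and> antichain r B \<and> ?L B \<and> ?U B \<and> \<not> L B \<and> \<not> U B}"
    by (simp add: cuts_def conj_ac)
  then show ?thesis
    using card_cuts_rec[OF assms(3), of L U] split[of L] split[of ?L] L_eq by simp
qed

end

lemma finite_minimal_element:
  assumes "finite Q" "Q \<noteq> {}" "trans r" "antisym r"
  obtains q where "q \<in> Q" "\<And>x. x \<in> Q \<Longrightarrow> (x, q) \<in> r \<Longrightarrow> x = q"
proof -
  have "\<exists>q\<in>Q. \<forall>x\<in>Q. (x, q) \<in> r \<longrightarrow> x = q"
    using assms(1,2)
  proof (induction Q rule: finite_ne_induct)
    case (insert a F)
    then obtain q where q: "q \<in> F" "\<forall>x\<in>F. (x, q) \<in> r \<longrightarrow> x = q"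
      by blast
    show ?case
    proof (cases "(a, q) \<in> r")
      case True
      then have "\<forall>x\<in>insert a F. (x, a) \<in> r \<longrightarrow> x = a"
        using q assms(3,4) by (metis antisymD insertE transD)
      then show ?thesis
        by blast
    qed (use q in auto)
  qed auto
  then show ?thesis
    using that by blast
qed

section \<open>Comparison of splits and cuts by induction on the size of the poset\<close>

context
  fixes r :: "'a rel"
  assumes r: "trans r" "antisym r"
begin

text \<open>Both branches of the recursion are instances of the same problem, with \<open>q\<close>
  absorbed into \<open>L\<close> or into \<open>U\<close>.\<close>

lemma smaller_instances:
  assumes "finite Q" "refl_on Q r" "dominance_mono r Q L" "dominance_mono (r\<inverse>) Q U" "q \<in> Q" "(q, q) \<in> r"
  shows "card (Q - {q}) < card Q" "card {x\<in>Q. (q, x) \<notin> r} < card Q"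
    "finite (Q - {q})" "finite {x\<in>Q. (q, x) \<notin> r}"
    "refl_on (Q - {q}) r" "refl_on {x\<in>Q. (q, x) \<notin> r} r"
    "dominance_mono r (Q - {q}) (\<lambda>S. L (insert q S))" "dominance_mono (r\<inverse>) (Q - {q}) U"
    "dominance_mono r {x\<in>Q. (q, x) \<notin> r} L" "dominance_mono (r\<inverse>) {x\<in>Q. (q, x) \<notin> r} (\<lambda>S. U (insert q S))"
proof -
  have sub: "Q - {q} \<subset> Q" "{x\<in>Q. (q, x) \<notin> r} \<subset> Q"
    using assms(5,6) by auto
  then show "card (Q - {q}) < card Q" "card {x\<in>Q. (q, x) \<notin> r} < card Q"
    using assms(1) by (blast intro: psubset_card_mono)+
  show "dominance_mono r (Q - {q}) (\<lambda>S. L (insert q S))"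
      "dominance_mono (r\<inverse>) {x\<in>Q. (q, x) \<notin> r} (\<lambda>S. U (insert q S))"
    using dominance_mono_insert[OF assms(3,5,6)] dominance_mono_insert[OF assms(4,5)] assms(6) sub by auto
  show "dominance_mono (r\<inverse>) (Q - {q}) U" "dominance_mono r {x\<in>Q. (q, x) \<notin> r} L"
    by (rule dominance_mono_subset[OF assms(4)] dominance_mono_subset[OF assms(3)], use sub in blast)+
qed (use assms(1,2) in \<open>auto simp: refl_on_def\<close>)

text \<open>Both counts obey the same recursion, except that cuts gain a nonnegative term at each
  step.\<close>

lemma card_splits_le_cuts:
  assumes "finite Q" "refl_on Q r" "dominance_mono r Q L" "dominance_mono (r\<inverse>) Q U"
  shows "card (splits r Q L U) \<le> card (cuts r Q L U)"
  using assms
proof (induction "card Q" arbitrary: Q L U rule: less_induct)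
  case less
  show ?case
  proof (cases "Q = {}")
    case True
    \<comment> \<open>On the empty poset both families are governed by the single condition
      \<open>L {} \<and> U {}\<close>.\<close>
    then show ?thesis
      by (simp add: splits_def cuts_def down_closed_def antichain_def cong: conj_cong)
  next
    case False
    then obtain q where q: "q \<in> Q" "\<And>x. x \<in> Q \<Longrightarrow> (x, q) \<in> r \<Longrightarrow> x = q"
      using finite_minimal_element less.prems(1) r by metis
    have qq: "(q, q) \<in> r"
      using q less.prems by (auto simp: refl_on_def)
    let ?Q1 = "Q - {q}" and ?Q2 = "{x\<in>Q. (q, x) \<notin> r}"
    have sub: "?Q1 \<subset> Q" "?Q2 \<subset> Q"
      using q qq by auto
    note smaller = smaller_instances[OF less.prems(1-4) q(1) qq]
    have "card (splits r ?Q1 (\<lambda>S. L (insert q S)) U) \<le> card (cuts r ?Q1 (\<lambda>S. L (insert q S)) U)"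
      by (rule less.hyps) (fact smaller)+
    moreover have "card (splits r ?Q2 L (\<lambda>S. U (insert q S))) \<le> card (cuts r ?Q2 L (\<lambda>S. U (insert q S)))"
      by (rule less.hyps) (fact smaller)+
    ultimately show ?thesis
      using card_splits_rec[OF r(1) less.prems(1,2) q(1) qq q(2) less.prems(4), of L]
        card_cuts_exchange[OF r(1) less.prems(1,2) q(1) qq q(2) less.prems(3,4) r(2)]
      by linarith
  qed
qed

text \<open>The last hypothesis says that no element is pivotal for both \<open>L\<close> and
  \<open>U\<close>, which makes the gain zero. Both branches inherit it, because absorbing
  \<open>q\<close> only narrows the collection of sets tested.\<close>

lemma card_splits_eq_cuts:
  assumes "finite Q" "refl_on Q r" "dominance_mono r Q L" "dominance_mono (r\<inverse>) Q U"
    and "\<And>q. q \<in> Q \<Longrightarrow> (\<forall>S\<subseteq>Q. L (insert q S) \<longrightarrow> L S) \<or> (\<forall>S\<subseteq>Q. U (insert q S) \<longrightarrow> U S)"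
  shows "card (splits r Q L U) = card (cuts r Q L U)"
  using assms
proof (induction "card Q" arbitrary: Q L U rule: less_induct)
  case less
  show ?case
  proof (cases "Q = {}")
    case True
    then show ?thesis
      by (simp add: splits_def cuts_def down_closed_def antichain_def cong: conj_cong)
  next
    case False
    then obtain q where q: "q \<in> Q" "\<And>x. x \<in> Q \<Longrightarrow> (x, q) \<in> r \<Longrightarrow> x = q"
      using finite_minimal_element less.prems(1) r by metis
    have qq: "(q, q) \<in> r"
      using q less.prems by (auto simp: refl_on_def)
    let ?Q1 = "Q - {q}" and ?Q2 = "{x\<in>Q. (q, x) \<notin> r}"
    have sub: "?Q1 \<subset> Q" "?Q2 \<subset> Q"
      using q qq by auto
    note smaller = smaller_instances[OF less.prems(1-4) q(1) qq]
    have "card (splits r ?Q1 (\<lambda>S. L (insert q S)) U) = card (cuts r ?Q1 (\<lambda>S. L (insert q S)) U)"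
    proof (rule less.hyps)
      fix p assume p: "p \<in> ?Q1"
      show "(\<forall>S\<subseteq>?Q1. L (insert q (insert p S)) \<longrightarrow> L (insert q S)) \<or> (\<forall>S\<subseteq>?Q1. U (insert p S) \<longrightarrow> U S)"
        using less.prems(5)[of p]
      proof
        show "p \<in> Q"
          using p by blast
        assume *: "\<forall>S\<subseteq>Q. L (insert p S) \<longrightarrow> L S"
        have "L (insert q S)" if "S \<subseteq> ?Q1" "L (insert q (insert p S))" for S
          using *[rule_format, of "insert q S"] that q(1) by (simp add: insert_commute) blast
        then show ?thesis
          by blast
      qed blast
    qed (fact smaller)+
    moreover have "card (splits r ?Q2 L (\<lambda>S. U (insert q S))) = card (cuts r ?Q2 L (\<lambda>S. U (insert q S)))"
    proof (rule less.hyps)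
      fix p assume p: "p \<in> ?Q2"
      show "(\<forall>S\<subseteq>?Q2. L (insert p S) \<longrightarrow> L S) \<or> (\<forall>S\<subseteq>?Q2. U (insert q (insert p S)) \<longrightarrow> U (insert q S))"
        using less.prems(5)[of p]
      proof
        show "p \<in> Q"
          using p by blast
        assume *: "\<forall>S\<subseteq>Q. U (insert p S) \<longrightarrow> U S"
        have "U (insert q S)" if "S \<subseteq> ?Q2" "U (insert q (insert p S))" for S
          using *[rule_format, of "insert q S"] that q(1) by (simp add: insert_commute) blast
        then show ?thesis
          by blast
      qed blast
    qed (fact smaller)+
    moreover have "{B. B \<subseteq> ?Q2 \<and> antichain r B \<and> L (insert q B) \<and> U (insert q B) \<and> \<not> L B \<and> \<not> U B} = {}"
      using less.prems(5)[OF q(1)] by blast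
    then have "card {B. B \<subseteq> ?Q2 \<and> antichain r B \<and> L (insert q B) \<and> U (insert q B) \<and> \<not> L B \<and> \<not> U B} = 0"
      by (simp only: card.empty)
    ultimately show ?thesis
      using card_splits_rec[OF r(1) less.prems(1,2) q(1) qq q(2) less.prems(4), of L]
        card_cuts_exchange[OF r(1) less.prems(1,2) q(1) qq q(2) less.prems(3,4) r(2)]
      by linarith
  qed
qed

text \<open>The element \<open>e\<close> is pivotal for both conditions at the empty set. If
  \<open>q\<close> fails \<open>L\<close>, \<open>e\<close> stays so in the branch of
  \<open>Q - {q}\<close>; if \<open>q\<close> fails only \<open>U\<close>, in the other branch; if
  \<open>q\<close> satisfies both, the empty antichain is counted by the gain.\<close>

lemma card_splits_less_cuts:
  assumes "finite Q" "refl_on Q r" "dominance_mono r Q L" "dominance_mono (r\<inverse>) Q U"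
    and "e \<in> Q" "L {e}" "U {e}" "\<not> L {}" "\<not> U {}"
  shows "card (splits r Q L U) < card (cuts r Q L U)"
  using assms
proof (induction "card Q" arbitrary: Q L U rule: less_induct)
  case less
  then have "Q \<noteq> {}"
    by blast
  then obtain q where q: "q \<in> Q" "\<And>x. x \<in> Q \<Longrightarrow> (x, q) \<in> r \<Longrightarrow> x = q"
    using finite_minimal_element less.prems(1) r by metis
  have qq: "(q, q) \<in> r"
    using q less.prems by (auto simp: refl_on_def)
  let ?Q1 = "Q - {q}" and ?Q2 = "{x\<in>Q. (q, x) \<notin> r}"
  let ?E = "{B. B \<subseteq> ?Q2 \<and> antichain r B \<and> L (insert q B) \<and> U (insert q B) \<and> \<not> L B \<and> \<not> U B}"
  have sub: "?Q1 \<subset> Q" "?Q2 \<subset> Q"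
    using q qq by auto
  note smaller = smaller_instances[OF less.prems(1-4) q(1) qq]
  have le1: "card (splits r ?Q1 (\<lambda>S. L (insert q S)) U) \<le> card (cuts r ?Q1 (\<lambda>S. L (insert q S)) U)"
    by (rule card_splits_le_cuts) (fact smaller)+
  have le2: "card (splits r ?Q2 L (\<lambda>S. U (insert q S))) \<le> card (cuts r ?Q2 L (\<lambda>S. U (insert q S)))"
    by (rule card_splits_le_cuts) (fact smaller)+
  have "card (splits r ?Q1 (\<lambda>S. L (insert q S)) U) < card (cuts r ?Q1 (\<lambda>S. L (insert q S)) U)
    \<or> card (splits r ?Q2 L (\<lambda>S. U (insert q S))) < card (cuts r ?Q2 L (\<lambda>S. U (insert q S)))
    \<or> card ?E > 0"
  proof (cases "L {q}")
    case False
    then have "e \<noteq> q"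
      using less.prems by auto
    moreover have "L {q, e}"
      using less.prems(6) by (rule dominance_monoD[OF less.prems(3), rotated 3])
        (use less.prems q in \<open>auto simp: refl_on_def\<close>)
    ultimately have "card (splits r ?Q1 (\<lambda>S. L (insert q S)) U) < card (cuts r ?Q1 (\<lambda>S. L (insert q S)) U)"
      using less.prems(5-9) False
      by (intro less.hyps[OF smaller(1,3,5,7,8)]) (auto simp: insert_commute)
    then show ?thesis ..
  next
    case Lq: True
    show ?thesis
    proof (cases "U {q}")
      case False
      \<comment> \<open>If \<open>e\<close> were above \<open>q\<close>, dominance in
        \<open>r\<inverse>\<close> would turn \<open>U {e}\<close> into
        \<open>U {q}\<close>.\<close>
      then have "(q, e) \<notin> r"
        using dominance_monoD[OF less.prems(4), of "{e}" "{q}"] less.prems q by auto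
      moreover have "U {q, e}"
        using less.prems(7) by (rule dominance_monoD[OF less.prems(4), rotated 3])
          (use less.prems q in \<open>auto simp: refl_on_def\<close>)
      ultimately have "card (splits r ?Q2 L (\<lambda>S. U (insert q S))) < card (cuts r ?Q2 L (\<lambda>S. U (insert q S)))"
        using less.prems(5-9) False
        by (intro less.hyps[OF smaller(2,4,6,9,10)]) (auto simp: insert_commute)
      then show ?thesis
        by blast
    next
      case True
      have "finite ?E"
        using less.prems(1) by (auto intro: finite_subset[of _ "Pow Q"])
      moreover have "{} \<in> ?E"
        using True Lq less.prems by (auto simp: antichain_def)
      ultimately show ?thesis
        unfolding card_gt_0_iff by blast
    qed
  qed
  then show ?case
    using card_splits_rec[OF r(1) less.prems(1,2) q(1) qq q(2) less.prems(4), of L]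
      card_cuts_exchange[OF r(1) less.prems(1,2) q(1) qq q(2) less.prems(3,4) r(2)] le1 le2
    by linarith
qed

end

section \<open>Vertices of the two polytopes\<close>

definition comparable :: "'a rel \<Rightarrow> 'a \<Rightarrow> 'a \<Rightarrow> bool" where
  "comparable r x y \<longleftrightarrow> (x, y) \<in> r \<or> (y, x) \<in> r"

lemma comparable_sym: "comparable r x y \<longleftrightarrow> comparable r y x"
  by (auto simp: comparable_def)

lemma comparable_converse [simp]: "comparable (r\<inverse>) = comparable r"
  by (auto simp: comparable_def fun_eq_iff)

definition is_chain :: "'a rel \<Rightarrow> 'a set \<Rightarrow> bool" where
  "is_chain r K \<longleftrightarrow> (\<forall>x\<in>K. \<forall>y\<in>K. comparable r x y)"

lemma is_chain_subset: "is_chain r K \<Longrightarrow> J \<subseteq> K \<Longrightarrow> is_chain r J"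
  by (auto simp: is_chain_def)

text \<open>Bridges the sorted lists of \<open>chain_polytope\<close> and the sets of pairwise
  comparable elements used from here on.\<close>

lemma chain_has_list:
  assumes "finite K" "is_chain r K" "trans r" "antisym r"
  shows "\<exists>ps. set ps = K \<and> distinct ps \<and> sorted_wrt (\<lambda>p q. (p, q) \<in> r \<and> p \<noteq> q) ps"
  using assms(1,2)
proof (induction "card K" arbitrary: K rule: less_induct)
  case less
  show ?case
  proof (cases "K = {}")
    case False
    then obtain q where q: "q \<in> K" "\<And>x. x \<in> K \<Longrightarrow> (x, q) \<in> r \<Longrightarrow> x = q"
      using finite_minimal_element less.prems(1) assms(3,4) by metis
    have "\<exists>ps. set ps = K - {q} \<and> distinct ps \<and> sorted_wrt (\<lambda>p q. (p, q) \<in> r \<and> p \<noteq> q) ps"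
      using less.prems q(1) by (intro less.hyps) (blast intro: is_chain_subset psubset_card_mono)+
    then obtain ps where ps: "set ps = K - {q}" "distinct ps" "sorted_wrt (\<lambda>p q. (p, q) \<in> r \<and> p \<noteq> q) ps"
      by blast
    have "set (q # ps) = K" "distinct (q # ps)"
      using ps q by auto
    moreover have "sorted_wrt (\<lambda>p q. (p, q) \<in> r \<and> p \<noteq> q) (q # ps)"
      using ps q less.prems(2) by (auto simp: is_chain_def comparable_def)
    ultimately show ?thesis
      by blast
  qed auto
qed

text \<open>Moving a non-integral level of a point of either polytope up or down by less than the gaps
  between its values stays inside the polytope, so that extreme points are integral.\<close>

lemma level_shift:
  fixes V :: "real set" and v :: real
  assumes "finite V"
  obtains e where "e > 0" "\<And>d a b. \<bar>d\<bar> \<le> e \<Longrightarrow> a \<in> V \<Longrightarrow> b \<in> V \<Longrightarrow> a \<le> b \<Longrightarrow>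
    (if a = v then a + d else a) \<le> (if b = v then b + d else b)"
proof
  \<comment> \<open>The 1 keeps the minimum defined when \<open>V\<close> has no point other than
    \<open>v\<close>.\<close>
  let ?G = "insert 1 ((\<lambda>a. \<bar>a - v\<bar>) ` (V - {v}))"
  have "finite ?G"
    using assms by auto
  then show "Min ?G > 0"
    by auto
  fix d a b assume d: "\<bar>d\<bar> \<le> Min ?G" and ab: "a \<in> V" "b \<in> V" "a \<le> b"
  have gap: "\<bar>d\<bar> \<le> \<bar>x - v\<bar>" if "x \<in> V" "x \<noteq> v" for x
    using d Min_le[OF \<open>finite ?G\<close>, of "\<bar>x - v\<bar>"] that by auto
  show "(if a = v then a + d else a) \<le> (if b = v then b + d else b)"
    using gap[of a] gap[of b] ab by auto
qed

lemma not_extreme_if_shift: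
  fixes S :: "'v::real_vector set"
  assumes "x + d \<in> S" "x - d \<in> S" "d \<noteq> 0"
  shows "\<not> x extreme_point_of S"
proof
  assume "x extreme_point_of S"
  moreover have "x = midpoint (x + d) (x - d)"
    by (simp add: midpoint_def flip: scaleR_2)
  moreover have "x + d \<noteq> x - d"
  proof
    assume "x + d = x - d"
    then have "2 *\<^sub>R d = 0"
      by (simp add: scaleR_2 algebra_simps)
    then show False
      using assms by simp
  qed
  then have "midpoint (x + d) (x - d) \<in> open_segment (x + d) (x - d)"
    by simp
  ultimately show False
    using assms unfolding extreme_point_of_def by metis
qed

locale finite_poset =
  fixes P :: "'a::finite set" and r :: "'a rel"
  assumes partial_order: "partial_order_on P r"
begin

lemma trans_r: "trans r" and antisym_r: "antisym r" and refl_r: "refl_on P r" and r_subset: "r \<subseteq> P \<times> P"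
  using partial_order_onD[OF partial_order] by auto

text \<open>Statements about upper parts are obtained from their lower mirror images by interpreting
  the reversed poset.\<close>

lemma dual: "finite_poset P (r\<inverse>)"
  by unfold_locales (simp add: partial_order)

lemma le_trans: "(x, y) \<in> r \<Longrightarrow> (y, z) \<in> r \<Longrightarrow> (x, z) \<in> r"
  using trans_r by (rule transD)

lemma le_antisym: "(x, y) \<in> r \<Longrightarrow> (y, x) \<in> r \<Longrightarrow> x = y"
  using antisym_r by (rule antisymD)

lemma le_refl: "x \<in> P \<Longrightarrow> (x, x) \<in> r"
  using refl_r by (auto simp: refl_on_def)

lemma le_carrier: "(x, y) \<in> r \<Longrightarrow> x \<in> P \<and> y \<in> P"
  using r_subset by auto

abbreviation filters :: "'a set set" where
  "filters \<equiv> {F. down_closed (r\<inverse>) P F}"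

abbreviation antichains :: "'a set set" where
  "antichains \<equiv> {A. A \<subseteq> P \<and> antichain r A}"

lemma chain_polytope_iff:
  "x \<in> chain_polytope P r \<longleftrightarrow> (\<forall>p. p \<notin> P \<longrightarrow> x $ p = 0) \<and> (\<forall>p\<in>P. 0 \<le> x $ p) \<and>
     (\<forall>K. K \<subseteq> P \<and> is_chain r K \<longrightarrow> (\<Sum>p\<in>K. x $ p) \<le> 1)"
proof -
  have "(\<forall>ps. set ps \<subseteq> P \<and> sorted_wrt (\<lambda>p q. (p, q) \<in> r \<and> p \<noteq> q) ps \<longrightarrow> (\<Sum>p\<leftarrow>ps. x $ p) \<le> 1)
    \<longleftrightarrow> (\<forall>K. K \<subseteq> P \<and> is_chain r K \<longrightarrow> (\<Sum>p\<in>K. x $ p) \<le> 1)" (is "?L \<longleftrightarrow> ?R")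
  proof
    assume L: ?L
    show ?R
    proof (intro allI impI)
      fix K assume K: "K \<subseteq> P \<and> is_chain r K"
      then obtain ps where "set ps = K" "distinct ps" "sorted_wrt (\<lambda>p q. (p, q) \<in> r \<and> p \<noteq> q) ps"
        using chain_has_list[of K r] trans_r antisym_r by auto
      then show "(\<Sum>p\<in>K. x $ p) \<le> 1"
        using L[rule_format, of ps] K by (simp add: sum_list_distinct_conv_sum_set)
    qed
  next
    assume R: ?R
    show ?L
    proof (intro allI impI)
      fix ps assume ps: "set ps \<subseteq> P \<and> sorted_wrt (\<lambda>p q. (p, q) \<in> r \<and> p \<noteq> q) ps"
      then have "is_chain r (set ps) \<and> distinct ps"
      proof (induction ps)
        case (Cons a ps)
        then show ?case
          using le_refl[of a] by (auto simp: is_chain_def comparable_def)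
      qed (simp add: is_chain_def)
      then show "(\<Sum>p\<leftarrow>ps. x $ p) \<le> 1"
        using R ps by (simp add: sum_list_distinct_conv_sum_set)
    qed
  qed
  then show ?thesis
    by (simp add: chain_polytope_def)
qed

lemma chain_polytope_chainD:
  "x \<in> chain_polytope P r \<Longrightarrow> K \<subseteq> P \<Longrightarrow> is_chain r K \<Longrightarrow> (\<Sum>p\<in>K. x $ p) \<le> 1"
  by (simp add: chain_polytope_iff)

lemma order_polytope_cube: "x \<in> order_polytope P r \<Longrightarrow> 0 \<le> x $ p \<and> x $ p \<le> 1"
  by (cases "p \<in> P") (auto simp: order_polytope_def)

lemma chain_polytope_cube:
  assumes "x \<in> chain_polytope P r"
  shows "0 \<le> x $ p \<and> x $ p \<le> 1"
proof (cases "p \<in> P")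
  case True
  then have "is_chain r {p}"
    by (simp add: is_chain_def comparable_def le_refl)
  then have "(\<Sum>p\<in>{p}. x $ p) \<le> 1"
    using True by (intro chain_polytope_chainD[OF assms]) auto
  then show ?thesis
    using assms True by (simp add: chain_polytope_iff)
qed (use assms in \<open>simp add: chain_polytope_iff\<close>)

lemma bounded_if_cube:
  fixes S :: "(real ^ 'a) set"
  assumes "\<And>x p. x \<in> S \<Longrightarrow> 0 \<le> x $ p \<and> x $ p \<le> 1"
  shows "bounded S"
proof (rule bounded_subset[OF bounded_cbox])
  show "S \<subseteq> cbox 0 1"
    using assms by (auto simp: mem_box_cart)
qed

lemma compact_order_polytope: "compact (order_polytope P r)"
proof -
  have "order_polytope P r = (\<Inter>p\<in>-P. {x. x $ p = 0}) \<inter> (\<Inter>p\<in>P. {x. 0 \<le> x $ p} \<inter> {x. x $ p \<le> 1})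
    \<inter> (\<Inter>p\<in>P. \<Inter>q\<in>P \<inter> {q. (p, q) \<in> r}. {x. x $ p \<le> x $ q})"
    by (auto simp: order_polytope_def)
  also have "closed \<dots>"
    by (intro closed_Int closed_INT ballI closed_Collect_le closed_Collect_eq continuous_intros)
  finally show ?thesis
    using bounded_if_cube order_polytope_cube by (simp add: compact_eq_bounded_closed)
qed

lemma compact_chain_polytope: "compact (chain_polytope P r)"
proof -
  have "chain_polytope P r = (\<Inter>p\<in>-P. {x. x $ p = 0}) \<inter> (\<Inter>p\<in>P. {x. 0 \<le> x $ p})
    \<inter> (\<Inter>K\<in>{K. K \<subseteq> P \<and> is_chain r K}. {x. (\<Sum>p\<in>K. x $ p) \<le> 1})"
    by (auto simp: chain_polytope_iff)
  also have "closed \<dots>"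
    by (intro closed_Int closed_INT ballI closed_Collect_le closed_Collect_eq continuous_intros)
  finally show ?thesis
    using bounded_if_cube chain_polytope_cube by (simp add: compact_eq_bounded_closed)
qed

lemma convex_order_polytope: "convex (order_polytope P r)"
proof (rule convexI)
  fix x y and u v :: real
  assume "x \<in> order_polytope P r" "y \<in> order_polytope P r" "0 \<le> u" "0 \<le> v" "u + v = 1"
  then show "u *\<^sub>R x + v *\<^sub>R y \<in> order_polytope P r"
    by (auto simp: order_polytope_def intro!: convex_bound_le add_mono mult_left_mono)
qed

lemma convex_chain_polytope: "convex (chain_polytope P r)"
proof (rule convexI)
  fix x y and u v :: real
  assume "x \<in> chain_polytope P r" "y \<in> chain_polytope P r" "0 \<le> u" "0 \<le> v" "u + v = 1"
  then show "u *\<^sub>R x + v *\<^sub>R y \<in> chain_polytope P r"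
    by (auto simp: chain_polytope_iff sum.distrib simp flip: sum_distrib_left intro!: convex_bound_le)
qed

lemma indvec_order_polytope: "indvec F \<in> order_polytope P r \<longleftrightarrow> F \<in> filters"
  by (auto simp: order_polytope_def down_closed_def split: if_splits)

lemma indvec_chain_polytope: "indvec A \<in> chain_polytope P r \<longleftrightarrow> A \<in> antichains"
proof
  assume A: "indvec A \<in> chain_polytope P r"
  then have "A \<subseteq> P"
    by (auto simp: chain_polytope_iff split: if_splits)
  moreover have "x = y" if "x \<in> A" "y \<in> A" "(x, y) \<in> r" for x y
  proof (rule ccontr)
    assume "x \<noteq> y"
    have "is_chain r {x, y}"
      using that(3) le_carrier[OF that(3)] le_refl[of x] le_refl[of y]
      by (simp add: is_chain_def comparable_def)
    then have "(\<Sum>p\<in>{x, y}. indvec A $ p) \<le> 1"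
      using that \<open>A \<subseteq> P\<close> by (intro chain_polytope_chainD[OF A]) auto
    then show False
      using that \<open>x \<noteq> y\<close> by simp
  qed
  ultimately show "A \<in> antichains"
    by (auto simp: antichain_def)
next
  assume A: "A \<in> antichains"
  have "(\<Sum>p\<in>K. indvec A $ p) \<le> 1" if K: "K \<subseteq> P" "is_chain r K" for K
  proof -
    have "x = y" if "x \<in> K \<inter> A" "y \<in> K \<inter> A" for x y
      using that A K unfolding is_chain_def comparable_def antichain_def by blast
    then have "card (K \<inter> A) \<le> 1"
      by (simp add: card_le_Suc0_iff_eq)
    moreover have "(\<Sum>p\<in>K. indvec A $ p) = card (K \<inter> A)"
      by (simp add: sum.If_cases)
    ultimately show ?thesis
      by simp
  qed
  then show "indvec A \<in> chain_polytope P r"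
    using A by (auto simp: chain_polytope_iff)
qed

lemma eq_indvec_if_01:
  assumes "\<And>p. x $ p = 0 \<or> x $ p = 1"
  shows "x = indvec {p. x $ p = 1}"
  using assms by (auto simp: vec_eq_iff)

lemma extreme_points_order_polytope:
  "{x. x extreme_point_of (order_polytope P r)} = indvec ` filters"
proof (intro equalityI subsetI)
  fix x assume "x \<in> indvec ` filters"
  then show "x \<in> {x. x extreme_point_of (order_polytope P r)}"
    using indvec_extreme_point[OF _ order_polytope_cube] by (auto simp: indvec_order_polytope)
next
  fix x assume "x \<in> {x. x extreme_point_of (order_polytope P r)}"
  then have x: "x extreme_point_of (order_polytope P r)" "x \<in> order_polytope P r"
    by (auto simp: extreme_point_of_def)
  have "x $ p = 0 \<or> x $ p = 1" for p
  proof (rule ccontr)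
    assume p: "\<not> (x $ p = 0 \<or> x $ p = 1)"
    define v where "v = x $ p"
    have "p \<in> P"
      using x(2) p by (auto simp: order_polytope_def)
    \<comment> \<open>With 0 and 1 among the levels, \<open>level_shift\<close> also preserves the
      bounds, because \<open>v\<close> is neither of them.\<close>
    obtain e where e: "e > 0" "\<And>d a b. \<bar>d\<bar> \<le> e \<Longrightarrow> a \<in> insert 0 (insert 1 (range (($) x))) \<Longrightarrow>
      b \<in> insert 0 (insert 1 (range (($) x))) \<Longrightarrow> a \<le> b \<Longrightarrow>
      (if a = v then a + d else a) \<le> (if b = v then b + d else b)"
      using level_shift[of "insert 0 (insert 1 (range (($) x)))" v] by auto
    let ?w = "\<lambda>d. d *\<^sub>R indvec {q. x $ q = v}"
    have shift: "x + ?w d \<in> order_polytope P r" if "\<bar>d\<bar> \<le> e" for d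
    proof -
      have eq: "(x + ?w d) $ q = (if x $ q = v then x $ q + d else x $ q)" for q
        by simp
      have v01: "v \<noteq> 0" "v \<noteq> 1"
        using p by (auto simp: v_def)
      show ?thesis
        unfolding order_polytope_def mem_Collect_eq eq
        using x(2) e(2)[OF that] v01 e(2)[OF that, of 0 "x $ q" for q] e(2)[OF that, of "x $ q" 1 for q]
        by (auto simp: order_polytope_def simp del: if_split_asm split del: if_split)
    qed
    have "\<not> x extreme_point_of (order_polytope P r)"
    proof (rule not_extreme_if_shift)
      show "x + ?w e \<in> order_polytope P r" "x - ?w e \<in> order_polytope P r"
        using shift[of e] shift[of "- e"] e(1) by auto
      have "?w e $ p \<noteq> 0"
        using e(1) by (simp add: v_def)
      then show "?w e \<noteq> 0"
        by (metis zero_index)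
    qed
    then show False
      using x by simp
  qed
  then obtain A where A: "x = indvec A"
    using eq_indvec_if_01 by blast
  then show "x \<in> indvec ` filters"
    using x(2) indvec_order_polytope[of A] by blast
qed

text \<open>\<open>m p\<close> is the largest total weight of a chain strictly below \<open>p\<close>: Stanley's transfer map.\<close>

lemma chain_weight_below:
  assumes x: "x \<in> chain_polytope P r"
  obtains m where "\<And>p. p \<in> P \<Longrightarrow> 0 \<le> m p" "\<And>p. p \<in> P \<Longrightarrow> x $ p + m p \<le> 1"
    "\<And>p q. (q, p) \<in> r \<Longrightarrow> q \<noteq> p \<Longrightarrow> x $ q + m q \<le> m p"
proof
  define \<K> where "\<K> p = {K. is_chain r K \<and> (\<forall>q\<in>K. (q, p) \<in> r \<and> q \<noteq> p)}" for p
  define m where "m p = Max (sum (($) x) ` \<K> p)" for p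
  have "{} \<in> \<K> p" for p
    by (simp add: \<K>_def is_chain_def)
  then have ne: "\<K> p \<noteq> {}" for p
    by blast
  have ge: "sum (($) x) K \<le> m p" if "K \<in> \<K> p" for K p
    unfolding m_def using that by (intro Max_ge) auto
  have attained: "\<exists>K\<in>\<K> p. m p = sum (($) x) K" for p
  proof -
    have "m p \<in> sum (($) x) ` \<K> p"
      unfolding m_def using ne by (intro Max_in) auto
    then show ?thesis
      by blast
  qed
  have insert_chain: "is_chain r (insert p K) \<and> insert p K \<subseteq> P \<and> p \<notin> K" if "K \<in> \<K> p" "p \<in> P" for K p
    using that le_carrier le_refl unfolding \<K>_def is_chain_def comparable_def by blast
  show "0 \<le> m p" if "p \<in> P" for p
    using ge[OF \<open>{} \<in> \<K> p\<close>] by simp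
  show "x $ p + m p \<le> 1" if "p \<in> P" for p
  proof -
    obtain K where K: "K \<in> \<K> p" "m p = sum (($) x) K"
      using attained by blast
    then have "sum (($) x) (insert p K) \<le> 1"
      using insert_chain[OF K(1) that] by (intro chain_polytope_chainD[OF x]) auto
    then show ?thesis
      using K insert_chain[OF K(1) that] by simp
  qed
  show "x $ q + m q \<le> m p" if "(q, p) \<in> r" "q \<noteq> p" for p q
  proof -
    obtain K where K: "K \<in> \<K> q" "m q = sum (($) x) K"
      using attained by blast
    have q: "q \<in> P"
      using that le_carrier by blast
    have "(s, p) \<in> r \<and> s \<noteq> p" if "s \<in> insert q K" for s
      using that K(1) \<open>(q, p) \<in> r\<close> \<open>q \<noteq> p\<close> le_trans le_antisym unfolding \<K>_def by blast
    then have "insert q K \<in> \<K> p"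
      using insert_chain[OF K(1) q] by (simp add: \<K>_def)
    then show ?thesis
      using ge K insert_chain[OF K(1) q] by force
  qed
qed

text \<open>In terms of \<open>y\<close> and \<open>m\<close>, which are monotone along the order,
  the point is \<open>x = y - m\<close> on \<open>P\<close>. Shifting one level in both
  \<open>y\<close> and \<open>m\<close> changes \<open>x\<close> linearly and stays inside the
  polytope.\<close>

lemma extreme_points_chain_polytope:
  "{x. x extreme_point_of (chain_polytope P r)} = indvec ` antichains"
proof (intro equalityI subsetI)
  fix x assume "x \<in> indvec ` antichains"
  then show "x \<in> {x. x extreme_point_of (chain_polytope P r)}"
    using indvec_extreme_point[OF _ chain_polytope_cube] by (auto simp: indvec_chain_polytope)
next
  fix x assume "x \<in> {x. x extreme_point_of (chain_polytope P r)}"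
  then have x: "x extreme_point_of (chain_polytope P r)" "x \<in> chain_polytope P r"
    by (auto simp: extreme_point_of_def)
  obtain m where m: "\<And>p. p \<in> P \<Longrightarrow> 0 \<le> m p" "\<And>p. p \<in> P \<Longrightarrow> x $ p + m p \<le> 1"
    "\<And>p q. (q, p) \<in> r \<Longrightarrow> q \<noteq> p \<Longrightarrow> x $ q + m q \<le> m p"
    using chain_weight_below[OF x(2)] by blast
  define y where "y p = x $ p + m p" for p
  have "x $ p = 0 \<or> x $ p = 1" for p
  proof (rule ccontr)
    assume p: "\<not> (x $ p = 0 \<or> x $ p = 1)"
    have "p \<in> P"
      using x(2) p by (auto simp: chain_polytope_iff)
    \<comment> \<open>As \<open>y p\<close> and \<open>m p\<close> differ by the fractional
      \<open>x $ p\<close>, one of them lies strictly between 0 and 1; it is taken as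
      \<open>v\<close>. The other one differs from \<open>v\<close>, so the shift really moves
      coordinate \<open>p\<close>.\<close>
    define v where "v = (if y p = 1 then m p else y p)"
    have "0 \<le> x $ p" "0 \<le> m p" "y p \<le> 1"
      using m \<open>p \<in> P\<close> chain_polytope_cube[OF x(2)] by (auto simp: y_def)
    then have v: "v \<noteq> 0" "v \<noteq> 1" "(v = y p) \<noteq> (v = m p)"
      using p by (auto simp: v_def y_def)
    define V where "V = insert 0 (insert 1 (y ` P \<union> m ` P))"
    have "finite V"
      by (simp add: V_def)
    then obtain e where e: "e > 0" "\<And>d a b. \<bar>d\<bar> \<le> e \<Longrightarrow> a \<in> V \<Longrightarrow> b \<in> V \<Longrightarrow> a \<le> b \<Longrightarrow>
        (if a = v then a + d else a) \<le> (if b = v then b + d else b)"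
      using level_shift[of V v] by blast
    let ?s = "\<lambda>d a. if a = v then a + d else a"
    define w :: "real ^ 'a" where
      "w = (\<chi> q. if q \<in> P then (if y q = v then e else 0) - (if m q = v then e else 0) else 0)"
    have shift: "x + c *\<^sub>R w \<in> chain_polytope P r" if "\<bar>c\<bar> \<le> 1" for c
    proof -
      define d where "d = c * e"
      have "\<bar>d\<bar> \<le> e"
        using that e(1) by (simp add: d_def abs_mult mult_left_le_one_le)
      note mono = e(2)[OF this]
      have eq: "(x + c *\<^sub>R w) $ q = ?s d (y q) - ?s d (m q)" if "q \<in> P" for q
        using that by (auto simp: w_def d_def y_def algebra_simps)
      have "0 \<le> ?s d (y q) - ?s d (m q)" if "q \<in> P" for q
        using mono[of "m q" "y q"] that chain_polytope_cube[OF x(2), of q] by (auto simp: V_def y_def)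
      \<comment> \<open>Telescoping from the top element \<open>t\<close> of \<open>K\<close>: the
        rest contributes at most the shifted \<open>m t\<close>, and \<open>t\<close> adds the
        shifted \<open>y t\<close> minus the shifted \<open>m t\<close>. The bound \<open>z\<close>
        varies in the induction; \<open>z = 1\<close> is the chain inequality.\<close>
      moreover have "sum (($) (x + c *\<^sub>R w)) K \<le> ?s d z"
        if "K \<subseteq> P" "is_chain r K" "z \<in> V" "0 \<le> z" "\<And>q. q \<in> K \<Longrightarrow> y q \<le> z" for K z
        using that
      proof (induction "card K" arbitrary: K z rule: less_induct)
        case less
        show ?case
        proof (cases "K = {}")
          case True
          then show ?thesis
            using mono[of 0 z] less.prems v by (auto simp: V_def)
        next
          case False
          interpret dual: finite_poset P "r\<inverse>"
            by (rule dual)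
          obtain t where t: "t \<in> K" "\<And>u. u \<in> K \<Longrightarrow> (t, u) \<in> r \<Longrightarrow> u = t"
            using finite_minimal_element[OF _ False dual.trans_r dual.antisym_r] by auto
          have "t \<in> P"
            using t less.prems by blast
          have "sum (($) (x + c *\<^sub>R w)) (K - {t}) \<le> ?s d (m t)"
          proof (rule less.hyps)
            show "card (K - {t}) < card K"
              using t by (intro psubset_card_mono) auto
            show "y q \<le> m t" if "q \<in> K - {t}" for q
              using that t less.prems(2) m(3)[of q t] by (auto simp: is_chain_def comparable_def y_def)
          qed (use less.prems \<open>t \<in> P\<close> m(1) in \<open>auto simp: V_def intro: is_chain_subset\<close>)
          moreover have "sum (($) (x + c *\<^sub>R w)) K = sum (($) (x + c *\<^sub>R w)) (K - {t}) + (?s d (y t) - ?s d (m t))"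
            using sum.remove[of K t "($) (x + c *\<^sub>R w)"] t(1) eq[OF \<open>t \<in> P\<close>] by simp
          moreover have "?s d (y t) \<le> ?s d z"
            using mono[of "y t" z] less.prems t(1) \<open>t \<in> P\<close> by (auto simp: V_def)
          ultimately show ?thesis
            by linarith
        qed
      qed
      from this[of _ 1] have "sum (($) (x + c *\<^sub>R w)) K \<le> 1" if "K \<subseteq> P" "is_chain r K" for K
        using that v m(2) by (auto simp: V_def y_def)
      ultimately show ?thesis
        using eq x(2) unfolding chain_polytope_iff by (auto simp: w_def)
    qed
    have "\<not> x extreme_point_of (chain_polytope P r)"
    proof (rule not_extreme_if_shift)
      show "x + w \<in> chain_polytope P r" "x - w \<in> chain_polytope P r"
        using shift[of 1] shift[of "- 1"] by auto
      have "w $ p \<noteq> 0"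
        using e(1) v(3) \<open>p \<in> P\<close> by (auto simp: w_def)
      then show "w \<noteq> 0"
        by (metis zero_index)
    qed
    then show False
      using x by simp
  qed
  then obtain A where A: "x = indvec A"
    using eq_indvec_if_01 by blast
  then show "x \<in> indvec ` antichains"
    using x(2) indvec_chain_polytope[of A] by blast
qed

end

section \<open>Triangular faces of the order polytope\<close>

text \<open>Connectedness of the induced comparability graph, stated through cuts rather than paths
  because faces exclude cuts directly. The empty set does not count as connected.\<close>

definition order_connected :: "'a rel \<Rightarrow> 'a set \<Rightarrow> bool" where
  "order_connected r S \<longleftrightarrow>
     S \<noteq> {} \<and> (\<forall>K\<subseteq>S. K \<noteq> {} \<longrightarrow> K \<noteq> S \<longrightarrow> (\<exists>x\<in>K. \<exists>y\<in>S - K. comparable r x y))"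

lemma order_connected_converse [simp]: "order_connected (r\<inverse>) = order_connected r"
  by (simp add: order_connected_def fun_eq_iff)

lemma order_connectedI:
  assumes "S \<noteq> {}"
    and "\<And>K. \<lbrakk>K \<subseteq> S; K \<noteq> {}; K \<noteq> S; \<And>x y. x \<in> K \<Longrightarrow> y \<in> S - K \<Longrightarrow> \<not> comparable r x y\<rbrakk> \<Longrightarrow> False"
  shows "order_connected r S"
  using assms unfolding order_connected_def by blast

lemma order_connected_crossing:
  assumes "order_connected r S" "K \<subseteq> S" "K \<noteq> {}" "K \<noteq> S"
  obtains x y where "x \<in> K" "y \<in> S - K" "comparable r x y"
  using assms unfolding order_connected_def by blast

lemma order_connected_antichain_unique:
  assumes "order_connected r S" "antichain r S" "x \<in> S" "y \<in> S"
  shows "x = y"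
proof (rule ccontr)
  assume "x \<noteq> y"
  then have "{x} \<noteq> S"
    using assms by blast
  then obtain u v where "u \<in> {x}" "v \<in> S - {x}" "comparable r u v"
    using order_connected_crossing[OF assms(1), of "{x}"] assms(3) by blast
  then show False
    using assms(2,3) by (auto simp: antichain_def comparable_def)
qed

lemma antichain_subset: "antichain r A \<Longrightarrow> B \<subseteq> A \<Longrightarrow> antichain r B"
  by (auto simp: antichain_def)

lemma antichain_converse [simp]: "antichain (r\<inverse>) = antichain r"
  by (auto simp: antichain_def fun_eq_iff)

lemma is_chain_converse [simp]: "is_chain (r\<inverse>) = is_chain r"
  by (simp add: is_chain_def fun_eq_iff)

lemma antichain_comparable: "antichain r A \<Longrightarrow> x \<in> A \<Longrightarrow> y \<in> A \<Longrightarrow> comparable r x y \<Longrightarrow> x = y"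
  by (auto simp: antichain_def comparable_def)

context finite_poset
begin

lemma filter_up: "down_closed (r\<inverse>) P F \<Longrightarrow> x \<in> F \<Longrightarrow> (x, y) \<in> r \<Longrightarrow> y \<in> F"
  using le_carrier[of x y] by (auto simp: down_closed_def)

lemma filter_subset: "down_closed (r\<inverse>) P F \<Longrightarrow> F \<subseteq> P"
  by (simp add: down_closed_def)

lemma filterI: "F \<subseteq> P \<Longrightarrow> (\<And>x y. x \<in> F \<Longrightarrow> (x, y) \<in> r \<Longrightarrow> y \<in> F) \<Longrightarrow> down_closed (r\<inverse>) P F"
  by (auto simp: down_closed_def)

text \<open>A disconnected \<open>G - F\<close> or \<open>H - G\<close> would admit a further filter
  in between; a disconnected \<open>H - F\<close> with both parts connected would add the vertex
  \<open>F \<union> (H - G)\<close> and make the face a quadrilateral.\<close>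

definition filter_triples :: "('a set \<times> 'a set \<times> 'a set) set" where
  "filter_triples = {(F, G, H). F \<in> filters \<and> G \<in> filters \<and> H \<in> filters \<and> F \<subset> G \<and> G \<subset> H \<and>
     order_connected r (G - F) \<and> order_connected r (H - G) \<and> order_connected r (H - F)}"

lemma filter_inter_union:
  "F \<in> filters \<Longrightarrow> G \<in> filters \<Longrightarrow> F \<inter> G \<in> filters \<and> F \<union> G \<in> filters"
  by (auto simp: down_closed_def)

lemma order_face_subset:
  assumes "convex hull (indvec ` T) face_of (order_polytope P r)" "card T = 3" "T \<subseteq> filters"
    and "F \<in> T" "G \<in> T"
  shows "F \<subseteq> G \<or> G \<subseteq> F"
proof (cases "F = G")
  case False
  have FG: "F \<in> filters" "G \<in> filters"
    using assms by auto
  have "F \<inter> G = F \<or> F \<inter> G = G"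
  proof (rule convex_hull_face_of_exchange[OF assms(1,2,4,5) False])
    show "indvec (F \<inter> G) \<in> order_polytope P r" "indvec (F \<union> G) \<in> order_polytope P r"
      using filter_inter_union[OF FG] by (simp_all only: indvec_order_polytope)
  qed blast+
  then show ?thesis
    by blast
qed simp

text \<open>A cut \<open>K\<close> of \<open>G - F\<close> yields filters
  \<open>F \<union> K\<close> and \<open>G - K\<close> with the same intersection and union as
  \<open>F\<close> and \<open>G\<close>, so the exchange lemma excludes it.\<close>

lemma order_face_connected:
  assumes "convex hull (indvec ` T) face_of (order_polytope P r)" "card T = 3" "T \<subseteq> filters"
    and "F \<in> T" "G \<in> T" "F \<subset> G"
  shows "order_connected r (G - F)"
proof (rule order_connectedI)
  fix K assume K: "K \<subseteq> G - F" "K \<noteq> {}" "K \<noteq> G - F"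
    and nc: "\<And>x y. x \<in> K \<Longrightarrow> y \<in> (G - F) - K \<Longrightarrow> \<not> comparable r x y"
  have FG: "down_closed (r\<inverse>) P F" "down_closed (r\<inverse>) P G"
    using assms by auto
  have nc': "(x, y) \<notin> r \<and> (y, x) \<notin> r" if "x \<in> K" "y \<in> G" "y \<notin> F" "y \<notin> K" for x y
    using nc[of x y] that by (simp add: comparable_def)
  have "down_closed (r\<inverse>) P (F \<union> K)"
  proof (rule filterI)
    show "F \<union> K \<subseteq> P"
      using FG K(1) filter_subset by blast
    fix x y assume x: "x \<in> F \<union> K" and xy: "(x, y) \<in> r"
    show "y \<in> F \<union> K"
    proof (cases "x \<in> F")
      case False
      then have "x \<in> K" "y \<in> G"
        using x K(1) filter_up[OF FG(2) _ xy] by auto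
      then show ?thesis
        using nc' xy by blast
    qed (use filter_up[OF FG(1) _ xy] in simp)
  qed
  moreover have "down_closed (r\<inverse>) P (G - K)"
  proof (rule filterI)
    show "G - K \<subseteq> P"
      using FG filter_subset by blast
    fix x y assume x: "x \<in> G - K" and xy: "(x, y) \<in> r"
    have "y \<notin> K"
    proof
      assume "y \<in> K"
      moreover have "x \<notin> F"
        using filter_up[OF FG(1) _ xy] \<open>y \<in> K\<close> K(1) by blast
      ultimately show False
        using nc'[of y x] x xy by blast
    qed
    then show "y \<in> G - K"
      using filter_up[OF FG(2) _ xy] x by blast
  qed
  ultimately have 1: "F \<union> K \<in> filters" "G - K \<in> filters"
    by simp_all
  have "F \<union> K = F \<or> F \<union> K = G"
  proof (rule convex_hull_face_of_exchange[OF assms(1,2,4,5)])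
    show "indvec (F \<union> K) \<in> order_polytope P r" "indvec (G - K) \<in> order_polytope P r"
      using 1 by (simp_all only: indvec_order_polytope)
  qed (use K assms(6) in blast)+
  then show False
    using K by blast
qed (use assms(6) in blast)

text \<open>The inequalities tested are \<open>x $ p \<le> 1\<close> on \<open>F\<close>,
  \<open>x $ p \<ge> 0\<close> outside \<open>H\<close>, and \<open>x $ p \<le> x $ q\<close> within
  each block \<open>G - F\<close> and \<open>H - G\<close>. Their equalities force a vertex to be
  \<open>F\<close> plus a union of blocks.\<close>

lemma order_face_if_triple:
  assumes "(F, G, H) \<in> filter_triples"
  shows "convex hull (indvec ` {F, G, H}) face_of (order_polytope P r)"
proof (rule convex_hull_face_of_tight[OF compact_order_polytope convex_order_polytope extreme_points_order_polytope])
  have T: "down_closed (r\<inverse>) P F" "down_closed (r\<inverse>) P G" "down_closed (r\<inverse>) P H"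
    "F \<subset> G" "G \<subset> H" "order_connected r (G - F)" "order_connected r (H - G)" "order_connected r (H - F)"
    using assms by (auto simp: filter_triples_def)
  show "{F, G, H} \<subseteq> filters"
    using T by auto
  fix A assume A: "A \<in> filters"
    and tight: "\<And>w c. (\<And>x. x \<in> order_polytope P r \<Longrightarrow> w \<bullet> x \<le> c) \<Longrightarrow>
      (\<And>B. B \<in> {F, G, H} \<Longrightarrow> w \<bullet> indvec B = c) \<Longrightarrow> w \<bullet> indvec A = c"
  have P: "F \<subseteq> P" "G \<subseteq> P" "H \<subseteq> P" "A \<subseteq> P"
    using T A by (auto simp: down_closed_def)
  have "p \<in> A" if "p \<in> F" for p
  proof -
    have "axis p 1 \<bullet> indvec A = (1 :: real)"
    proof (rule tight)
      show "axis p 1 \<bullet> x \<le> 1" if "x \<in> order_polytope P r" for x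
        using order_polytope_cube[OF that] by (simp add: inner_axis')
      show "axis p 1 \<bullet> indvec B = 1" if "B \<in> {F, G, H}" for B
        using that \<open>p \<in> F\<close> T(4,5) by (auto simp: inner_axis')
    qed
    then show ?thesis
      by (simp add: inner_axis' split: if_splits)
  qed
  then have "F \<subseteq> A"
    by blast
  have "p \<in> H" if "p \<in> A" for p
  proof (rule ccontr)
    assume "p \<notin> H"
    have "- axis p 1 \<bullet> indvec A = (0 :: real)"
    proof (rule tight)
      show "- axis p 1 \<bullet> x \<le> 0" if "x \<in> order_polytope P r" for x
        using order_polytope_cube[OF that] by (simp add: inner_axis')
      show "- axis p 1 \<bullet> indvec B = 0" if "B \<in> {F, G, H}" for B
        using that \<open>p \<notin> H\<close> T(4,5) by (auto simp: inner_axis')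
    qed
    then show False
      using that by (simp add: inner_axis')
  qed
  then have "A \<subseteq> H"
    by blast
  have level: "p \<in> A \<longleftrightarrow> q \<in> A" if "(p, q) \<in> r" "p \<in> G - F \<and> q \<in> G - F \<or> p \<in> H - G \<and> q \<in> H - G" for p q
  proof -
    have "(axis p 1 - axis q 1) \<bullet> x \<le> 0" if "x \<in> order_polytope P r" for x
      using that \<open>(p, q) \<in> r\<close> le_carrier by (auto simp: inner_diff_left inner_axis' order_polytope_def)
    moreover have "(axis p 1 - axis q 1) \<bullet> indvec B = 0" if "B \<in> {F, G, H}" for B
      using that \<open>p \<in> G - F \<and> q \<in> G - F \<or> p \<in> H - G \<and> q \<in> H - G\<close> T(4,5)
      by (auto simp: inner_diff_left inner_axis')
    ultimately have "(axis p 1 - axis q 1) \<bullet> indvec A = 0"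
      by (rule tight)
    then show ?thesis
      by (simp add: inner_diff_left inner_axis' split: if_splits)
  qed
  have all_or_none: "B \<subseteq> A \<or> B \<inter> A = {}" if B: "order_connected r B" "B = G - F \<or> B = H - G" for B
  proof (rule ccontr)
    assume "\<not> (B \<subseteq> A \<or> B \<inter> A = {})"
    then obtain x y where "x \<in> B \<inter> A" "y \<in> B - B \<inter> A" "comparable r x y"
      using order_connected_crossing[OF B(1), of "B \<inter> A"] by blast
    then show False
      using level[of x y] level[of y x] B(2) by (auto simp: comparable_def)
  qed
  \<comment> \<open>Excludes \<open>F \<union> (H - G)\<close>: as \<open>G\<close> is a filter, a
    relation between the blocks goes up from \<open>H - G\<close> to \<open>G - F\<close>, and this
    candidate is not closed under it.\<close>
  have "\<not> (H - G \<subseteq> A \<and> (G - F) \<inter> A = {})"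
  proof
    assume *: "H - G \<subseteq> A \<and> (G - F) \<inter> A = {}"
    obtain x y where xy: "x \<in> H - G" "y \<in> (H - F) - (H - G)" "comparable r x y"
      using order_connected_crossing[OF T(8), of "H - G"] T(4,5) by blast
    then have y: "y \<in> G - F"
      by blast
    have "y \<in> A" if "(x, y) \<in> r"
      using filter_up[of A x y] that xy(1) * A by blast
    moreover have "x \<in> G" if "(y, x) \<in> r"
      using filter_up[OF T(2), of y x] that y by blast
    ultimately show False
      using xy y * by (auto simp: comparable_def)
  qed
  then show "A \<in> {F, G, H}"
    using all_or_none[OF T(6)] all_or_none[OF T(7)] \<open>F \<subseteq> A\<close> \<open>A \<subseteq> H\<close> T(4,5) by blast
qed

lemma three_chain:
  assumes "card T = 3" "\<And>F G. F \<in> T \<Longrightarrow> G \<in> T \<Longrightarrow> F \<subseteq> G \<or> G \<subseteq> F"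
  obtains F G H :: "'b set" where "T = {F, G, H}" "F \<subset> G" "G \<subset> H"
proof -
  obtain X Y Z where T: "T = {X, Y, Z}" "X \<noteq> Y" "X \<noteq> Z" "Y \<noteq> Z"
    using assms(1) by (auto simp: card_3_iff)
  have "T = {X, Z, Y}" "T = {Y, X, Z}" "T = {Y, Z, X}" "T = {Z, X, Y}" "T = {Z, Y, X}"
    using T(1) by auto
  note perms = that[OF T(1)] this[THEN that]
  from T have "X \<subset> Y \<or> Y \<subset> X" "X \<subset> Z \<or> Z \<subset> X" "Y \<subset> Z \<or> Z \<subset> Y"
    using assms(2)[of X Y] assms(2)[of X Z] assms(2)[of Y Z] by auto
  then consider "X \<subset> Y" "Y \<subset> Z" | "X \<subset> Z" "Z \<subset> Y" | "Y \<subset> X" "X \<subset> Z" | "Y \<subset> Z" "Z \<subset> X"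
    | "Z \<subset> X" "X \<subset> Y" | "Z \<subset> Y" "Y \<subset> X"
    by (metis psubset_trans)
  then show thesis
    by cases (rule perms, assumption, assumption)+
qed

lemma num_triangular_faces_order_polytope:
  "num_triangular_faces (order_polytope P r) = card filter_triples"
proof -
  let ?h = "\<lambda>(F, G, H). {F, G, H}"
  let ?N = "{T. T \<subseteq> filters \<and> card T = 3 \<and> (convex hull (indvec ` T)) face_of (order_polytope P r)}"
  have "inj_on ?h filter_triples"
  proof (rule inj_onI)
    fix t t' assume "t \<in> filter_triples" "t' \<in> filter_triples" "?h t = ?h t'"
    moreover obtain F G H F' G' H' where t: "t = (F, G, H)" "t' = (F', G', H')"
      by (metis prod_cases3)
    ultimately have "(F, G, H) \<in> filter_triples" "(F', G', H') \<in> filter_triples"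
      and eq: "{F, G, H} = {F', G', H'}"
      by simp_all
    then have c: "F \<subset> G" "G \<subset> H" "F' \<subset> G'" "G' \<subset> H'"
      by (auto simp: filter_triples_def)
    have "\<Inter> {F, G, H} = F" "\<Inter> {F', G', H'} = F'" "\<Union> {F, G, H} = H" "\<Union> {F', G', H'} = H'"
      using c by auto
    then have FH: "F = F'" "H = H'"
      using eq by metis+
    have "G \<in> {F', G', H'}" "G \<noteq> F" "G \<noteq> H"
      using c eq by blast+
    then show "t = t'"
      using FH t by simp
  qed
  moreover have "?h ` filter_triples = ?N"
  proof (intro equalityI subsetI)
    fix T assume "T \<in> ?h ` filter_triples"
    then obtain F G H where T: "T = {F, G, H}" "(F, G, H) \<in> filter_triples"
      by auto
    then have "F \<subset> G" "G \<subset> H" "T \<subseteq> filters"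
      by (auto simp: filter_triples_def)
    then have "F \<noteq> G" "G \<noteq> H" "F \<noteq> H"
      by blast+
    then have "card T = 3"
      by (simp add: T(1))
    then show "T \<in> ?N"
      using order_face_if_triple[OF T(2)] \<open>T \<subseteq> filters\<close> T(1) by blast
  next
    fix T assume "T \<in> ?N"
    then have T: "T \<subseteq> filters" "card T = 3" "convex hull (indvec ` T) face_of (order_polytope P r)"
      by auto
    obtain F G H where FGH: "T = {F, G, H}" "F \<subset> G" "G \<subset> H"
      using three_chain[OF T(2) order_face_subset[OF T(3,2,1)]] by blast
    have "(F, G, H) \<in> filter_triples"
    proof -
      have "F \<in> T" "G \<in> T" "H \<in> T" "F \<subset> H"
        using FGH by blast+
      then show ?thesis
        using FGH(2,3) T(1) order_face_connected[OF T(3,2,1)]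
        by (simp add: filter_triples_def subset_iff)
    qed
    then show "T \<in> ?h ` filter_triples"
      by (rule image_eqI[rotated]) (simp add: FGH(1))
  qed
  ultimately have "card ?N = card filter_triples"
    using card_image[of ?h filter_triples] by argo
  then show ?thesis
    using num_triangular_faces_indvec[OF compact_order_polytope convex_order_polytope extreme_points_order_polytope]
    by argo
qed

end

section \<open>Triangular faces of the chain polytope\<close>

text \<open>Compares two sets only where they differ, so nested sets are \<open>lower\<close> in
  both directions; nonempty differences break this tie later.\<close>

definition lower :: "'a rel \<Rightarrow> 'a set \<Rightarrow> 'a set \<Rightarrow> bool" where
  "lower r A B \<longleftrightarrow> (\<forall>x\<in>A - B. \<forall>y\<in>B - A. (y, x) \<notin> r)"

lemma lowerD: "lower r A B \<Longrightarrow> x \<in> A - B \<Longrightarrow> y \<in> B - A \<Longrightarrow> (y, x) \<notin> r"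
  unfolding lower_def by blast

lemma lower_converse: "lower (r\<inverse>) A B \<longleftrightarrow> lower r B A"
  unfolding lower_def by auto

text \<open>By connectedness \<open>z\<close> has a neighbour in the symmetric difference, and the
  antichain \<open>A\<close> cannot contain it.\<close>

lemma exists_comparable:
  assumes "order_connected r (sym_diff A B)" "antichain r A" "z \<in> A - B" "B - A \<noteq> {}"
  obtains y where "y \<in> B - A" "comparable r z y"
proof -
  obtain b where b: "b \<in> sym_diff A B" "b \<noteq> z"
    using assms(3,4) by auto
  have "{z} \<subseteq> sym_diff A B" "{z} \<noteq> {}" "{z} \<noteq> sym_diff A B"
    using assms(3) b by auto
  from order_connected_crossing[OF assms(1) this]
  obtain y where y: "y \<in> sym_diff A B - {z}" "comparable r z y"
    by (metis singletonD)
  then have "y \<notin> A"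
    using antichain_comparable[OF assms(2), of z y] assms(3) by blast
  then show thesis
    using that y by blast
qed

context finite_poset
begin

text \<open>Across a cut \<open>K\<close> of the symmetric difference the parts of \<open>A\<close>
  and \<open>B\<close> in \<open>K\<close> can be swapped. The results are antichains, since nothing
  in \<open>K\<close> is comparable to the rest, and have the same intersection and union.\<close>

lemma chain_face_connected:
  assumes "convex hull (indvec ` T) face_of (chain_polytope P r)" "card T = 3" "T \<subseteq> antichains"
    and "A \<in> T" "B \<in> T" "A \<noteq> B"
  shows "order_connected r (sym_diff A B)"
proof (rule order_connectedI)
  fix K assume K: "K \<subseteq> sym_diff A B" "K \<noteq> {}" "K \<noteq> sym_diff A B"
    and nc: "\<And>x y. x \<in> K \<Longrightarrow> y \<in> sym_diff A B - K \<Longrightarrow> \<not> comparable r x y"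
  have AB: "A \<subseteq> P" "B \<subseteq> P" "antichain r A" "antichain r B"
    using assms by auto
  have swap: "antichain r (sym_diff A K)"
    if "antichain r A" "antichain r B" "K \<subseteq> sym_diff A B"
      and nc: "\<And>x y. x \<in> K \<Longrightarrow> y \<in> sym_diff A B - K \<Longrightarrow> \<not> comparable r x y" for A B
  proof -
    have "x = y" if x: "x \<in> sym_diff A K" and y: "y \<in> sym_diff A K" and xy: "comparable r x y" for x y
    proof -
      consider "x \<in> A" "y \<in> A" | "x \<in> B" "y \<in> B" | "x \<in> A - B - K" "y \<in> K" | "x \<in> K" "y \<in> A - B - K"
        using x y \<open>K \<subseteq> sym_diff A B\<close> by blast
      then show ?thesis
      proof cases
        case 1
        then show ?thesis
          using antichain_comparable[OF \<open>antichain r A\<close>] xy by blast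
      next
        case 2
        then show ?thesis
          using antichain_comparable[OF \<open>antichain r B\<close>] xy by blast
      next
        case 3
        then show ?thesis
          using nc[of y x] xy comparable_sym[of r x y] by blast
      next
        case 4
        then show ?thesis
          using nc[of x y] xy by blast
      qed
    qed
    then show ?thesis
      by (simp add: antichain_def comparable_def)
  qed
  have "sym_diff A K \<in> antichains" "sym_diff B K \<in> antichains"
    using swap[OF AB(3,4) K(1) nc] swap[OF AB(4,3)] K(1) nc AB(1,2) by (auto simp: Un_commute)
  then have "sym_diff A K = A \<or> sym_diff A K = B"
    using K(1)
    by (intro convex_hull_face_of_exchange[OF assms(1,2,4,5,6), of _ "sym_diff B K"])
      (simp_all only: indvec_chain_polytope, blast+)
  then show False
    using K by blast
qed (use assms(6) in blast)

text \<open>Selects one ordering of the vertices of a triangle. The form is self-dual: reversing the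
  order exchanges \<open>A\<close> and \<open>C\<close>. The set \<open>B\<close> may be contained
  in \<open>A\<close> or \<open>C\<close>, but contains neither.\<close>

definition antichain_triples :: "('a set \<times> 'a set \<times> 'a set) set" where
  "antichain_triples = {(A, B, C). A \<in> antichains \<and> B \<in> antichains \<and> C \<in> antichains \<and>
     A \<inter> C \<subseteq> B \<and> A - B \<noteq> {} \<and> C - B \<noteq> {} \<and> lower r A B \<and> lower r B C \<and> lower r A C \<and>
     order_connected r (sym_diff A B) \<and> order_connected r (sym_diff B C) \<and>
     order_connected r (sym_diff A C)}"

lemma antichain_triplesD:
  assumes "(A, B, C) \<in> antichain_triples"
  shows "A \<subseteq> P" "B \<subseteq> P" "C \<subseteq> P" "antichain r A" "antichain r B" "antichain r C"
    "A \<inter> C \<subseteq> B" "A - B \<noteq> {}" "C - B \<noteq> {}" "lower r A B" "lower r B C" "lower r A C"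
    "order_connected r (sym_diff A B)" "order_connected r (sym_diff B C)" "order_connected r (sym_diff A C)"
  using assms by (simp_all add: antichain_triples_def)

lemma antichain_triples_converse:
  "(A, B, C) \<in> antichain_triples \<longleftrightarrow> (C, B, A) \<in> finite_poset.antichain_triples P (r\<inverse>)"
proof -
  interpret dual: finite_poset P "r\<inverse>"
    by (rule dual)
  show ?thesis
    by (auto simp: antichain_triples_def dual.antichain_triples_def lower_converse Un_commute Int_commute)
qed

lemma antichain_triple_below:
  assumes "(A, B, C) \<in> antichain_triples" "z \<in> B - A"
  obtains x where "x \<in> A - B" "(x, z) \<in> r"
proof -
  note T = antichain_triplesD[OF assms(1)]
  obtain x where "x \<in> A - B" "comparable r z x"
    using exists_comparable[OF _ T(5) assms(2) T(8)] T(13) by (auto simp: Un_commute)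
  then show thesis
    using that lowerD[OF T(10), of x z] assms(2) by (auto simp: comparable_def)
qed

lemma antichain_triple_above:
  assumes "(A, B, C) \<in> antichain_triples" "z \<in> B - C"
  obtains x where "x \<in> C - B" "(z, x) \<in> r"
proof -
  interpret dual: finite_poset P "r\<inverse>"
    by (rule dual)
  show thesis
    using dual.antichain_triple_below[of C B A z] assms antichain_triples_converse that by auto
qed

lemma is_chain_pair: "(x, y) \<in> r \<Longrightarrow> is_chain r {x, y}"
  using le_carrier[of x y] le_refl[of x] le_refl[of y] by (simp add: is_chain_def comparable_def)

lemma is_chain_triple: "(x, y) \<in> r \<Longrightarrow> (y, z) \<in> r \<Longrightarrow> is_chain r {x, y, z}"
  using le_trans[of x y z] le_carrier[of x y] le_carrier[of y z] le_refl[of x] le_refl[of y] le_refl[of z]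
  by (simp add: is_chain_def comparable_def)

text \<open>\<open>S\<close> satisfies with equality every chain inequality that is tight at
  \<open>A\<close>, \<open>B\<close> and \<open>C\<close>. Chains of one, two and three elements
  will suffice.\<close>

definition tight_at :: "'a set \<times> 'a set \<times> 'a set \<Rightarrow> 'a set \<Rightarrow> bool" where
  "tight_at = (\<lambda>(A, B, C) S. \<forall>K. is_chain r K \<longrightarrow> K \<subseteq> P \<longrightarrow>
     (\<exists>x. K \<inter> A = {x}) \<longrightarrow> (\<exists>x. K \<inter> B = {x}) \<longrightarrow> (\<exists>x. K \<inter> C = {x}) \<longrightarrow> (\<exists>x. K \<inter> S = {x}))"

lemma tight_at_converse: "tight_at (A, B, C) S \<longleftrightarrow> finite_poset.tight_at P (r\<inverse>) (C, B, A) S"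
proof -
  interpret dual: finite_poset P "r\<inverse>"
    by (rule dual)
  show ?thesis
    by (auto simp: tight_at_def dual.tight_at_def)
qed

lemma tight_atD:
  assumes "tight_at (A, B, C) S" "is_chain r K" "K \<subseteq> P" "K \<inter> A = {x}" "K \<inter> B = {y}" "K \<inter> C = {z}"
  obtains s where "K \<inter> S = {s}"
proof -
  have "\<exists>s. K \<inter> S = {s}"
    using assms(1)[unfolded tight_at_def prod.case, rule_format, OF assms(2,3)] assms(4-6) by blast
  then show thesis
    using that by blast
qed

lemma tight_at_pair_below:
  assumes "(A, B, C) \<in> antichain_triples" "tight_at (A, B, C) S" "x \<in> A - B" "z \<in> B \<inter> C - A" "(x, z) \<in> r"
  shows "x \<in> S \<longleftrightarrow> z \<notin> S"
proof -
  note T = antichain_triplesD[OF assms(1)]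
  have "{x, z} \<inter> A = {x}" "{x, z} \<inter> B = {z}" "{x, z} \<inter> C = {z}" "{x, z} \<subseteq> P" "x \<noteq> z"
    using assms(3,4) T(1-3,7) by blast+
  from tight_atD[OF assms(2) is_chain_pair[OF assms(5)] this(4,1-3)] obtain s where "{x, z} \<inter> S = {s}" .
  then show ?thesis
    using \<open>x \<noteq> z\<close> by (cases "x \<in> S"; cases "z \<in> S") auto
qed

lemma tight_at_triple:
  assumes "(A, B, C) \<in> antichain_triples" "tight_at (A, B, C) S" "x \<in> A - B" "z \<in> B - A - C" "y \<in> C - B"
    "(x, z) \<in> r" "(z, y) \<in> r"
  shows "x \<in> S \<and> z \<notin> S \<and> y \<notin> S \<or> x \<notin> S \<and> z \<in> S \<and> y \<notin> S \<or> x \<notin> S \<and> z \<notin> S \<and> y \<in> S"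
proof -
  note T = antichain_triplesD[OF assms(1)]
  have "{x, z, y} \<inter> A = {x}" "{x, z, y} \<inter> B = {z}" "{x, z, y} \<inter> C = {y}" "{x, z, y} \<subseteq> P" "x \<noteq> z" "z \<noteq> y" "x \<noteq> y"
    using assms(3-5) T(1-3,7) by blast+
  from tight_atD[OF assms(2) is_chain_triple[OF assms(6,7)] this(4,1-3)] obtain s where "{x, z, y} \<inter> S = {s}" .
  then show ?thesis
    using \<open>x \<noteq> z\<close> \<open>z \<noteq> y\<close> \<open>x \<noteq> y\<close> by (cases "x \<in> S"; cases "z \<in> S"; cases "y \<in> S") auto
qed

text \<open>Along each relation inside \<open>sym_diff A B\<close>, tightness makes \<open>S\<close>
  look like \<open>A\<close> at both ends or at neither; connectedness spreads this over the whole
  set.\<close>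

lemma tight_dichotomy:
  assumes T: "(A, B, C) \<in> antichain_triples" and tight: "tight_at (A, B, C) S" and S: "antichain r S"
  shows "A - B \<subseteq> S \<and> (B - A) \<inter> S = {} \<or> (A - B) \<inter> S = {} \<and> B \<inter> C - A \<subseteq> S"
proof -
  note D = antichain_triplesD[OF T]
  \<comment> \<open>\<open>K\<close> collects the points where \<open>S\<close> looks like
    \<open>A\<close>. For \<open>z\<close> outside \<open>A\<close> and \<open>C\<close>, absence
    from \<open>S\<close> decides nothing, since \<open>S\<close> may contain a point of
    \<open>C\<close> above \<open>z\<close> instead; so the elements below \<open>z\<close> are
    consulted.\<close>
  define K where "K = {z \<in> sym_diff A B. if z \<in> A then z \<in> S else if z \<in> C then z \<notin> S
    else \<exists>x\<in>A - B. (x, z) \<in> r \<and> x \<in> S}"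
  have step: "x \<in> K \<longleftrightarrow> z \<in> K" if xz: "x \<in> A - B" "z \<in> B - A" "(x, z) \<in> r" for x z
  proof -
    have xK: "x \<in> K \<longleftrightarrow> x \<in> S"
      using xz by (simp add: K_def)
    show ?thesis
    proof (cases "z \<in> C")
      case True
      then have "z \<in> K \<longleftrightarrow> z \<notin> S"
        using xz by (simp add: K_def)
      then show ?thesis
        using xK tight_at_pair_below[OF T tight xz(1) _ xz(3)] True xz(2) by blast
    next
      case False
      then have zK: "z \<in> K \<longleftrightarrow> (\<exists>x\<in>A - B. (x, z) \<in> r \<and> x \<in> S)"
        using xz by (simp add: K_def)
      obtain y where y: "y \<in> C - B" "(z, y) \<in> r"
        using antichain_triple_above[OF T, of z] False xz(2) by blast
      \<comment> \<open>With \<open>y\<close> fixed, all elements of \<open>A - B\<close> below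
        \<open>z\<close> agree on membership in \<open>S\<close>.\<close>
      have "x' \<in> S \<longleftrightarrow> z \<notin> S \<and> y \<notin> S" if "x' \<in> A - B" "(x', z) \<in> r" for x'
        using tight_at_triple[OF T tight that(1) _ y(1) that(2) y(2)] False xz(2) by blast
      then show ?thesis
        using xK zK xz by blast
    qed
  qed
  have "K = {} \<or> K = sym_diff A B"
  proof (rule ccontr)
    assume neg: "\<not> (K = {} \<or> K = sym_diff A B)"
    have "K \<subseteq> sym_diff A B"
      by (auto simp: K_def)
    then obtain u v where uv: "u \<in> K" "v \<in> sym_diff A B - K" "comparable r u v"
      using order_connected_crossing[OF D(13), of K] neg by blast
    have "u \<in> sym_diff A B"
      using uv(1) \<open>K \<subseteq> sym_diff A B\<close> by blast
    then consider "u \<in> A - B" "v \<in> A - B" | "u \<in> B - A" "v \<in> B - A" | "u \<in> A - B" "v \<in> B - A" | "u \<in> B - A" "v \<in> A - B"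
      using uv(2) by blast
    then show False
    proof cases
      case 1
      then show ?thesis
        using antichain_comparable[OF D(4) _ _ uv(3)] uv(1,2) by blast
    next
      case 2
      then show ?thesis
        using antichain_comparable[OF D(5) _ _ uv(3)] uv(1,2) by blast
    next
      case 3
      then show ?thesis
        using lowerD[OF D(10) 3] step[OF 3] uv by (simp add: comparable_def)
    next
      case 4
      then show ?thesis
        using lowerD[OF D(10) 4(2,1)] step[OF 4(2,1)] uv by (simp add: comparable_def)
    qed
  qed
  then show ?thesis
  proof
    assume "K = {}"
    have "x \<notin> S" if "x \<in> A - B" for x
      using \<open>K = {}\<close> that by (auto simp: K_def)
    moreover have "z \<in> S" if "z \<in> B \<inter> C - A" for z
      using \<open>K = {}\<close> that by (auto simp: K_def)
    ultimately show ?thesis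
      by blast
  next
    assume K: "K = sym_diff A B"
    have a: "x \<in> S" if "x \<in> A - B" for x
    proof -
      have "x \<in> K"
        using that K by blast
      then show ?thesis
        using that by (simp add: K_def)
    qed
    have "z \<notin> S" if z: "z \<in> B - A" for z
    proof
      assume "z \<in> S"
      obtain x where x: "x \<in> A - B" "(x, z) \<in> r"
        using antichain_triple_below[OF T z] by blast
      then have "x = z"
        using S a \<open>z \<in> S\<close> by (simp add: antichain_def)
      then show False
        using x z by blast
    qed
    then show ?thesis
      using a by blast
  qed
qed

text \<open>The dichotomy and its dual ask whether \<open>S\<close> looks like \<open>A\<close> at
  the lower end and like \<open>C\<close> at the upper end. Exactly one yes gives \<open>A\<close>
  or \<open>C\<close>, none gives \<open>B\<close>, and two contradict connectedness of
  \<open>sym_diff A C\<close>.\<close>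

lemma tight_vertices:
  assumes T: "(A, B, C) \<in> antichain_triples" and tight: "tight_at (A, B, C) S" and S: "antichain r S"
    and sub: "S \<subseteq> A \<union> B \<union> C" "S \<subseteq> P"
  shows "S \<in> {A, B, C}"
proof -
  interpret dual: finite_poset P "r\<inverse>"
    by (rule dual)
  note D = antichain_triplesD[OF T]
  have M: "A \<inter> C \<subseteq> S"
  proof
    fix m assume m: "m \<in> A \<inter> C"
    have "is_chain r {m}"
      using m D(1) le_refl[of m] by (auto simp: is_chain_def comparable_def)
    moreover have "{m} \<inter> A = {m}" "{m} \<inter> B = {m}" "{m} \<inter> C = {m}" "{m} \<subseteq> P"
      using m D(1,7) by blast+
    ultimately obtain s where "{m} \<inter> S = {s}"
      using tight_atD[OF tight] by metis
    then show "m \<in> S"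
      by (cases "m \<in> S") auto
  qed
  have down: "A - B \<subseteq> S \<and> (B - A) \<inter> S = {} \<or> (A - B) \<inter> S = {} \<and> B \<inter> C - A \<subseteq> S"
    by (rule tight_dichotomy[OF T tight S])
  have up: "C - B \<subseteq> S \<and> (B - C) \<inter> S = {} \<or> (C - B) \<inter> S = {} \<and> B \<inter> A - C \<subseteq> S"
    using dual.tight_dichotomy[of C B A S] T tight S antichain_triples_converse tight_at_converse by simp
  show ?thesis
  proof (cases "A - B \<subseteq> S \<and> (B - A) \<inter> S = {}")
    case a: True
    show ?thesis
    proof (cases "C - B \<subseteq> S \<and> (B - C) \<inter> S = {}")
      case c: True
      \<comment> \<open>If \<open>S\<close> contains both \<open>A - B\<close> and
        \<open>C - B\<close>, any point of \<open>?K\<close> and any point of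
        \<open>sym_diff A C - ?K\<close> lie together in one of the antichains \<open>A\<close>,
        \<open>B\<close>, \<open>C\<close>, \<open>S\<close>, so \<open>?K\<close> is a cut.\<close>
      let ?K = "(A - B) \<union> (B \<inter> C - A)"
      have "?K \<subseteq> sym_diff A C" "?K \<noteq> {}" "?K \<noteq> sym_diff A C"
        using D(7-9) by blast+
      then obtain u v where uv: "u \<in> ?K" "v \<in> sym_diff A C - ?K" "comparable r u v"
        using order_connected_crossing[OF D(15)] by metis
      have "u \<in> A \<and> v \<in> A \<or> u \<in> S \<and> v \<in> S \<or> u \<in> B \<and> v \<in> B \<or> u \<in> C \<and> v \<in> C"
        using uv(1,2) a c by blast
      then have "u = v"
        using antichain_comparable uv(3) S D(4-6) by metis
      then show ?thesis
        using uv by blast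
    next
      case False
      then have "(C - B) \<inter> S = {}" "B \<inter> A - C \<subseteq> S"
        using up by blast+
      then have "S = A"
        using a M sub(1) by blast
      then show ?thesis
        by simp
    qed
  next
    case False
    then have a: "(A - B) \<inter> S = {}" "B \<inter> C - A \<subseteq> S"
      using down by blast+
    show ?thesis
    proof (cases "C - B \<subseteq> S \<and> (B - C) \<inter> S = {}")
      case True
      then have "S = C"
        using a M sub(1) by blast
      then show ?thesis
        by simp
    next
      case False
      then have c: "(C - B) \<inter> S = {}" "B \<inter> A - C \<subseteq> S"
        using up by blast+
      have "z \<in> S" if z: "z \<in> B - A - C" for z
      proof -
        have "z \<in> B - A" "z \<in> B - C"
          using z by blast+
        obtain x where x: "x \<in> A - B" "(x, z) \<in> r"
          by (rule antichain_triple_below[OF T \<open>z \<in> B - A\<close>])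
        obtain y where y: "y \<in> C - B" "(z, y) \<in> r"
          by (rule antichain_triple_above[OF T \<open>z \<in> B - C\<close>])
        show ?thesis
          using tight_at_triple[OF T tight x(1) z y(1) x(2) y(2)] x(1) y(1) a(1) c(1) by blast
      qed
      then have "S = B"
        using a c M sub(1) by blast
      then show ?thesis
        by simp
    qed
  qed
qed

lemma chain_face_if_triple:
  assumes "(A, B, C) \<in> antichain_triples"
  shows "convex hull (indvec ` {A, B, C}) face_of (chain_polytope P r)"
proof (rule convex_hull_face_of_tight[OF compact_chain_polytope convex_chain_polytope extreme_points_chain_polytope])
  note D = antichain_triplesD[OF assms]
  show "{A, B, C} \<subseteq> antichains"
    using D by auto
  fix S assume S: "S \<in> antichains"
    and eq: "\<And>w c. (\<And>x. x \<in> chain_polytope P r \<Longrightarrow> w \<bullet> x \<le> c) \<Longrightarrow>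
      (\<And>S'. S' \<in> {A, B, C} \<Longrightarrow> w \<bullet> indvec S' = c) \<Longrightarrow> w \<bullet> indvec S = c"
  have "S \<subseteq> A \<union> B \<union> C"
  proof (rule ccontr)
    assume "\<not> S \<subseteq> A \<union> B \<union> C"
    then obtain p where p: "p \<in> S" "p \<notin> A \<union> B \<union> C"
      by blast
    have "- axis p 1 \<bullet> indvec S = (0 :: real)"
    proof (rule eq)
      show "- axis p 1 \<bullet> x \<le> 0" if "x \<in> chain_polytope P r" for x
        using chain_polytope_cube[OF that] by (simp add: inner_axis')
      show "- axis p 1 \<bullet> indvec S' = 0" if "S' \<in> {A, B, C}" for S'
        using that p by (auto simp: inner_axis')
    qed
    then show False
      using p by (simp add: inner_axis')
  qed
  moreover have "tight_at (A, B, C) S"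
    unfolding tight_at_def prod.case
  proof (intro allI impI)
    fix K assume K: "is_chain r K" "K \<subseteq> P" "\<exists>x. K \<inter> A = {x}" "\<exists>x. K \<inter> B = {x}" "\<exists>x. K \<inter> C = {x}"
    let ?w = "\<Sum>p\<in>K. axis p 1"
    have w: "?w \<bullet> x = (\<Sum>p\<in>K. x $ p)" for x :: "real ^ 'a"
      by (simp add: inner_sum_left inner_axis')
    have card: "?w \<bullet> indvec S' = real (card (K \<inter> S'))" for S'
      by (simp add: w sum.If_cases)
    have "?w \<bullet> indvec S = 1"
    proof (rule eq)
      show "?w \<bullet> x \<le> 1" if "x \<in> chain_polytope P r" for x
        using chain_polytope_chainD[OF that K(2,1)] by (simp only: w)
      show "?w \<bullet> indvec S' = 1" if "S' \<in> {A, B, C}" for S'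
        using that K(3-5) unfolding card by auto
    qed
    then have "card (K \<inter> S) = 1"
      unfolding card by simp
    then show "\<exists>x. K \<inter> S = {x}"
      by (simp add: card_1_singleton_iff)
  qed
  ultimately show "S \<in> {A, B, C}"
    using tight_vertices[OF assms, of S] S by blast
qed

section \<open>Ordering the vertices of a triangle of antichains\<close>

definition up :: "'a set \<Rightarrow> 'a set" where
  "up A = {p. \<exists>a\<in>A. (a, p) \<in> r}"

text \<open>Of two nested antichains the larger counts as the lower one, in agreement with inclusion
  of the generated filters.\<close>

definition adjacent_below :: "'a set \<Rightarrow> 'a set \<Rightarrow> bool" where
  "adjacent_below A B \<longleftrightarrow> order_connected r (sym_diff A B) \<and> lower r A B \<and> A - B \<noteq> {}"

lemma adjacent_belowD:
  "adjacent_below A B \<Longrightarrow> order_connected r (sym_diff A B)"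
  "adjacent_below A B \<Longrightarrow> lower r A B"
  "adjacent_below A B \<Longrightarrow> A - B \<noteq> {}"
  by (simp_all add: adjacent_below_def)

lemma adjacent_below_below:
  assumes "adjacent_below A B" "antichain r B" "z \<in> B - A"
  obtains x where "x \<in> A - B" "(x, z) \<in> r"
proof -
  have "order_connected r (sym_diff B A)"
    using adjacent_belowD(1)[OF assms(1)] by (simp add: Un_commute)
  from exists_comparable[OF this assms(2,3) adjacent_belowD(3)[OF assms(1)]]
  obtain x where x: "x \<in> A - B" "comparable r z x" .
  then have "(x, z) \<in> r"
    using lowerD[OF adjacent_belowD(2)[OF assms(1)], of x z] assms(3) by (simp add: comparable_def)
  then show thesis
    using that x(1) by blast
qed

lemma adjacent_below_above:
  assumes "adjacent_below A B" "antichain r A" "z \<in> A - B" "B - A \<noteq> {}"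
  obtains y where "y \<in> B - A" "(z, y) \<in> r"
proof -
  from exists_comparable[OF adjacent_belowD(1)[OF assms(1)] assms(2,3,4)]
  obtain y where y: "y \<in> B - A" "comparable r z y" .
  then have "(z, y) \<in> r"
    using lowerD[OF adjacent_belowD(2)[OF assms(1)], of z y] assms(3) by (simp add: comparable_def)
  then show thesis
    using that y(1) by blast
qed

text \<open>The generated filters shrink strictly, so \<open>adjacent_below\<close> has no
  cycles.\<close>

lemma adjacent_below_up:
  assumes "adjacent_below A B" "A \<in> antichains" "B \<in> antichains"
  shows "card (up B) < card (up A)"
proof (rule psubset_card_mono)
  have A: "antichain r A" and B: "antichain r B" and sub: "A \<subseteq> P" "B \<subseteq> P"
    using assms by auto
  have "up B \<subseteq> up A"
  proof
    fix p assume "p \<in> up B"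
    then obtain b where b: "b \<in> B" "(b, p) \<in> r"
      by (auto simp: up_def)
    show "p \<in> up A"
    proof (cases "b \<in> A")
      case False
      obtain x where "x \<in> A - B" "(x, b) \<in> r"
        by (rule adjacent_below_below[OF assms(1) B, of b]) (use b False in auto)
      then show ?thesis
        using le_trans[OF _ b(2)] by (auto simp: up_def)
    qed (use b in \<open>auto simp: up_def\<close>)
  qed
  moreover obtain a where a: "a \<in> A" "a \<notin> B"
    using adjacent_belowD(3)[OF assms(1)] by blast
  have "a \<in> up A"
    using a sub(1) le_refl[of a] by (auto simp: up_def)
  moreover have "a \<notin> up B"
  proof
    assume "a \<in> up B"
    then obtain b where b: "b \<in> B" "(b, a) \<in> r"
      by (auto simp: up_def)
    then have "b \<notin> A"
      using A a by (auto simp: antichain_def)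
    then show False
      using lowerD[OF adjacent_belowD(2)[OF assms(1)], of a b] a b by blast
  qed
  ultimately show "up B \<subset> up A"
    by blast
qed simp

text \<open>No element has neighbours both below and above it in the other antichain, as these would
  be comparable. Hence the points touched by a relation going up from \<open>A\<close> to
  \<open>B\<close> are closed under neighbours, and all relations point the same way.\<close>

lemma connected_lower:
  assumes A: "antichain r A" and B: "antichain r B" and con: "order_connected r (sym_diff A B)"
  shows "lower r A B \<or> lower r B A"
proof -
  define K where "K = {x \<in> A - B. \<exists>y\<in>B - A. (x, y) \<in> r} \<union> {y \<in> B - A. \<exists>x\<in>A - B. (x, y) \<in> r}"
  have K_iff: "x \<in> K \<longleftrightarrow> (\<exists>y\<in>B - A. (x, y) \<in> r)" if "x \<in> A - B" for x
    using that by (auto simp: K_def)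
  have K_iff': "y \<in> K \<longleftrightarrow> (\<exists>x\<in>A - B. (x, y) \<in> r)" if "y \<in> B - A" for y
    using that by (auto simp: K_def)
  have no: "(y, x) \<notin> r" if xy: "x \<in> A - B" "y \<in> B - A" "x \<in> K \<or> y \<in> K" for x y
  proof
    assume yx: "(y, x) \<in> r"
    from xy(3) show False
    proof
      assume "x \<in> K"
      then obtain y' where y': "y' \<in> B - A" "(x, y') \<in> r"
        using K_iff[OF xy(1)] by blast
      then have "y = y'"
        using le_trans[OF yx y'(2)] B xy by (auto simp: antichain_def)
      then show False
        using le_antisym[OF yx] y'(2) xy by blast
    next
      assume "y \<in> K"
      then obtain x' where x': "x' \<in> A - B" "(x', y) \<in> r"
        using K_iff'[OF xy(2)] by blast
      then have "x = x'"
        using le_trans[OF x'(2) yx] A xy by (auto simp: antichain_def)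
      then show False
        using le_antisym[OF yx] x'(2) xy by blast
    qed
  qed
  have "K = {} \<or> K = sym_diff A B"
  proof (rule ccontr)
    assume neg: "\<not> (K = {} \<or> K = sym_diff A B)"
    have "K \<subseteq> sym_diff A B"
      by (auto simp: K_def)
    then obtain u v where uv: "u \<in> K" "v \<in> sym_diff A B - K" "comparable r u v"
      using order_connected_crossing[OF con, of K] neg by blast
    have "u \<in> sym_diff A B"
      using uv(1) \<open>K \<subseteq> sym_diff A B\<close> by blast
    then consider "u \<in> A - B" "v \<in> A - B" | "u \<in> B - A" "v \<in> B - A" | "u \<in> A - B" "v \<in> B - A" | "u \<in> B - A" "v \<in> A - B"
      using uv(2) by blast
    then show False
    proof cases
      case 1
      then show ?thesis
        using antichain_comparable[OF A _ _ uv(3)] uv(1,2) by blast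
    next
      case 2
      then show ?thesis
        using antichain_comparable[OF B _ _ uv(3)] uv(1,2) by blast
    next
      case 3
      then have "(u, v) \<in> r"
        using no[OF 3] uv by (simp add: comparable_def)
      then show ?thesis
        using K_iff'[OF 3(2)] 3(1) uv(2) by blast
    next
      case 4
      then have "(v, u) \<in> r"
        using no[OF 4(2,1)] uv by (simp add: comparable_def)
      then show ?thesis
        using K_iff[OF 4(2)] 4(1) uv(2) by blast
    qed
  qed
  then show ?thesis
  proof
    assume "K = {}"
    then have "lower r B A"
      using K_iff unfolding lower_def by blast
    then show ?thesis ..
  next
    assume "K = sym_diff A B"
    then have "lower r A B"
      using no unfolding lower_def by blast
    then show ?thesis ..
  qed
qed

lemma connected_adjacent_below:
  assumes "A \<in> antichains" "B \<in> antichains" "order_connected r (sym_diff A B)"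
  shows "adjacent_below A B \<or> adjacent_below B A"
proof -
  have con: "order_connected r (sym_diff B A)"
    using assms(3) by (simp add: Un_commute)
  have ne: "A - B \<noteq> {} \<or> B - A \<noteq> {}"
    using assms(3) by (auto simp: order_connected_def)
  have "lower r A B \<or> lower r B A"
    using assms by (intro connected_lower) auto
  moreover have "lower r A B" if "B - A = {}"
    using that unfolding lower_def by blast
  moreover have "lower r B A" if "A - B = {}"
    using that unfolding lower_def by blast
  ultimately show ?thesis
    using assms(3) con ne unfolding adjacent_below_def by metis
qed

text \<open>By generated filters the order is \<open>A\<close>, \<open>C\<close>, \<open>B\<close>;
  for \<open>B\<close> inside \<open>C\<close> the last two change places to reach the self-dual
  form.\<close>

lemma antichain_triple_if_subset:
  assumes "A \<in> antichains" "B \<in> antichains" "C \<in> antichains"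
    and AC: "adjacent_below A C" and CB: "adjacent_below C B" and AB: "adjacent_below A B"
    and sub: "B \<subseteq> C"
  shows "(A, B, C) \<in> antichain_triples"
proof -
  have ac: "antichain r A" "antichain r B" "antichain r C"
    using assms by auto
  have "C - A \<noteq> {}"
  proof
    assume CA: "C - A = {}"
    obtain x where x: "x \<in> A" "x \<notin> C"
      using adjacent_belowD(3)[OF AC] by blast
    obtain y where y: "y \<in> C" "y \<notin> B"
      using adjacent_belowD(3)[OF CB] by blast
    have "sym_diff A B \<subseteq> A"
      using CA sub by blast
    then have "antichain r (sym_diff A B)"
      using ac(1) antichain_subset by blast
    then have "x = y"
      using order_connected_antichain_unique[OF adjacent_belowD(1)[OF AB]] x y CA sub by blast
    then show False
      using x y by blast
  qed
  then obtain q where q: "q \<in> C" "q \<notin> A"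
    by blast
  have "A \<inter> C \<subseteq> B"
  proof
    fix z assume z: "z \<in> A \<inter> C"
    show "z \<in> B"
    proof (rule ccontr)
      assume zB: "z \<notin> B"
      \<comment> \<open>Now \<open>C - B\<close> would be just \<open>{z}\<close>, so
        \<open>q\<close> is in \<open>B - A\<close>; then some element of \<open>B - A\<close> lies
        above \<open>z\<close>, although both belong to the antichain \<open>C\<close>.\<close>
      have "sym_diff C B \<subseteq> C"
        using sub by blast
      then have "antichain r (sym_diff C B)"
        using ac(3) antichain_subset by blast
      then have "q \<in> B"
        using order_connected_antichain_unique[OF adjacent_belowD(1)[OF CB], of q z] q z zB by blast
      then have "B - A \<noteq> {}" "z \<in> A - B"
        using q z zB by blast+
      then obtain y where y: "y \<in> B - A" "(z, y) \<in> r"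
        using adjacent_below_above[OF AB ac(1)] by metis
      then have "z = y"
        using ac(3) z sub by (auto simp: antichain_def)
      then show False
        using y z by blast
    qed
  qed
  moreover have "lower r B C"
    using sub unfolding lower_def by blast
  ultimately show ?thesis
    using assms adjacent_belowD[OF AC] adjacent_belowD[OF CB] adjacent_belowD[OF AB]
    by (simp add: antichain_triples_def Un_commute)
qed

lemma antichain_triple_if_not_subset:
  assumes "A \<in> antichains" "B \<in> antichains" "C \<in> antichains"
    and AB: "adjacent_below A B" and BC: "adjacent_below B C" and AC: "adjacent_below A C"
    and sub: "\<not> C \<subseteq> B"
  shows "(A, B, C) \<in> antichain_triples"
proof -
  have ac: "antichain r A" "antichain r B" "antichain r C"
    using assms by auto
  have "A \<inter> C \<subseteq> B"
  proof
    fix z assume z: "z \<in> A \<inter> C"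
    show "z \<in> B"
    proof (rule ccontr)
      assume zB: "z \<notin> B"
      then obtain y where y: "y \<in> B - C" "(y, z) \<in> r"
        using adjacent_below_below[OF BC ac(3), of z] z by blast
      have "y \<notin> A"
        using y z zB ac(1) by (auto simp: antichain_def)
      then show False
        using lowerD[OF adjacent_belowD(2)[OF AB], of z y] y z zB by blast
    qed
  qed
  then show ?thesis
    using assms adjacent_belowD[OF AC] adjacent_belowD[OF BC] adjacent_belowD[OF AB]
    by (simp add: antichain_triples_def)
qed

text \<open>On the three sets \<open>adjacent_below\<close> is total and has no cycles, hence is a
  linear order.\<close>

lemma antichain_triple_exists:
  assumes T: "T \<subseteq> antichains" "card T = 3"
    and con: "\<And>A B. A \<in> T \<Longrightarrow> B \<in> T \<Longrightarrow> A \<noteq> B \<Longrightarrow> order_connected r (sym_diff A B)"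
  obtains A B C where "(A, B, C) \<in> antichain_triples" "T = {A, B, C}"
proof -
  note result = that
  obtain X Y Z where XYZ: "T = {X, Y, Z}" "X \<noteq> Y" "X \<noteq> Z" "Y \<noteq> Z"
    using T(2) by (auto simp: card_3_iff)
  have ac: "X \<in> antichains" "Y \<in> antichains" "Z \<in> antichains"
    using T(1) XYZ(1) by blast+
  have res: thesis if "A \<in> antichains" "B \<in> antichains" "C \<in> antichains" "T = {A, B, C}"
    "adjacent_below A B" "adjacent_below B C" "adjacent_below A C" for A B C
  proof (cases "C \<subseteq> B")
    case True
    have "T = {A, C, B}"
      using that(4) by (simp add: insert_commute)
    then show thesis
      using result antichain_triple_if_subset[OF that(1,3,2,5,6,7) True] by blast
  next
    case False
    then show thesis
      using result antichain_triple_if_not_subset[OF that(1-3,5-7)] that(4) by blast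
  qed
  have perms: "T = {X, Z, Y}" "T = {Y, X, Z}" "T = {Y, Z, X}" "T = {Z, X, Y}" "T = {Z, Y, X}"
    using XYZ(1) by auto
  note res' = res[OF ac XYZ(1)] res[OF ac(1,3,2) perms(1)] res[OF ac(2,1,3) perms(2)]
    res[OF ac(2,3,1) perms(3)] res[OF ac(3,1,2) perms(4)] res[OF ac(3,2,1) perms(5)]
  have XY: "adjacent_below X Y \<or> adjacent_below Y X" and XZ: "adjacent_below X Z \<or> adjacent_below Z X"
    and YZ: "adjacent_below Y Z \<or> adjacent_below Z Y"
    using connected_adjacent_below ac con XYZ by simp_all
  note f = adjacent_below_up[OF _ ac(1,2)] adjacent_below_up[OF _ ac(2,1)] adjacent_below_up[OF _ ac(1,3)]
    adjacent_below_up[OF _ ac(3,1)] adjacent_below_up[OF _ ac(2,3)] adjacent_below_up[OF _ ac(3,2)]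
  have "\<not> (adjacent_below X Y \<and> adjacent_below Y Z \<and> adjacent_below Z X)"
    "\<not> (adjacent_below Y X \<and> adjacent_below X Z \<and> adjacent_below Z Y)"
    using f by fastforce+
  then consider "adjacent_below X Y" "adjacent_below Y Z" "adjacent_below X Z"
    | "adjacent_below X Z" "adjacent_below Z Y" "adjacent_below X Y"
    | "adjacent_below Y X" "adjacent_below X Z" "adjacent_below Y Z"
    | "adjacent_below Y Z" "adjacent_below Z X" "adjacent_below Y X"
    | "adjacent_below Z X" "adjacent_below X Y" "adjacent_below Z Y"
    | "adjacent_below Z Y" "adjacent_below Y X" "adjacent_below Z X"
    using XY XZ YZ by argo
  then show thesis
    by cases (rule res', assumption, assumption, assumption)+
qed

lemma antichain_triple_adjacent:
  assumes "(A, B, C) \<in> antichain_triples"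
  shows "adjacent_below A B" "adjacent_below A C"
  using antichain_triplesD[OF assms] unfolding adjacent_below_def by blast+

text \<open>\<open>A\<close> has the largest generated filter. If \<open>B\<close> and
  \<open>C\<close> could be exchanged, neither would contain the other, and a comparable pair in
  their symmetric difference would violate \<open>lower\<close> in one direction.\<close>

lemma antichain_triple_unique:
  assumes "(A, B, C) \<in> antichain_triples" "(A', B', C') \<in> antichain_triples"
    and eq: "{A, B, C} = {A', B', C'}"
  shows "A = A' \<and> B = B' \<and> C = C'"
proof -
  note D = antichain_triplesD[OF assms(1)] and D' = antichain_triplesD[OF assms(2)]
  have less: "card (up B) < card (up A)" "card (up C) < card (up A)"
    using adjacent_below_up antichain_triple_adjacent[OF assms(1)] D by simp_all
  have less': "card (up B') < card (up A')" "card (up C') < card (up A')"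
    using adjacent_below_up antichain_triple_adjacent[OF assms(2)] D' by simp_all
  have "A \<in> {A', B', C'}" "A' \<in> {A, B, C}"
    using eq by blast+
  then have A: "A = A'"
    using less less' by auto
  moreover have "B \<noteq> A" "C \<noteq> A" "B' \<noteq> A'" "C' \<noteq> A'"
    using less less' by auto
  moreover have "B \<in> {A', B', C'}" "C \<in> {A', B', C'}"
    using eq by blast+
  moreover have "B \<noteq> C"
    using D(9) by blast
  ultimately consider "B = B'" "C = C'" | "B = C'" "C = B'"
    by auto
  then show ?thesis
  proof cases
    case 2
    obtain z where z: "z \<in> B - C"
      using D'(9) 2 by blast
    obtain y where y: "y \<in> C - B" "comparable r z y"
      using exists_comparable[OF D(14,5) z D(9)] by blast
    then show ?thesis
      using lowerD[OF D(11), of z y] lowerD[OF D'(11), of y z] 2 z by (auto simp: comparable_def)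
  qed (use A in simp)
qed

lemma num_triangular_faces_chain_polytope:
  "num_triangular_faces (chain_polytope P r) = card antichain_triples"
proof -
  let ?h = "\<lambda>(A, B, C). {A, B, C}"
  let ?N = "{T. T \<subseteq> antichains \<and> card T = 3 \<and> (convex hull (indvec ` T)) face_of (chain_polytope P r)}"
  have "inj_on ?h antichain_triples"
  proof (rule inj_onI)
    fix t t' assume "t \<in> antichain_triples" "t' \<in> antichain_triples" "?h t = ?h t'"
    moreover obtain A B C A' B' C' where t: "t = (A, B, C)" "t' = (A', B', C')"
      by (metis prod_cases3)
    ultimately show "t = t'"
      using antichain_triple_unique[of A B C A' B' C'] by simp
  qed
  moreover have "?h ` antichain_triples = ?N"
  proof (intro equalityI subsetI)
    fix T assume "T \<in> ?h ` antichain_triples"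
    then obtain A B C where T: "T = {A, B, C}" "(A, B, C) \<in> antichain_triples"
      by auto
    note D = antichain_triplesD[OF T(2)]
    have "A \<noteq> B" "A \<noteq> C" "B \<noteq> C"
      using D(7-9) by blast+
    then have "card T = 3"
      by (simp add: T(1))
    moreover have "T \<subseteq> antichains"
      using D(1-6) T(1) by simp
    ultimately show "T \<in> ?N"
      using chain_face_if_triple[OF T(2)] T(1) by blast
  next
    fix T assume "T \<in> ?N"
    then have T: "T \<subseteq> antichains" "card T = 3" "convex hull (indvec ` T) face_of (chain_polytope P r)"
      by auto
    obtain A B C where "(A, B, C) \<in> antichain_triples" "T = {A, B, C}"
      using antichain_triple_exists[OF T(1,2) chain_face_connected[OF T(3,2,1)]] by blast
    then show "T \<in> ?h ` antichain_triples"
      by (intro image_eqI[of _ _ "(A, B, C)"]) simp_all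
  qed
  ultimately have "card ?N = card antichain_triples"
    using card_image[of ?h antichain_triples] by argo
  then show ?thesis
    using num_triangular_faces_indvec[OF compact_chain_polytope convex_chain_polytope extreme_points_chain_polytope]
    by argo
qed

end

section \<open>Frames\<close>

text \<open>A cut of \<open>T\<close> pulls back to \<open>S\<close>: \<open>s\<close> goes to the
  side of any element of \<open>T\<close> above it. The choice does not matter, because all of these
  lie above a common element of \<open>T\<close> below \<open>s\<close>. Comparable elements of
  \<open>S\<close> share an upper bound in \<open>T\<close>, hence a side.\<close>

lemma order_connected_dominate:
  assumes "trans r" and S: "order_connected r S"
    and above: "\<And>s. s \<in> S \<Longrightarrow> \<exists>t\<in>T. (s, t) \<in> r" and below: "\<And>s. s \<in> S \<Longrightarrow> \<exists>m\<in>T. (m, s) \<in> r"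
    and near: "\<And>t. t \<in> T \<Longrightarrow> \<exists>s\<in>S. comparable r s t"
  shows "order_connected r T"
proof (rule order_connectedI)
  have tr: "(x, z) \<in> r" if "(x, y) \<in> r" "(y, z) \<in> r" for x y z
    using assms(1) that by (rule transD)
  obtain s where "s \<in> S"
    using S by (auto simp: order_connected_def)
  then show "T \<noteq> {}"
    using above by blast
  fix K assume K: "K \<subseteq> T" "K \<noteq> {}" "K \<noteq> T"
    and nc: "\<And>x y. x \<in> K \<Longrightarrow> y \<in> T - K \<Longrightarrow> \<not> comparable r x y"
  have clopen: "x \<in> K \<longleftrightarrow> y \<in> K" if "x \<in> T" "y \<in> T" "(x, y) \<in> r" for x y
    using nc[of x y] nc[of y x] that by (auto simp: comparable_def)
  define K' where "K' = {s \<in> S. \<exists>t\<in>K. (s, t) \<in> r}"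
  have same: "s \<in> K' \<longleftrightarrow> t \<in> K" if st: "s \<in> S" "t \<in> T" "(s, t) \<in> r" for s t
  proof
    assume "s \<in> K'"
    then obtain t' where t': "t' \<in> K" "(s, t') \<in> r"
      by (auto simp: K'_def)
    obtain m where m: "m \<in> T" "(m, s) \<in> r"
      using below[OF st(1)] by blast
    have "m \<in> K"
      using clopen[OF m(1) _ tr[OF m(2) t'(2)]] t'(1) K(1) by blast
    then show "t \<in> K"
      using clopen[OF m(1) st(2) tr[OF m(2) st(3)]] by blast
  qed (use st in \<open>auto simp: K'_def\<close>)
  have reach: "\<exists>s\<in>S. s \<in> K' \<longleftrightarrow> t \<in> K" if t: "t \<in> T" for t
  proof -
    obtain s where s: "s \<in> S" "comparable r s t"
      using near[OF t] by blast
    obtain t' where t': "t' \<in> T" "(s, t') \<in> r"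
      using above[OF s(1)] by blast
    show ?thesis
    proof (cases "(s, t) \<in> r")
      case False
      then have "(t, t') \<in> r"
        using s(2) tr[OF _ t'(2)] by (auto simp: comparable_def)
      then show ?thesis
        using same[OF s(1) t'] clopen[OF t t'(1)] s(1) by blast
    qed (use same s t in blast)
  qed
  have "K' \<subseteq> S"
    by (auto simp: K'_def)
  moreover have "K' \<noteq> {}" "K' \<noteq> S"
    using reach K by blast+
  ultimately obtain u v where uv: "u \<in> K'" "v \<in> S - K'" "comparable r u v"
    by (rule order_connected_crossing[OF S])
  obtain t where t: "t \<in> T" "(u, t) \<in> r" "(v, t) \<in> r"
    using above[of u] above[of v] uv \<open>K' \<subseteq> S\<close> tr unfolding comparable_def by blast
  then show False
    using same[OF _ t(1,2)] same[OF _ t(1,3)] uv \<open>K' \<subseteq> S\<close> by blast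
qed

text \<open>The middle sets \<open>B\<close> of the triples \<open>(A, B, C)\<close> with prescribed \<open>X = A \<inter> B - C\<close> and
  \<open>Y = B \<inter> C - A\<close> are cuts of \<open>middle r A C X Y\<close>; the filters splitting the region \<open>interval_hull r A C\<close>
  with \<open>X\<close> above and \<open>Y\<close> below the split are splits of the same poset.\<close>

definition interval_hull :: "'a rel \<Rightarrow> 'a set \<Rightarrow> 'a set \<Rightarrow> 'a set" where
  "interval_hull r A C = {d. \<exists>a\<in>A - C. \<exists>c\<in>C - A. (a, d) \<in> r \<and> (d, c) \<in> r}"

definition middle :: "'a rel \<Rightarrow> 'a set \<Rightarrow> 'a set \<Rightarrow> 'a set \<Rightarrow> 'a set \<Rightarrow> 'a set" where
  "middle r A C X Y =
     {q \<in> interval_hull r A C. q \<notin> A \<and> q \<notin> C \<and> (\<forall>x\<in>X. (x, q) \<notin> r) \<and> (\<forall>y\<in>Y. (q, y) \<notin> r)}"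

text \<open>For \<open>B = (A \<inter> C) \<union> X \<union> S \<union> Y\<close> the set tested is
  \<open>sym_diff A B\<close>. The condition on \<open>sym_diff B C\<close> is the same predicate
  for \<open>r\<inverse>\<close>, with \<open>A\<close>, \<open>C\<close> and \<open>X\<close>,
  \<open>Y\<close> exchanged.\<close>

definition low_connected :: "'a rel \<Rightarrow> 'a set \<Rightarrow> 'a set \<Rightarrow> 'a set \<Rightarrow> 'a set \<Rightarrow> 'a set \<Rightarrow> bool" where
  "low_connected r A C X Y S \<longleftrightarrow> order_connected r ((A - C - X) \<union> Y \<union> S)"

text \<open>The block \<open>H - G\<close> of a filter triple, rebuilt from the ideal
  \<open>S\<close> of the middle; region elements below \<open>Y\<close> are forced into it.\<close>

definition low_part :: "'a rel \<Rightarrow> 'a set \<Rightarrow> 'a set \<Rightarrow> 'a set \<Rightarrow> 'a set \<Rightarrow> 'a set \<Rightarrow> 'a set" where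
  "low_part r A C X Y S = (A - C - X) \<union> S \<union> {d \<in> interval_hull r A C. \<exists>y\<in>Y. (d, y) \<in> r}"

lemma interval_hull_converse [simp]: "interval_hull (r\<inverse>) C A = interval_hull r A C"
  by (auto simp: interval_hull_def)

lemma middle_converse [simp]: "middle (r\<inverse>) C A Y X = middle r A C X Y"
  by (auto simp: middle_def)

text \<open>Proper inclusion of \<open>X\<close> and \<open>Y\<close> keeps the third antichain from
  containing \<open>A\<close> or \<open>C\<close>. \<open>XY\<close> makes \<open>X\<close> and
  \<open>Y\<close> fit into one antichain; for filters, it lets a split put \<open>X\<close> above
  and \<open>Y\<close> below.\<close>

locale frame = finite_poset +
  fixes A C X Y :: "'a set"
  assumes A: "A \<subseteq> P" "antichain r A" and C: "C \<subseteq> P" "antichain r C"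
    and lower_AC: "lower r A C" and connected_AC: "order_connected r (sym_diff A C)"
    and X: "X \<subset> A - C" and Y: "Y \<subset> C - A"
    and XY: "\<And>x y. x \<in> X \<Longrightarrow> y \<in> Y \<Longrightarrow> (x, y) \<notin> r"
begin

lemma dual_frame: "frame P (r\<inverse>) C A Y X"
proof -
  interpret dual: finite_poset P "r\<inverse>"
    by (rule dual)
  show ?thesis
    by unfold_locales (use A C X Y XY lower_AC connected_AC in \<open>simp_all add: lower_converse Un_commute\<close>)
qed

abbreviation "D \<equiv> interval_hull r A C"
abbreviation "Q \<equiv> middle r A C X Y"

lemma A_eq: "x \<in> A \<Longrightarrow> y \<in> A \<Longrightarrow> (x, y) \<in> r \<Longrightarrow> x = y"
  using A(2) by (simp add: antichain_def)

lemma C_eq: "x \<in> C \<Longrightarrow> y \<in> C \<Longrightarrow> (x, y) \<in> r \<Longrightarrow> x = y"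
  using C(2) by (simp add: antichain_def)

lemma between_subset: "D \<subseteq> P"
  using le_carrier by (auto simp: interval_hull_def)

lemma betweenE:
  assumes "d \<in> D"
  obtains a c where "a \<in> A - C" "c \<in> C - A" "(a, d) \<in> r" "(d, c) \<in> r"
  using assms unfolding interval_hull_def by blast

lemma betweenI: "a \<in> A - C \<Longrightarrow> c \<in> C - A \<Longrightarrow> (a, d) \<in> r \<Longrightarrow> (d, c) \<in> r \<Longrightarrow> d \<in> D"
  unfolding interval_hull_def by blast

lemma bottom_between: "A - C \<subseteq> D"
proof
  fix a assume a: "a \<in> A - C"
  have "C - A \<noteq> {}"
    using Y by blast
  from exists_comparable[OF connected_AC A(2) a this]
  obtain c where c: "c \<in> C - A" "comparable r a c" .
  then have "(a, c) \<in> r"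
    using lowerD[OF lower_AC a c(1)] by (simp add: comparable_def)
  then show "a \<in> D"
    using betweenI[OF a c(1)] le_refl[of a] a A(1) by blast
qed

lemma top_between: "C - A \<subseteq> D"
proof -
  interpret dual: frame P "r\<inverse>" C A Y X
    by (rule dual_frame)
  show ?thesis
    using dual.bottom_between by simp
qed

lemma between_A: "d \<in> D \<Longrightarrow> d \<in> A \<Longrightarrow> d \<notin> C"
  using A_eq by (metis betweenE Diff_iff)

lemma between_not_above_A: "d \<in> D \<Longrightarrow> a \<in> A \<Longrightarrow> (d, a) \<in> r \<Longrightarrow> d = a"
  by (metis A_eq Diff_iff betweenE le_antisym le_trans)

lemma between_not_below_C: "d \<in> D \<Longrightarrow> c \<in> C \<Longrightarrow> (c, d) \<in> r \<Longrightarrow> d = c"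
  by (metis C_eq Diff_iff betweenE le_antisym le_trans)

lemma common_not_below: "d \<in> D \<Longrightarrow> m \<in> A \<inter> C \<Longrightarrow> (m, d) \<notin> r"
  by (metis C_eq Diff_iff IntE betweenE le_trans)

lemma common_not_above: "d \<in> D \<Longrightarrow> m \<in> A \<inter> C \<Longrightarrow> (d, m) \<notin> r"
  by (metis A_eq Diff_iff IntE betweenE le_trans)

lemma middleD:
  assumes "q \<in> Q"
  shows "q \<in> D" "q \<notin> A" "q \<notin> C" "x \<in> X \<Longrightarrow> (x, q) \<notin> r" "y \<in> Y \<Longrightarrow> (q, y) \<notin> r"
  using assms by (auto simp: middle_def)

lemma middle_subset: "Q \<subseteq> P"
  using between_subset middleD(1) by blast

text \<open>This anchors every middle element at a minimal one that stays in the lower part.\<close>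

lemma middle_below:
  assumes "q \<in> Q"
  obtains a where "a \<in> A - C - X" "(a, q) \<in> r"
  using middleD(1)[OF assms] middleD(4)[OF assms] by (metis betweenE DiffI)

lemma low_part_between: "S \<subseteq> Q \<Longrightarrow> low_part r A C X Y S \<subseteq> D"
  using bottom_between middleD(1) by (auto simp: low_part_def)

lemma low_part_below:
  assumes "S \<subseteq> Q" "d \<in> low_part r A C X Y S"
  obtains a where "a \<in> A - C - X" "(a, d) \<in> r"
proof -
  consider "d \<in> A - C - X" | "d \<in> S" | y where "d \<in> D" "y \<in> Y" "(d, y) \<in> r"
    using assms(2) by (auto simp: low_part_def)
  then show thesis
  proof cases
    case 1
    then show ?thesis
      using that[of d] le_refl[of d] A(1) by blast
  next
    case 2
    then show ?thesis
      using middle_below[of d] assms(1) that by blast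
  next
    case 3
    obtain a c where a: "a \<in> A - C" "(a, d) \<in> r"
      using betweenE[OF 3(1)] by metis
    then have "a \<notin> X"
      using XY[OF _ 3(2)] le_trans[OF a(2) 3(3)] by blast
    then show ?thesis
      using that a by blast
  qed
qed

text \<open>The set in \<open>low_connected\<close> bounds \<open>low_part\<close> from both sides,
  so connectedness passes between them. This is where the two polytopes come to share the condition
  \<open>L\<close>.\<close>

lemma order_connected_low_part:
  assumes S: "S \<subseteq> Q"
  shows "order_connected r (low_part r A C X Y S) \<longleftrightarrow> low_connected r A C X Y S"
proof
  let ?L = "low_part r A C X Y S" and ?T = "(A - C - X) \<union> Y \<union> S"
  have Y': "y \<in> ?L \<and> y \<in> P" if "y \<in> Y" for y
  proof -
    have "y \<in> D" "y \<in> P"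
      using that Y top_between C(1) by blast+
    then show ?thesis
      using that le_refl[of y] unfolding low_part_def by blast
  qed
  have L: "?L \<subseteq> P"
    using low_part_between[OF S] between_subset by blast
  have T: "?T \<subseteq> ?L"
    using Y' by (auto simp: low_part_def)
  {
    assume con: "order_connected r ?L"
    show "low_connected r A C X Y S"
      unfolding low_connected_def
    proof (rule order_connected_dominate[OF trans_r con])
      fix s assume s: "s \<in> ?L"
      show "\<exists>t\<in>?T. (s, t) \<in> r"
        using s le_refl[of s] L by (auto simp: low_part_def)
      show "\<exists>m\<in>?T. (m, s) \<in> r"
        using low_part_below[OF S s] by blast
    next
      fix t assume "t \<in> ?T"
      then have "t \<in> ?L" "(t, t) \<in> r"
        using T L le_refl[of t] by blast+
      then show "\<exists>s\<in>?L. comparable r s t"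
        unfolding comparable_def by blast
    qed
  next
    assume "low_connected r A C X Y S"
    then have con: "order_connected r ?T"
      by (simp add: low_connected_def)
    show "order_connected r ?L"
    proof (rule order_connected_dominate[OF trans_r con])
      fix s assume "s \<in> ?T"
      then have "s \<in> ?L" "(s, s) \<in> r"
        using T L le_refl[of s] by blast+
      then show "\<exists>t\<in>?L. (s, t) \<in> r" "\<exists>t\<in>?L. (t, s) \<in> r"
        by blast+
    next
      fix t assume t: "t \<in> ?L"
      obtain a where "a \<in> A - C - X" "(a, t) \<in> r"
        by (rule low_part_below[OF S t])
      then show "\<exists>s\<in>?T. comparable r s t"
        by (auto simp: comparable_def)
    qed
  }
qed

lemma order_connected_between: "order_connected r D"
proof (rule order_connected_dominate[OF trans_r connected_AC])
  fix s assume "s \<in> sym_diff A C"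
  then have "s \<in> D" "(s, s) \<in> r"
    using bottom_between top_between between_subset le_refl[of s] by blast+
  then show "\<exists>t\<in>D. (s, t) \<in> r" "\<exists>t\<in>D. (t, s) \<in> r"
    by blast+
next
  fix d assume "d \<in> D"
  then obtain a c where "a \<in> A - C" "(a, d) \<in> r"
    by (rule betweenE)
  then show "\<exists>s\<in>sym_diff A C. comparable r s d"
    by (auto simp: comparable_def)
qed

text \<open>The complement of the lower block in the region is the lower block of the dual frame, so
  results on \<open>H - G\<close> carry over to \<open>G - F\<close>.\<close>

lemma between_minus_low_part:
  assumes I: "I \<subseteq> Q"
  shows "D - low_part r A C X Y I = low_part (r\<inverse>) C A Y X (Q - I)"
proof (intro equalityI subsetI)
  fix d assume d: "d \<in> D - low_part r A C X Y I"
  then have d1: "d \<in> D" "d \<notin> A - C - X" "d \<notin> I" "\<And>y. y \<in> Y \<Longrightarrow> (d, y) \<notin> r"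
    by (auto simp: low_part_def)
  show "d \<in> low_part (r\<inverse>) C A Y X (Q - I)"
  proof (cases "\<exists>x\<in>X. (x, d) \<in> r")
    case True
    then show ?thesis
      using d1(1) by (auto simp: low_part_def)
  next
    case False
    have dd: "(d, d) \<in> r"
      using le_refl d1(1) between_subset by blast
    show ?thesis
    proof (cases "d \<in> C")
      case True
      then show ?thesis
        using between_A[OF d1(1)] d1(4) dd by (auto simp: low_part_def)
    next
      case dC: False
      have "d \<notin> A"
        using False dd d1(2) dC by blast
      then have "d \<in> Q"
        using dC False d1 by (auto simp: middle_def)
      then show ?thesis
        using d1(3) by (auto simp: low_part_def)
    qed
  qed
next
  interpret dual: frame P "r\<inverse>" C A Y X
    by (rule dual_frame)
  fix d assume d: "d \<in> low_part (r\<inverse>) C A Y X (Q - I)"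
  then have dD: "d \<in> D"
    using dual.low_part_between[of "Q - I"] by auto
  consider "d \<in> C - A - Y" | "d \<in> Q - I" | x where "x \<in> X" "(x, d) \<in> r"
    using d by (auto simp: low_part_def)
  then have "d \<notin> A - C - X \<and> d \<notin> I \<and> (\<forall>y\<in>Y. (d, y) \<notin> r)"
  proof cases
    case 1
    have "(d, y) \<notin> r" if "y \<in> Y" for y
      using C_eq[of d y] 1 that Y by blast
    then show ?thesis
      using 1 I middleD(3)[of d] by blast
  next
    case 2
    then show ?thesis
      using middleD[of d] by blast
  next
    case 3
    have "d \<notin> A - C - X"
      using A_eq[of x d] 3 X by blast
    moreover have "d \<notin> I"
      using middleD(4)[of d x] 3 I by blast
    moreover have "(d, y) \<notin> r" if "y \<in> Y" for y
      using XY[OF 3(1) that] le_trans[OF 3(2), of y] by blast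
    ultimately show ?thesis
      by blast
  qed
  then show "d \<in> D - low_part r A C X Y I"
    using dD by (auto simp: low_part_def)
qed

lemma low_connected_mono: "dominance_mono r Q (low_connected r A C X Y)"
  unfolding dominance_mono_def
proof (intro allI impI)
  fix S T assume ST: "S \<subseteq> Q" "T \<subseteq> Q" "\<forall>s\<in>S. \<exists>t\<in>T. (s, t) \<in> r" and L: "low_connected r A C X Y S"
  let ?S = "(A - C - X) \<union> Y \<union> S" and ?T = "(A - C - X) \<union> Y \<union> T"
  have AY: "(s, s) \<in> r" if "s \<in> (A - C - X) \<union> Y" for s
    using that A(1) C(1) Y le_refl[of s] by blast
  have con: "order_connected r ?S"
    using L by (simp add: low_connected_def)
  show "low_connected r A C X Y T"
    unfolding low_connected_def
  proof (rule order_connected_dominate[OF trans_r con])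
    fix s assume s: "s \<in> ?S"
    show "\<exists>t\<in>?T. (s, t) \<in> r"
      using s ST(3) AY[of s] by blast
    show "\<exists>t\<in>?T. (t, s) \<in> r"
    proof (cases "s \<in> S")
      case True
      then obtain a where "a \<in> A - C - X" "(a, s) \<in> r"
        using middle_below[of s] ST(1) by blast
      then show ?thesis
        by blast
    qed (use s AY[of s] in blast)
  next
    fix t assume t: "t \<in> ?T"
    show "\<exists>s\<in>?S. comparable r s t"
    proof (cases "t \<in> T")
      case True
      then obtain a where "a \<in> A - C - X" "(a, t) \<in> r"
        using middle_below[of t] ST(2) by blast
      then show ?thesis
        unfolding comparable_def by blast
    qed (use t AY[of t] in \<open>unfold comparable_def, blast\<close>)
  qed
qed

text \<open>Removing \<open>q\<close> leaves at least two mutually incomparable parts, and each of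
  them reaches \<open>q\<close> through an element of \<open>A - C\<close> below
  \<open>q\<close>.\<close>

lemma low_connected_pivot:
  assumes q: "q \<in> Q" and S: "S \<subseteq> Q"
    and L: "low_connected r A C X Y (insert q S)" "\<not> low_connected r A C X Y S"
  obtains d d' where "d \<in> A - C" "d' \<in> A - C" "d \<noteq> d'" "(d, q) \<in> r" "(d', q) \<in> r"
proof -
  define Z where "Z = (A - C - X) \<union> Y \<union> S"
  have con: "order_connected r (insert q Z)" and ncon: "\<not> order_connected r Z"
    using L by (simp_all add: low_connected_def Z_def)
  have "Z \<noteq> {}"
    using X unfolding Z_def by blast
  then obtain K where K: "K \<subseteq> Z" "K \<noteq> {}" "K \<noteq> Z"
    and nc: "\<And>x y. x \<in> K \<Longrightarrow> y \<in> Z - K \<Longrightarrow> \<not> comparable r x y"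
    using ncon unfolding order_connected_def by blast
  have qZ: "q \<notin> Z"
    using con ncon by (metis insert_absorb)
  \<comment> \<open>Let \<open>u\<close> in \<open>K\<close> be comparable to \<open>q\<close>. It
    cannot lie in \<open>Y\<close>; if it lies in \<open>S\<close>, an element of
    \<open>A - C - X\<close> below both \<open>u\<close> and \<open>q\<close> belongs to the same
    part.\<close>
  have pivot: "\<exists>d\<in>K. d \<in> A - C \<and> (d, q) \<in> r"
    if K: "K \<subseteq> Z" "K \<noteq> {}" and nc: "\<And>x y. x \<in> K \<Longrightarrow> y \<in> Z - K \<Longrightarrow> \<not> comparable r x y" for K
  proof -
    have "K \<subseteq> insert q Z" "K \<noteq> insert q Z"
      using K(1) qZ by blast+
    from order_connected_crossing[OF con this(1) K(2) this(2)]
    obtain u v where uv: "u \<in> K" "v \<in> insert q Z - K" "comparable r u v" .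
    then have "v = q"
      using nc by blast
    have KI: "a \<in> K" if "a \<in> A - C - X" "comparable r u a" for a
      using nc[OF uv(1), of a] that unfolding Z_def by blast
    consider "u \<in> A - C - X" | "u \<in> Y" | "u \<in> S"
      using uv(1) K(1) unfolding Z_def by blast
    then show ?thesis
    proof cases
      case 1
      then have "(q, u) \<notin> r"
        using between_not_above_A[OF middleD(1)[OF q], of u] middleD(2)[OF q] by blast
      then show ?thesis
        using uv 1 \<open>v = q\<close> by (auto simp: comparable_def)
    next
      case 2
      then have "(u, q) \<notin> r"
        using between_not_below_C[OF middleD(1)[OF q], of u] middleD(3)[OF q] Y by blast
      then show ?thesis
        using uv 2 \<open>v = q\<close> middleD(5)[OF q 2] by (auto simp: comparable_def)
    next
      case 3
      then have "u \<in> Q"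
        using S by blast
      obtain a where a: "a \<in> A - C - X" "(a, u) \<in> r"
        by (rule middle_below[OF \<open>u \<in> Q\<close>])
      obtain b where b: "b \<in> A - C - X" "(b, q) \<in> r"
        by (rule middle_below[OF q])
      show ?thesis
      proof (cases "(u, q) \<in> r")
        case True
        then show ?thesis
          using KI[OF a(1)] a le_trans[OF a(2) True] by (auto simp: comparable_def)
      next
        case False
        then have "(b, u) \<in> r"
          using uv(3) \<open>v = q\<close> le_trans[OF b(2)] by (auto simp: comparable_def)
        then show ?thesis
          using KI[OF b(1)] b by (auto simp: comparable_def)
      qed
    qed
  qed
  obtain d where d: "d \<in> K" "d \<in> A - C" "(d, q) \<in> r"
    using pivot[OF K(1,2) nc] by blast
  have "Z - K \<subseteq> Z" "Z - K \<noteq> {}"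
    using K by blast+
  moreover have "\<not> comparable r x y" if "x \<in> Z - K" "y \<in> Z - (Z - K)" for x y
    using nc[of y x] that comparable_sym[of r x y] by blast
  ultimately obtain d' where "d' \<in> Z - K" "d' \<in> A - C" "(d', q) \<in> r"
    using pivot[of "Z - K"] by blast
  then show thesis
    using that[of d d'] d by blast
qed

end

section \<open>Counting triangular faces over frames\<close>

context frame
begin

abbreviation "L \<equiv> low_connected r A C X Y"
abbreviation "U \<equiv> low_connected (r\<inverse>) C A Y X"

lemma U_eq: "U S \<longleftrightarrow> order_connected r ((C - A - Y) \<union> X \<union> S)"
  by (simp add: low_connected_def)

lemma cut_triple:
  assumes "B \<in> cuts r Q L U"
  shows "(A, (A \<inter> C) \<union> X \<union> B \<union> Y, C) \<in> antichain_triples"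
proof -
  interpret dual: frame P "r\<inverse>" C A Y X
    by (rule dual_frame)
  let ?B = "(A \<inter> C) \<union> X \<union> B \<union> Y"
  have B: "B \<subseteq> Q" "antichain r B" "L B" "U B"
    using assms by (auto simp: cuts_def)
  have BD: "B \<subseteq> D" "B \<inter> A = {}" "B \<inter> C = {}"
    using B(1) middleD by blast+
  have sub: "X \<subseteq> A" "X \<inter> C = {}" "Y \<subseteq> C" "Y \<inter> A = {}"
    using X Y by blast+
  have cmp: "x = y" if "x \<in> ?B" "y \<in> ?B" "(x, y) \<in> r" for x y
  proof -
    have 1: "(x, y) \<notin> r \<and> (y, x) \<notin> r" if "x \<in> A \<inter> C" "y \<in> B" for x y
      using common_not_below common_not_above BD(1) that by blast
    have 2: "(x, y) \<notin> r \<and> (y, x) \<notin> r" if "x \<in> X" "y \<in> B" for x y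
      using between_not_above_A[of y x] middleD(4)[of y x] BD B(1) sub(1) that by blast
    have 3: "(x, y) \<notin> r \<and> (y, x) \<notin> r" if "x \<in> Y" "y \<in> B" for x y
      using between_not_below_C[of y x] middleD(5)[of y x] BD B(1) sub(3) that by blast
    have 4: "(x, y) \<notin> r \<and> (y, x) \<notin> r" if "x \<in> X" "y \<in> Y" for x y
      using XY[OF that] lowerD[OF lower_AC, of x y] that X Y by blast
    consider "x \<in> A" "y \<in> A" | "x \<in> C" "y \<in> C" | "x \<in> B" "y \<in> B" | "x \<in> A \<inter> C" "y \<in> B" | "y \<in> A \<inter> C" "x \<in> B"
      | "x \<in> X" "y \<in> B" | "y \<in> X" "x \<in> B" | "x \<in> Y" "y \<in> B" | "y \<in> Y" "x \<in> B" | "x \<in> X" "y \<in> Y" | "y \<in> X" "x \<in> Y"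
      using \<open>x \<in> ?B\<close> \<open>y \<in> ?B\<close> sub by blast
    then show ?thesis
      using \<open>(x, y) \<in> r\<close> 1 2 3 4 A_eq C_eq B(2) unfolding antichain_def by cases blast+
  qed
  have diffs: "A - ?B = A - C - X" "?B - A = Y \<union> B" "C - ?B = C - A - Y" "?B - C = X \<union> B"
    using BD sub by blast+
  have sym: "sym_diff A ?B = (A - C - X) \<union> Y \<union> B" "sym_diff ?B C = (C - A - Y) \<union> X \<union> B"
    unfolding diffs by blast+
  have low: "(y, x) \<notin> r" if "x \<in> A - C - X" "y \<in> Y \<union> B" for x y
    using lowerD[OF lower_AC, of x y] between_not_above_A[of y x] that BD Y by blast
  have high: "(y, x) \<notin> r" if "x \<in> X \<union> B" "y \<in> C - A - Y" for x y
    using lowerD[OF lower_AC, of x y] between_not_below_C[of x y] that BD X by blast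
  have "?B \<subseteq> P"
    using A C sub BD(1) between_subset by blast
  moreover have "antichain r ?B"
    using cmp unfolding antichain_def by blast
  moreover have "A - ?B \<noteq> {}" "C - ?B \<noteq> {}"
    unfolding diffs using X Y by blast+
  moreover have "lower r A ?B" "lower r ?B C"
    unfolding lower_def diffs using low high by blast+
  moreover have "order_connected r (sym_diff A ?B)" "order_connected r (sym_diff ?B C)"
    unfolding sym using B(3,4) by (simp_all add: U_eq low_connected_def)
  ultimately show ?thesis
    using A C lower_AC connected_AC unfolding antichain_triples_def by blast
qed

end

context finite_poset
begin

definition frames :: "('a set \<times> 'a set \<times> 'a set \<times> 'a set) set" where
  "frames = {(A, C, X, Y). frame P r A C X Y}"

definition frame_cuts :: "'a set \<times> 'a set \<times> 'a set \<times> 'a set \<Rightarrow> 'a set set" where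
  "frame_cuts = (\<lambda>(A, C, X, Y).
     cuts r (middle r A C X Y) (low_connected r A C X Y) (low_connected (r\<inverse>) C A Y X))"

definition frame_splits :: "'a set \<times> 'a set \<times> 'a set \<times> 'a set \<Rightarrow> 'a set set" where
  "frame_splits = (\<lambda>(A, C, X, Y).
     splits r (middle r A C X Y) (low_connected r A C X Y) (low_connected (r\<inverse>) C A Y X))"

text \<open>Inverse of \<open>cut_triple\<close>: elements of \<open>B\<close> outside
  \<open>A\<close> and \<open>C\<close> are squeezed between \<open>A - B\<close> and
  \<open>C - B\<close>, hence lie in the middle.\<close>

lemma antichain_triple_frame:
  assumes "(A, B, C) \<in> antichain_triples"
  shows "frame P r A C (A \<inter> B - C) (B \<inter> C - A)"
    and "B - A - C \<in> frame_cuts (A, C, A \<inter> B - C, B \<inter> C - A)"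
proof -
  note T = antichain_triplesD[OF assms]
  let ?X = "A \<inter> B - C" and ?Y = "B \<inter> C - A"
  have XY: "(x, y) \<notin> r" if "x \<in> ?X" "y \<in> ?Y" for x y
    using T(5) that unfolding antichain_def by blast
  show fr: "frame P r A C ?X ?Y"
  proof unfold_locales
    show "?X \<subset> A - C" "?Y \<subset> C - A"
      using T(7-9) by blast+
  qed (use T XY in auto)
  interpret frame P r A C ?X ?Y
    by (rule fr)
  have eqs: "(A - C - ?X) \<union> ?Y \<union> (B - A - C) = sym_diff A B" "(C - A - ?Y) \<union> ?X \<union> (B - A - C) = sym_diff B C"
    using T(7) by blast+
  have "B - A - C \<subseteq> Q"
  proof
    fix z assume z: "z \<in> B - A - C"
    then have "z \<in> B - A" "z \<in> B - C"
      by blast+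
    obtain a where a: "a \<in> A - B" "(a, z) \<in> r"
      by (rule antichain_triple_below[OF assms \<open>z \<in> B - A\<close>])
    obtain c where c: "c \<in> C - B" "(z, c) \<in> r"
      by (rule antichain_triple_above[OF assms \<open>z \<in> B - C\<close>])
    have "z \<in> D"
      by (rule betweenI[OF _ _ a(2) c(2)]) (use a c T(7) in blast)+
    moreover have "(x, z) \<notin> r" if "x \<in> ?X" for x
      using T(5) z that unfolding antichain_def by blast
    moreover have "(z, y) \<notin> r" if "y \<in> ?Y" for y
      using T(5) z that unfolding antichain_def by blast
    ultimately show "z \<in> Q"
      using z unfolding middle_def by blast
  qed
  moreover have "antichain r (B - A - C)"
    by (rule antichain_subset[OF T(5)]) blast
  moreover have "L (B - A - C)" "U (B - A - C)"
    using T(13,14) unfolding low_connected_def order_connected_converse eqs by simp_all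
  ultimately show "B - A - C \<in> frame_cuts (A, C, ?X, ?Y)"
    by (simp add: frame_cuts_def cuts_def)
qed

lemma card_antichain_triples: "card antichain_triples = (\<Sum>\<kappa>\<in>frames. card (frame_cuts \<kappa>))"
proof -
  let ?f = "\<lambda>(A, B, C). ((A, C, A \<inter> B - C, B \<inter> C - A), B - A - C)"
  let ?g = "\<lambda>((A, C, X, Y), B). (A, (A \<inter> C) \<union> X \<union> B \<union> Y, C)"
  have gf: "?g (?f t) = t" if "t \<in> antichain_triples" for t
  proof -
    obtain A B C where t: "t = (A, B, C)"
      by (metis prod_cases3)
    have "(A \<inter> C) \<union> (A \<inter> B - C) \<union> (B - A - C) \<union> (B \<inter> C - A) = B"
      using antichain_triplesD(7)[of A B C] that t by blast
    then show ?thesis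
      by (simp add: t)
  qed
  have f: "?f t \<in> Sigma frames frame_cuts" if "t \<in> antichain_triples" for t
  proof -
    obtain A B C where "t = (A, B, C)"
      by (metis prod_cases3)
    then show ?thesis
      using antichain_triple_frame[of A B C] that by (simp add: frames_def)
  qed
  have g: "?g s \<in> antichain_triples" and fg: "?f (?g s) = s" if "s \<in> Sigma frames frame_cuts" for s
  proof -
    obtain A C X Y B where s: "s = ((A, C, X, Y), B)"
      by (metis prod.exhaust)
    then interpret frame P r A C X Y
      using that by (simp add: frames_def)
    have B: "B \<in> cuts r Q L U"
      using that s by (simp add: frame_cuts_def)
    show "?g s \<in> antichain_triples"
      using cut_triple[OF B] by (simp add: s)
    let ?B = "(A \<inter> C) \<union> X \<union> B \<union> Y"
    have "B \<inter> A = {}" "B \<inter> C = {}"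
      using B middleD by (auto simp: cuts_def)
    then have "A \<inter> ?B - C = X" "?B \<inter> C - A = Y" "?B - A - C = B"
      using X Y by blast+
    then show "?f (?g s) = s"
      by (simp add: s)
  qed
  have "bij_betw ?f antichain_triples (Sigma frames frame_cuts)"
    by (rule bij_betw_byWitness[where f' = ?g]) (use f g fg gf in blast)+
  then have "card antichain_triples = card (Sigma frames frame_cuts)"
    by (rule bij_betw_same_card)
  then show ?thesis
    by simp
qed

end

section \<open>Filter triples as splits of frames\<close>

definition minimals :: "'a rel \<Rightarrow> 'a set \<Rightarrow> 'a set" where
  "minimals r S = {x \<in> S. \<forall>y\<in>S. (y, x) \<in> r \<longrightarrow> y = x}"

lemma antichain_minimals: "antichain r (minimals r S)"
  by (auto simp: minimals_def antichain_def)

lemma minimals_subset: "minimals r S \<subseteq> S"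
  by (auto simp: minimals_def)

lemma minimalsD: "x \<in> minimals r S \<Longrightarrow> y \<in> S \<Longrightarrow> (y, x) \<in> r \<Longrightarrow> y = x"
  by (simp add: minimals_def)

context finite_poset
begin

lemma minimal_below:
  assumes "d \<in> S" "S \<subseteq> P"
  obtains m where "m \<in> minimals r S" "(m, d) \<in> r"
proof -
  let ?T = "{x \<in> S. (x, d) \<in> r}"
  have "?T \<noteq> {}"
    using assms le_refl by blast
  then obtain m where m: "m \<in> ?T" "\<And>x. x \<in> ?T \<Longrightarrow> (x, m) \<in> r \<Longrightarrow> x = m"
    using finite_minimal_element[of ?T r] trans_r antisym_r by auto
  have "m \<in> minimals r S"
    using m le_trans[of _ m d] unfolding minimals_def by blast
  then show thesis
    using that m(1) by blast
qed

lemma maximal_above: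
  assumes "d \<in> S" "S \<subseteq> P"
  obtains m where "m \<in> minimals (r\<inverse>) S" "(d, m) \<in> r"
proof -
  interpret dual: finite_poset P "r\<inverse>"
    by (rule dual)
  show thesis
    using dual.minimal_below[OF assms] that by auto
qed

lemma up_filter: "A \<subseteq> P \<Longrightarrow> down_closed (r\<inverse>) P (up A)"
proof (rule filterI)
  show "y \<in> up A" if "x \<in> up A" "(x, y) \<in> r" for x y
    using that(1) le_trans[OF _ that(2)] unfolding up_def by blast
qed (use le_carrier in \<open>auto simp: up_def\<close>)

lemma minimals_up: "A \<subseteq> P \<Longrightarrow> antichain r A \<Longrightarrow> minimals r (up A) = A"
proof (intro equalityI subsetI)
  fix x assume A: "A \<subseteq> P" "antichain r A" and x: "x \<in> minimals r (up A)"
  then obtain a where a: "a \<in> A" "(a, x) \<in> r"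
    by (auto simp: minimals_def up_def)
  then have "a \<in> up A"
    using A(1) le_refl[of a] by (auto simp: up_def)
  then show "x \<in> A"
    using minimalsD[OF x] a by blast
next
  fix x assume A: "A \<subseteq> P" "antichain r A" and x: "x \<in> A"
  have "y = x" if y: "y \<in> up A" "(y, x) \<in> r" for y
  proof -
    obtain a where a: "a \<in> A" "(a, y) \<in> r"
      using y(1) by (auto simp: up_def)
    then have "a = x"
      using A(2) x le_trans[OF a(2) y(2)] by (simp add: antichain_def)
    then show ?thesis
      using le_antisym a y by blast
  qed
  then show "x \<in> minimals r (up A)"
    using x A(1) le_refl[of x] by (auto simp: minimals_def up_def)
qed

lemma up_minimals: "down_closed (r\<inverse>) P F \<Longrightarrow> up (minimals r F) = F"
proof (intro equalityI subsetI)
  fix x assume F: "down_closed (r\<inverse>) P F" and "x \<in> up (minimals r F)"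
  then obtain m where "m \<in> minimals r F" "(m, x) \<in> r"
    by (auto simp: up_def)
  then show "x \<in> F"
    using filter_up[OF F, of m x] by (simp add: minimals_def)
next
  fix x assume F: "down_closed (r\<inverse>) P F" and "x \<in> F"
  then obtain m where "m \<in> minimals r F" "(m, x) \<in> r"
    using minimal_below filter_subset by metis
  then show "x \<in> up (minimals r F)"
    by (auto simp: up_def)
qed

end

context frame
begin

text \<open>Recovers \<open>C - A\<close> from the region, which for a filter triple is
  \<open>H - F\<close>.\<close>

lemma maximals_between: "minimals (r\<inverse>) D = C - A"
proof (intro equalityI subsetI)
  fix d assume d: "d \<in> minimals (r\<inverse>) D"
  then have "d \<in> D"
    by (rule subsetD[OF minimals_subset])
  then obtain a c where "c \<in> C - A" "(d, c) \<in> r"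
    by (rule betweenE)
  then show "d \<in> C - A"
    using minimalsD[OF d, of c] top_between by blast
next
  fix c assume c: "c \<in> C - A"
  have "d = c" if "d \<in> D" "(c, d) \<in> r" for d
    using between_not_below_C that c by blast
  then show "c \<in> minimals (r\<inverse>) D"
    using c top_between by (auto simp: minimals_def)
qed

text \<open>Inside \<open>up A\<close> both the region and its lower part are closed downwards, so
  removing either leaves a filter.\<close>

lemma split_triple:
  assumes "I \<in> splits r Q L U"
  shows "(up A - D, up A - low_part r A C X Y I, up A) \<in> filter_triples"
proof -
  interpret dual: frame P "r\<inverse>" C A Y X
    by (rule dual_frame)
  let ?D = "low_part r A C X Y I"
  have I: "down_closed r Q I" "L I" "U (Q - I)" "I \<subseteq> Q"
    using assms by (auto simp: splits_def down_closed_def)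
  have D_up: "D \<subseteq> up A"
    by (auto simp: interval_hull_def up_def)
  have sub: "?D \<subseteq> D"
    by (rule low_part_between[OF I(4)])
  have upA: "down_closed (r\<inverse>) P (up A)"
    by (rule up_filter[OF A(1)])
  \<comment> \<open>An element of \<open>A\<close> below \<open>p\<close> is not in
    \<open>C\<close>, because nothing in \<open>A \<inter> C\<close> lies below the region; so it
    witnesses that \<open>p\<close> is in the region.\<close>
  have D_down: "p \<in> D" if p: "p \<in> up A" "p' \<in> D" "(p, p') \<in> r" for p p'
  proof -
    obtain a where a: "a \<in> A" "(a, p) \<in> r"
      using p(1) by (auto simp: up_def)
    obtain b c where c: "c \<in> C - A" "(p', c) \<in> r"
      by (rule betweenE[OF p(2)])
    have "a \<notin> A \<inter> C"
      using common_not_below[OF p(2), of a] le_trans[OF a(2) p(3)] by blast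
    then show ?thesis
      using betweenI[of a c p] a c le_trans[OF p(3) c(2)] by blast
  qed
  have low_down: "p \<in> ?D" if p: "p \<in> up A" "p' \<in> ?D" "(p, p') \<in> r" for p p'
  proof -
    have pD: "p \<in> D"
      using D_down[OF p(1) _ p(3)] p(2) sub by blast
    consider "p' \<in> A - C - X" | "p' \<in> I" | y where "y \<in> Y" "(p', y) \<in> r"
      using p(2) by (auto simp: low_part_def)
    then show ?thesis
    proof cases
      case 1
      then have "p = p'"
        using between_not_above_A[OF pD _ p(3)] by blast
      then show ?thesis
        using p(2) by simp
    next
      case 2
      show ?thesis
      proof (cases "\<exists>y\<in>Y. (p, y) \<in> r")
        case True
        then show ?thesis
          using pD by (auto simp: low_part_def)
      next
        case False
        have p'Q: "p' \<in> Q"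
          using 2 I(4) by blast
        have nX: "(x, p) \<notin> r" if "x \<in> X" for x
          using middleD(4)[OF p'Q that] le_trans[OF _ p(3)] by blast
        have "p \<notin> C"
          using between_not_below_C[OF middleD(1)[OF p'Q] _ p(3)] middleD(3)[OF p'Q] by blast
        show ?thesis
        proof (cases "p \<in> A")
          case True
          have "p \<notin> X"
            using nX[of p] le_refl[of p] True A(1) by blast
          then show ?thesis
            using True \<open>p \<notin> C\<close> by (simp add: low_part_def)
        next
          case pA: False
          then have "p \<in> Q"
            using pD \<open>p \<notin> C\<close> nX False by (simp add: middle_def)
          then have "p \<in> I"
            using I(1) 2 p(3) by (auto simp: down_closed_def)
          then show ?thesis
            by (simp add: low_part_def)
        qed
      qed
    next
      case 3
      then show ?thesis
        using pD le_trans[OF p(3) 3(2)] by (auto simp: low_part_def)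
    qed
  qed
  have "down_closed (r\<inverse>) P (up A - D)"
  proof (rule filterI)
    show "up A - D \<subseteq> P"
      using filter_subset[OF upA] by blast
    show "y \<in> up A - D" if "x \<in> up A - D" "(x, y) \<in> r" for x y
      using that D_down[of x y] filter_up[OF upA, of x y] by blast
  qed
  moreover have "down_closed (r\<inverse>) P (up A - ?D)"
  proof (rule filterI)
    show "up A - ?D \<subseteq> P"
      using filter_subset[OF upA] by blast
    show "y \<in> up A - ?D" if "x \<in> up A - ?D" "(x, y) \<in> r" for x y
      using that low_down[of x y] filter_up[OF upA, of x y] by blast
  qed
  moreover have "(up A - ?D) - (up A - D) = low_part (r\<inverse>) C A Y X (Q - I)"
    using between_minus_low_part[OF I(4)] D_up by blast
  moreover have "up A - (up A - ?D) = ?D" "up A - (up A - D) = D"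
    using D_up sub by blast+
  moreover have "order_connected r ?D"
    using order_connected_low_part[OF I(4)] I(2) by simp
  moreover have "order_connected r (low_part (r\<inverse>) C A Y X (Q - I))"
    using dual.order_connected_low_part[of "Q - I"] I(3) by simp
  moreover have "?D \<noteq> {}" "D - ?D \<noteq> {}"
    using calculation(6,7) between_minus_low_part[OF I(4)] by (simp_all add: order_connected_def)
  then have "up A - D \<subset> up A - ?D" "up A - ?D \<subset> up A"
    using sub D_up by blast+
  ultimately show ?thesis
    using upA order_connected_between by (simp add: filter_triples_def)
qed

end

context finite_poset
begin

text \<open>Letting \<open>C\<close> agree with \<open>A\<close> outside the region gives
  \<open>A \<inter> C = A \<inter> F\<close>, and \<open>H - F\<close> becomes exactly the interval
  hull.\<close>

lemma filter_triple_frame: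
  assumes "(F, G, H) \<in> filter_triples"
  defines "A \<equiv> minimals r H"
  defines "C \<equiv> (A - (H - F)) \<union> minimals (r\<inverse>) (H - F)"
  defines "X \<equiv> A \<inter> (G - F)"
  defines "Y \<equiv> minimals (r\<inverse>) (H - F) - G"
  defines "I \<equiv> (H - G) \<inter> middle r A C X Y"
  shows "frame P r A C X Y" "I \<in> frame_splits (A, C, X, Y)"
    "interval_hull r A C = H - F" "low_part r A C X Y I = H - G" "up A = H"
proof -
  let ?M = "minimals (r\<inverse>) (H - F)"
  have T: "down_closed (r\<inverse>) P F" "down_closed (r\<inverse>) P G" "down_closed (r\<inverse>) P H"
    "F \<subset> G" "G \<subset> H" "order_connected r (G - F)" "order_connected r (H - G)" "order_connected r (H - F)"
    using assms(1) by (auto simp: filter_triples_def)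
  have HP: "H \<subseteq> P"
    by (rule filter_subset[OF T(3)])
  have AH: "A \<subseteq> H" and MH: "?M \<subseteq> H - F"
    unfolding A_def by (rule minimals_subset)+
  have Amin: "y = x" if "x \<in> A" "y \<in> H" "(y, x) \<in> r" for x y
    using minimalsD that unfolding A_def by metis
  have Mmax: "y = x" if "x \<in> ?M" "y \<in> H - F" "(x, y) \<in> r" for x y
    using minimalsD[OF that(1,2)] that(3) by simp
  have below: "\<exists>a\<in>A - F. (a, d) \<in> r" if d: "d \<in> H - F" for d
  proof -
    obtain a where a: "a \<in> A" "(a, d) \<in> r"
      using minimal_below[of d H] d HP unfolding A_def by blast
    then have "a \<notin> F"
      using filter_up[OF T(1) _ a(2)] d by blast
    then show ?thesis
      using a by blast
  qed
  have above: "\<exists>c\<in>?M. (d, c) \<in> r" if "d \<in> H - F" for d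
    using maximal_above[OF that] HP by blast
  \<comment> \<open>A common element would be isolated in the connected set \<open>H - F\<close>,
    which has a point in each of its two blocks.\<close>
  have AM: "A \<inter> ?M = {}"
  proof (rule ccontr)
    assume "A \<inter> ?M \<noteq> {}"
    then obtain d where d: "d \<in> A" "d \<in> ?M"
      by blast
    obtain g h where gh: "g \<in> G - F" "h \<in> H - G"
      using T(4,5) by blast
    then have "g \<in> H - F" "h \<in> H - F" "g \<noteq> h"
      using T(4,5) by blast+
    then have "{d} \<noteq> H - F"
      by (metis singletonD)
    moreover have "{d} \<subseteq> H - F"
      using d(2) MH by blast
    ultimately obtain u v where "u \<in> {d}" "v \<in> H - F - {d}" "comparable r u v"
      using order_connected_crossing[OF T(8), of "{d}"] by blast
    then show False
      using Amin[OF d(1), of v] Mmax[OF d(2), of v] by (auto simp: comparable_def)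
  qed
  have AC: "A - C = A - F" "C - A = ?M" "A \<inter> C = A \<inter> F"
    using AH AM MH unfolding C_def by blast+
  have between_eq: "interval_hull r A C = H - F"
  proof (intro equalityI subsetI)
    fix d assume "d \<in> interval_hull r A C"
    then obtain a c where ac: "a \<in> A - F" "c \<in> ?M" "(a, d) \<in> r" "(d, c) \<in> r"
      unfolding interval_hull_def AC by blast
    then have "d \<in> H"
      using filter_up[OF T(3) _ ac(3)] AH by blast
    moreover have "d \<notin> F"
      using filter_up[OF T(1) _ ac(4)] ac(2) MH by blast
    ultimately show "d \<in> H - F"
      by blast
  next
    fix d assume d: "d \<in> H - F"
    then show "d \<in> interval_hull r A C"
      using below[OF d] above[OF d] unfolding interval_hull_def AC by blast
  qed
  have antiA: "antichain r A"
    unfolding A_def by (rule antichain_minimals)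
  have antiM: "antichain r ?M"
    using antichain_minimals[of "r\<inverse>" "H - F"] by simp
  have antiC: "antichain r C"
    unfolding antichain_def
  proof (intro ballI impI)
    fix x y assume xy: "x \<in> C" "y \<in> C" "(x, y) \<in> r"
    then consider "x \<in> A" "y \<in> A" | "x \<in> ?M" "y \<in> ?M" | "x \<in> A \<inter> F" "y \<in> ?M" | "x \<in> ?M" "y \<in> A \<inter> F"
      using AH unfolding C_def by blast
    then show "x = y"
    proof cases
      case 1
      then show ?thesis
        using antiA xy by (simp add: antichain_def)
    next
      case 2
      then show ?thesis
        using antiM xy by (simp add: antichain_def)
    next
      case 3
      then show ?thesis
        using filter_up[OF T(1) _ xy(3)] MH by blast
    next
      case 4
      then show ?thesis
        using Amin[of y x] MH xy by blast
    qed
  qed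
  have con: "order_connected r (sym_diff A C)"
  proof (rule order_connected_dominate[OF trans_r T(8)])
    fix d assume d: "d \<in> H - F"
    then show "\<exists>t\<in>sym_diff A C. (d, t) \<in> r" "\<exists>t\<in>sym_diff A C. (t, d) \<in> r"
      using below[OF d] above[OF d] unfolding AC by blast+
  next
    fix t assume "t \<in> sym_diff A C"
    then have "t \<in> H - F"
      using AH MH unfolding AC by blast
    then show "\<exists>s\<in>H - F. comparable r s t"
      using le_refl[of t] HP unfolding comparable_def by blast
  qed
  have low: "lower r A C"
    unfolding lower_def AC
  proof (intro ballI notI)
    fix x y assume xy: "x \<in> A - F" "y \<in> ?M" "(y, x) \<in> r"
    then have "y = x"
      using Amin[of x y] MH by blast
    then show False
      using xy AM by blast
  qed
  \<comment> \<open>A minimal element below a point outside \<open>G\<close> is itself outside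
    \<open>G\<close>, hence not in \<open>X\<close>.\<close>
  have X_sub: "X \<subset> A - C"
  proof -
    obtain d where d: "d \<in> H" "d \<notin> G"
      using T(5) by blast
    then obtain a where a: "a \<in> A - F" "(a, d) \<in> r"
      using below[of d] T(4) by blast
    have "a \<notin> G"
      using filter_up[OF T(2) _ a(2)] d by blast
    then show ?thesis
      using a unfolding AC X_def by blast
  qed
  have Y_sub: "Y \<subset> C - A"
  proof -
    obtain d where d: "d \<in> G" "d \<notin> F"
      using T(4) by blast
    then obtain c where c: "c \<in> ?M" "(d, c) \<in> r"
      using above[of d] T(5) by blast
    have "c \<in> G"
      using filter_up[OF T(2) _ c(2)] d by blast
    then show ?thesis
      using c unfolding AC Y_def by blast
  qed
  have XY: "(x, y) \<notin> r" if "x \<in> X" "y \<in> Y" for x y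
    using filter_up[OF T(2), of x y] that unfolding X_def Y_def by blast
  have CP: "C \<subseteq> P"
    using AH MH HP unfolding C_def by blast
  show fr: "frame P r A C X Y"
    by unfold_locales (use AH HP antiA CP antiC low con X_sub Y_sub XY in \<open>auto\<close>)
  then interpret frame P r A C X Y .
  interpret dual: frame P "r\<inverse>" C A Y X
    by (rule dual_frame)
  have IQ: "I \<subseteq> Q"
    by (simp add: I_def)
  show low_eq: "low_part r A C X Y I = H - G"
  proof (intro equalityI subsetI)
    fix d assume "d \<in> low_part r A C X Y I"
    then consider "d \<in> A - F - X" | "d \<in> I" | y where "d \<in> H - F" "y \<in> Y" "(d, y) \<in> r"
      unfolding low_part_def between_eq AC by blast
    then show "d \<in> H - G"
    proof cases
      case 1
      then show ?thesis
        using AH unfolding X_def by blast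
    next
      case 2
      then show ?thesis
        unfolding I_def by blast
    next
      case 3
      then show ?thesis
        using filter_up[OF T(2) _ 3(3)] unfolding Y_def by blast
    qed
  next
    fix d assume d: "d \<in> H - G"
    then have dD: "d \<in> H - F"
      using T(4) by blast
    have nX: "(x, d) \<notin> r" if "x \<in> X" for x
      using filter_up[OF T(2), of x d] that d unfolding X_def by blast
    show "d \<in> low_part r A C X Y I"
    proof (cases "\<exists>y\<in>Y. (d, y) \<in> r")
      case True
      then show ?thesis
        using dD unfolding low_part_def between_eq by blast
    next
      case nY: False
      have dd: "(d, d) \<in> r"
        using le_refl[of d] d HP by blast
      have "d \<notin> ?M"
        using nY dd d unfolding Y_def by blast
      then have dC: "d \<notin> C"
        using dD unfolding C_def by blast
      show ?thesis
      proof (cases "d \<in> A")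
        case True
        then show ?thesis
          using dC nX[of d] dd unfolding low_part_def by blast
      next
        case False
        then have "d \<in> Q"
          using dC nX nY dD unfolding middle_def between_eq by blast
        then show ?thesis
          using d unfolding low_part_def I_def by blast
      qed
    qed
  qed
  have "H - F - (H - G) = G - F"
    using T(4,5) by blast
  then have up_eq: "low_part (r\<inverse>) C A Y X (Q - I) = G - F"
    using between_minus_low_part[OF IQ] by (simp add: low_eq between_eq)
  have "down_closed r Q I"
    unfolding down_closed_def
  proof (intro conjI ballI impI)
    fix x y assume xy: "x \<in> Q" "y \<in> I" "(x, y) \<in> r"
    have "x \<notin> G"
      using filter_up[OF T(2) _ xy(3)] xy(2) unfolding I_def by blast
    moreover have "x \<in> H"
      using middleD(1)[OF xy(1)] unfolding between_eq by blast
    ultimately show "x \<in> I"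
      using xy(1) unfolding I_def by blast
  qed (rule IQ)
  moreover have "L I"
    using order_connected_low_part[OF IQ] T(7) by (simp add: low_eq)
  moreover have "U (Q - I)"
    using dual.order_connected_low_part[of "Q - I"] T(6) by (simp add: up_eq)
  ultimately show "I \<in> frame_splits (A, C, X, Y)"
    by (simp add: frame_splits_def splits_def)
  show "interval_hull r A C = H - F"
    by (rule between_eq)
  show "up A = H"
    unfolding A_def by (rule up_minimals[OF T(3)])
qed

definition triple_frame :: "'a set \<times> 'a set \<times> 'a set \<Rightarrow> ('a set \<times> 'a set \<times> 'a set \<times> 'a set) \<times> 'a set" where
  "triple_frame = (\<lambda>(F, G, H).
     let A = minimals r H; M = minimals (r\<inverse>) (H - F); C = (A - (H - F)) \<union> M;
       X = A \<inter> (G - F); Y = M - G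
     in ((A, C, X, Y), (H - G) \<inter> middle r A C X Y))"

text \<open>The index set is the one of \<open>card_antichain_triples\<close>, so the totals can be
  compared frame by frame.\<close>

lemma card_filter_triples: "card filter_triples = (\<Sum>\<kappa>\<in>frames. card (frame_splits \<kappa>))"
proof -
  let ?g = "\<lambda>((A, C, X, Y), I). (up A - interval_hull r A C, up A - low_part r A C X Y I, up A)"
  have f: "triple_frame t \<in> Sigma frames frame_splits" and gf: "?g (triple_frame t) = t"
    if "t \<in> filter_triples" for t
  proof -
    obtain F G H where t: "t = (F, G, H)"
      by (metis prod_cases3)
    then have T: "(F, G, H) \<in> filter_triples"
      using that by simp
    show "triple_frame t \<in> Sigma frames frame_splits"
      using filter_triple_frame(1,2)[OF T] by (simp add: t triple_frame_def Let_def frames_def)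
    have "H - (H - F) = F" "H - (H - G) = G"
      using T by (auto simp: filter_triples_def)
    then show "?g (triple_frame t) = t"
      using filter_triple_frame(3-5)[OF T] by (simp add: t triple_frame_def Let_def)
  qed
  have g: "?g s \<in> filter_triples" and fg: "triple_frame (?g s) = s" if "s \<in> Sigma frames frame_splits" for s
  proof -
    obtain A C X Y I where s: "s = ((A, C, X, Y), I)"
      by (metis prod.exhaust)
    then interpret frame P r A C X Y
      using that by (simp add: frames_def)
    have I: "I \<in> splits r Q L U"
      using that s by (simp add: frame_splits_def)
    show "?g s \<in> filter_triples"
      using split_triple[OF I] by (simp add: s)
    let ?D = "low_part r A C X Y I"
    have IQ: "I \<subseteq> Q"
      using I by (auto simp: splits_def down_closed_def)
    have sub: "D \<subseteq> up A" "?D \<subseteq> D"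
      using low_part_between[OF IQ] by (auto simp: interval_hull_def up_def)
    then have eqs: "up A - (up A - D) = D" "up A - (up A - ?D) = ?D" "up A - ?D - (up A - D) = D - ?D"
      by blast+
    have nD: "a \<notin> D" if "a \<in> A \<inter> C" for a
      using between_A that by blast
    have 1: "(A - D) \<union> (C - A) = C"
      using bottom_between nD by blast
    have XD: "x \<in> D \<and> x \<notin> ?D" if "x \<in> X" for x
    proof -
      have "x \<in> A" "x \<notin> C" "(x, x) \<in> r" "x \<in> D"
        using that X A(1) le_refl[of x] bottom_between by blast+
      then show ?thesis
        using that IQ middleD(2)[of x] XY[of x] unfolding low_part_def by blast
    qed
    have "a \<in> X" if "a \<in> A" "a \<in> D" "a \<notin> ?D" for a
      using between_A[OF that(2,1)] that unfolding low_part_def by blast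
    then have 2: "A \<inter> (D - ?D) = X"
      using XD X by blast
    have YD: "y \<in> ?D \<and> y \<in> C - A" if "y \<in> Y" for y
    proof -
      have "y \<in> C - A" "(y, y) \<in> r" "y \<in> D"
        using that Y C(1) le_refl[of y] top_between by blast+
      then show ?thesis
        using that unfolding low_part_def by blast
    qed
    have "c \<in> Y" if c: "c \<in> C - A" "c \<in> ?D" for c
    proof -
      consider "c \<in> I" | y where "y \<in> Y" "(c, y) \<in> r"
        using c unfolding low_part_def by blast
      then show ?thesis
      proof cases
        case 1
        then show ?thesis
          using IQ middleD(3)[of c] c by blast
      next
        case 2
        then show ?thesis
          using C_eq[of c y] c YD by blast
      qed
    qed
    then have 3: "(C - A) - (up A - ?D) = Y"
      using YD top_between sub by blast
    have 4: "?D \<inter> Q = I"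
      using IQ middleD unfolding low_part_def by blast
    show "triple_frame (?g s) = s"
      using minimals_up[OF A] maximals_between
      by (simp add: s triple_frame_def Let_def eqs 1 2 3 4)
  qed
  have "bij_betw triple_frame filter_triples (Sigma frames frame_splits)"
    by (rule bij_betw_byWitness[where f' = ?g]) (use f g fg gf in blast)+
  then have "card filter_triples = card (Sigma frames frame_splits)"
    by (rule bij_betw_same_card)
  then show ?thesis
    by simp
qed

end

section \<open>Comparison of the two counts\<close>

context finite_poset
begin

text \<open>Order embeddings are injective by antisymmetry, so induced copies can be handled as maps
  from \<open>X_elem\<close>.\<close>

lemma X_free_iff_no_embedding:
  "X_free P r \<longleftrightarrow> \<not> (\<exists>h. range h \<subseteq> P \<and> (\<forall>x y. (x, y) \<in> X_rel \<longleftrightarrow> (h x, h y) \<in> r))"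
proof -
  have "(\<exists>Q\<subseteq>P. poset_isomorphic Q (Restr r Q) UNIV X_rel) \<longleftrightarrow>
    (\<exists>h. range h \<subseteq> P \<and> (\<forall>x y. (x, y) \<in> X_rel \<longleftrightarrow> (h x, h y) \<in> r))" (is "?L \<longleftrightarrow> ?R")
  proof
    assume ?L
    then obtain Q f where Q: "Q \<subseteq> P" "bij_betw f Q UNIV"
      and f: "\<And>a b. a \<in> Q \<Longrightarrow> b \<in> Q \<Longrightarrow> (a, b) \<in> Restr r Q \<longleftrightarrow> (f a, f b) \<in> X_rel"
      unfolding poset_isomorphic_def by blast
    define h where "h = inv_into Q f"
    have h: "h x \<in> Q" "f (h x) = x" for x
      using Q(2) by (auto simp: h_def bij_betw_def inv_into_into f_inv_into_f)
    have "(x, y) \<in> X_rel \<longleftrightarrow> (h x, h y) \<in> r" for x y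
      using f[OF h(1)[of x] h(1)[of y]] h by simp
    then show ?R
      using h(1) Q(1) by blast
  next
    assume ?R
    then obtain h where h: "range h \<subseteq> P" "\<And>x y. (x, y) \<in> X_rel \<longleftrightarrow> (h x, h y) \<in> r"
      by blast
    have "inj h"
    proof (rule injI)
      fix x y assume "h x = h y"
      then have "(x, y) \<in> X_rel" "(y, x) \<in> X_rel"
        using h le_refl[of "h y"] by auto
      then show "x = y"
        using partial_order_on_X_rel by (meson antisymD partial_order_onD(3))
    qed
    have "poset_isomorphic (range h) (Restr r (range h)) UNIV X_rel"
      unfolding poset_isomorphic_def
    proof (intro exI[of _ "inv h"] conjI ballI)
      show "bij_betw (inv h) (range h) UNIV"
        using \<open>inj h\<close> by (simp add: bij_betw_inv_into inj_on_imp_bij_betw)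
      show "(a, b) \<in> Restr r (range h) \<longleftrightarrow> (inv h a, inv h b) \<in> X_rel"
        if "a \<in> range h" "b \<in> range h" for a b
        using that h(2) \<open>inj h\<close> by auto
    qed
    then show ?L
      using h(1) by blast
  qed
  then show ?thesis
    by (simp add: X_free_def)
qed

lemma not_X_free_if:
  assumes r: "(d, e) \<in> r" "(d', e) \<in> r" "(e, u) \<in> r" "(e, u') \<in> r"
    and neq: "d \<noteq> e" "d' \<noteq> e" "u \<noteq> e" "u' \<noteq> e"
    and d: "(d, d') \<notin> r" "(d', d) \<notin> r" and u: "(u, u') \<notin> r" "(u', u) \<notin> r"
  shows "\<not> X_free P r"
proof -
  define h where "h = case_X_elem d d' e u u'"
  have P: "d \<in> P" "d' \<in> P" "e \<in> P" "u \<in> P" "u' \<in> P"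
    using r le_carrier by blast+
  have du: "(d, u) \<in> r" "(d, u') \<in> r" "(d', u) \<in> r" "(d', u') \<in> r"
    using r le_trans by blast+
  have no: "(e, d) \<notin> r" "(e, d') \<notin> r" "(u, e) \<notin> r" "(u', e) \<notin> r"
    using r neq le_antisym by blast+
  then have "(u, d) \<notin> r" "(u, d') \<notin> r" "(u', d) \<notin> r" "(u', d') \<notin> r"
    using r le_trans by blast+
  then have "(x, y) \<in> X_rel \<longleftrightarrow> (h x, h y) \<in> r" for x y
    using r d u du no le_refl P by (cases x; cases y) (simp_all add: h_def X_rel_def)
  moreover have "h x \<in> P" for x
    using P by (cases x) (simp_all add: h_def)
  ultimately show ?thesis
    unfolding X_free_iff_no_embedding by blast
qed

end

context frame
begin

lemma refl_middle: "refl_on Q r"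
  using middle_subset le_refl by (auto simp: refl_on_def)

lemma high_connected_mono: "dominance_mono (r\<inverse>) Q U"
proof -
  interpret dual: frame P "r\<inverse>" C A Y X
    by (rule dual_frame)
  show ?thesis
    using dual.low_connected_mono by simp
qed

lemma card_splits_le: "card (splits r Q L U) \<le> card (cuts r Q L U)"
  by (rule card_splits_le_cuts[OF trans_r antisym_r _ refl_middle low_connected_mono high_connected_mono]) simp

text \<open>An element pivotal for both \<open>L\<close> and \<open>U\<close> has two elements of
  the antichain \<open>A\<close> below it and two of the antichain \<open>C\<close> above it, which
  gives a forbidden copy.\<close>

lemma card_splits_eq:
  assumes "X_free P r"
  shows "card (splits r Q L U) = card (cuts r Q L U)"
proof (rule card_splits_eq_cuts[OF trans_r antisym_r _ refl_middle low_connected_mono high_connected_mono])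
  fix q assume q: "q \<in> Q"
  show "(\<forall>S\<subseteq>Q. L (insert q S) \<longrightarrow> L S) \<or> (\<forall>S\<subseteq>Q. U (insert q S) \<longrightarrow> U S)"
  proof (rule ccontr)
    assume "\<not> ?thesis"
    then obtain S T where S: "S \<subseteq> Q" "L (insert q S)" "\<not> L S" and T: "T \<subseteq> Q" "U (insert q T)" "\<not> U T"
      by blast
    interpret dual: frame P "r\<inverse>" C A Y X
      by (rule dual_frame)
    obtain d d' where d: "d \<in> A - C" "d' \<in> A - C" "d \<noteq> d'" "(d, q) \<in> r" "(d', q) \<in> r"
      by (rule low_connected_pivot[OF q S])
    obtain u u' where u: "u \<in> C - A" "u' \<in> C - A" "u \<noteq> u'" "(q, u) \<in> r" "(q, u') \<in> r"
      using dual.low_connected_pivot[of q T] q T by auto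
    have "\<not> X_free P r"
    proof (rule not_X_free_if[OF d(4,5) u(4,5)])
      show "d \<noteq> q" "d' \<noteq> q" "u \<noteq> q" "u' \<noteq> q"
        using d u middleD(2,3)[OF q] by blast+
      show "(d, d') \<notin> r" "(d', d) \<notin> r"
        using d A_eq by blast+
      show "(u, u') \<notin> r" "(u', u) \<notin> r"
        using u C_eq by blast+
    qed
    then show False
      using assms by contradiction
  qed
qed simp

end

context finite_poset
begin

text \<open>Take the two lower and the two upper elements of the copy as \<open>A\<close> and
  \<open>C\<close>, with \<open>X\<close> and \<open>Y\<close> empty. The centre \<open>h E\<close>
  lies in the middle and joins each pair, while neither pair is connected by itself.\<close>

lemma strict_frame_exists:
  assumes "\<not> X_free P r"
  shows "\<exists>\<kappa>\<in>frames. card (frame_splits \<kappa>) < card (frame_cuts \<kappa>)"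
proof -
  obtain h where h: "range h \<subseteq> P" "\<And>x y. (x, y) \<in> X_rel \<longleftrightarrow> (h x, h y) \<in> r"
    using assms X_free_iff_no_embedding by blast
  let ?A = "{h D1, h D2}" and ?C = "{h U1, h U2}"
  have hr: "(h x, h y) \<in> r \<longleftrightarrow> (x, y) \<in> X_rel" for x y
    using h(2) by simp
  have eq: "h x = h y \<longleftrightarrow> x = y" for x y
  proof
    assume "h x = h y"
    moreover have "h y \<in> P"
      using h(1) by blast
    ultimately have "(h x, h y) \<in> r" "(h y, h x) \<in> r"
      using le_refl[of "h y"] by simp_all
    then have "(x, y) \<in> X_rel" "(y, x) \<in> X_rel"
      by (simp_all only: hr)
    then show "x = y"
      using partial_order_on_X_rel by (meson antisymD partial_order_onD(3))
  qed simp
  have diff: "?A - ?C = ?A" "?C - ?A = ?C"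
    by (auto simp: eq)
  have con_star: "order_connected r (insert z S)" if "\<And>s. s \<in> S \<Longrightarrow> comparable r z s" for z S
  proof (rule order_connectedI)
    fix K assume K: "K \<subseteq> insert z S" "K \<noteq> {}" "K \<noteq> insert z S"
      and nc: "\<And>x y. x \<in> K \<Longrightarrow> y \<in> insert z S - K \<Longrightarrow> \<not> comparable r x y"
    show False
    proof (cases "z \<in> K")
      case True
      then obtain s where "s \<in> S - K"
        using K by blast
      then show False
        using nc[OF True, of s] that by blast
    next
      case False
      then obtain s where "s \<in> S" "s \<in> K"
        using K by blast
      then show False
        using nc[of s z] False that comparable_sym[of r z s] by blast
    qed
  qed simp
  \<comment> \<open>The star around \<open>h E\<close> stays connected without its centre, since the
    outer points bound it from both sides.\<close>
  have con_AC: "order_connected r (?A \<union> ?C)"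
  proof (rule order_connected_dominate[OF trans_r, of "insert (h E) (?A \<union> ?C)"])
    show "order_connected r (insert (h E) (?A \<union> ?C))"
      by (rule con_star) (auto simp: comparable_def hr X_rel_def)
  qed (auto simp: comparable_def hr X_rel_def)
  have fr: "frame P r ?A ?C {} {}"
  proof unfold_locales
    show "order_connected r (sym_diff ?A ?C)"
      using con_AC unfolding diff .
  qed (use h(1) in \<open>auto simp: antichain_def lower_def hr eq X_rel_def\<close>)
  interpret frame P r ?A ?C "{}" "{}"
    by (rule fr)
  have "h E \<in> Q"
    by (auto simp: middle_def interval_hull_def hr eq X_rel_def)
  have "order_connected r (insert (h E) ?A)" "order_connected r (insert (h E) ?C)"
    by (rule con_star, auto simp: comparable_def hr X_rel_def)+
  then have "L {h E}" "U {h E}"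
    unfolding low_connected_def diff order_connected_converse by (simp_all add: insert_commute)
  moreover have "\<not> L {}" "\<not> U {}"
    using order_connected_antichain_unique[OF _ A(2), of "h D1" "h D2"]
      order_connected_antichain_unique[OF _ C(2), of "h U1" "h U2"]
    unfolding low_connected_def diff order_connected_converse by (auto simp: eq)
  ultimately have "card (splits r Q L U) < card (cuts r Q L U)"
    using \<open>h E \<in> Q\<close>
    by (intro card_splits_less_cuts[OF trans_r antisym_r _ refl_middle low_connected_mono high_connected_mono]) auto
  then show ?thesis
    using fr by (intro bexI[of _ "(?A, ?C, {}, {})"]) (simp_all add: frames_def frame_cuts_def frame_splits_def)
qed

lemma triangular_faces_comparison:
  "num_triangular_faces (order_polytope P r) \<le> num_triangular_faces (chain_polytope P r) \<and>
   (num_triangular_faces (order_polytope P r) = num_triangular_faces (chain_polytope P r) \<longleftrightarrow> X_free P r)"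
proof -
  let ?s = "\<lambda>\<kappa>. card (frame_splits \<kappa>)" and ?t = "\<lambda>\<kappa>. card (frame_cuts \<kappa>)"
  have le: "?s \<kappa> \<le> ?t \<kappa>" if "\<kappa> \<in> frames" for \<kappa>
  proof -
    obtain A C X Y where \<kappa>: "\<kappa> = (A, C, X, Y)"
      by (metis prod_cases4)
    then interpret frame P r A C X Y
      using that by (simp add: frames_def)
    show ?thesis
      using card_splits_le by (simp add: \<kappa> frame_cuts_def frame_splits_def)
  qed
  have eq: "?s \<kappa> = ?t \<kappa>" if "X_free P r" "\<kappa> \<in> frames" for \<kappa>
  proof -
    obtain A C X Y where \<kappa>: "\<kappa> = (A, C, X, Y)"
      by (metis prod_cases4)
    then interpret frame P r A C X Y
      using that by (simp add: frames_def)
    show ?thesis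
      using card_splits_eq[OF that(1)] by (simp add: \<kappa> frame_cuts_def frame_splits_def)
  qed
  have "sum ?s frames \<le> sum ?t frames"
    using le by (rule sum_mono)
  moreover have "sum ?s frames = sum ?t frames" if "X_free P r"
    using eq[OF that] by (intro sum.cong refl) blast
  moreover have "sum ?s frames < sum ?t frames" if "\<not> X_free P r"
    using le strict_frame_exists[OF that] by (intro sum_strict_mono_ex1) auto
  ultimately show ?thesis
    unfolding num_triangular_faces_order_polytope num_triangular_faces_chain_polytope
      card_filter_triples card_antichain_triples
    by (metis less_irrefl)
qed

end

theorem theorem4p1:
  fixes P :: "'a::finite set" and r :: "'a rel"
  assumes "partial_order_on P r"
  shows "num_triangular_faces (order_polytope P r) \<le> num_triangular_faces (chain_polytope P r) \<and>
         (num_triangular_faces (order_polytope P r) = num_triangular_faces (chain_polytope P r)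
            \<longleftrightarrow> X_free P r)"
proof -
  interpret finite_poset P r
    by unfold_locales (rule assms)
  show ?thesis
    by (rule triangular_faces_comparison)
qed

end
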